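(* Let $\mathcal{D}$ be a set and let $J$ be the Com-PreLie ideal of $\mathit{CP}(\mathcal{D})$ generated by the elements $$\tau_d\bullet(F_1\times F_2)-\tau_d\bullet(F_1\cdot F_2),\qquad d\in\mathcal{D},\ F_1,F_2\in\mathcal{PT}(\mathcal{D}).$$ 1. If $T,T'\in\mathcal{PT}(\mathcal{D})$ are equal as decorated rooted forests (i.e. after forgetting the blocks), then $T+J=T'+J$. Consequently, if $F$ is a decorated rooted forest, the element $T'+J$ does not depend on the choice of $T'\in\mathcal{PT}(\mathcal{D})$ such that $T'=F$ as a decorated rooted forest; this element is identified with $F$. 2. The set of rooted forests decorated by $\mathcal{D}$ is a basis of $\mathit{CP}(\mathcal{D})/J$. Hence $\mathit{CP}(\mathcal{D})/J$ is, as an algebra, identified with the Connes-Kreimer algebra $\mathcal{H}_{CK}^{\mathcal{D}}$ of rooted trees decorated by $\mathcal{D}$ (the vector space with basis the decorated rooted forests, with product the disjoint union), which in this way becomes a unitary Com-PreLie algebra.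
   Context: $\mathbb{K}$ is a field of characteristic zero. A Com-PreLie algebra is a vector space $A$ with bilinear products $\cdot,\bullet$ such that $\cdot$ is associative and commutative, $(a\bullet b)\bullet c-a\bullet(b\bullet c)=(a\bullet c)\bullet b-a\bullet(c\bullet b)$ and $(a\cdot b)\bullet c=(a\bullet c)\cdot b+a\cdot(b\bullet c)$ for all $a,b,c$; unitary if $(A,\cdot)$ has a unit. A Com-PreLie ideal is a subspace $I$ with $I\cdot A\subseteq I$, $I\bullet A\subseteq I$ and $A\bullet I\subseteq I$. For $a,b,c\in A$, $a\bullet(b\times c):=(a\bullet b)\bullet c-a\bullet(b\bullet c)$ (symmetric in $b,c$). A partitioned forest is a (finite) rooted forest $F$ with vertex set $V(F)$, edges oriented from the roots to the leaves, together with a partition of $V(F)$ into blocks such that two vertices in the same block are either both roots or have the same parent. It is a partitioned tree if all its roots lie in one block; the empty forest $\emptyset$ is a partitioned tree. $\mathcal{PT}(\mathcal{D})$ is the set of isomorphism classes of partitioned trees (including $\emptyset$) with vertices decorated by $\mathcal{D}$; $\tau_d$ is the one-vertex tree decorated by $d$; $|T|$ is the number of vertices of $T$. $T\cdot T'$ is the disjoint union of $T$ and $T'$ with their two blocks of roots merged into one block (unit $\emptyset$). For a vertex $s$ of $T$ and $T'\ne\emptyset$, $T\bullet_{s,*}T'$ is obtained by adding edges from $s$ to every root of $T'$, keeping all blocks of $T$ and $T'$ unchanged. $\mathit{CP}(\mathcal{D})$ is the unitary Com-PreLie algebra with basis $\mathcal{PT}(\mathcal{D})$, product $\cdot$, and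 $T\bullet T'=\sum_{s\in V(T)}T\bullet_{s,*}T'$ if $T'\neq\emptyset$, $T\bullet\emptyset=|T|\,T$. *)

theory Defs
  imports
    "Jordan_Normal_Form.VS_Connect"
    "HOL-Algebra.QuotRing"
    "HOL-Library.Poly_Mapping"
    "HOL-Library.Disjoint_Sets"
    "HOL-Library.Nat_Bijection"
begin

section \<open>Unitary Com-PreLie algebras\<close>

text \<open>HOL-Algebra's locale \<open>algebra\<close> provides an associative, commutative, unital algebra;
  its product \<open>\<otimes>\<close> is the product written \<open>\<cdot>\<close> in the mathematical literature. The field
  \<open>prelie\<close> is the second product.\<close>

record ('k, 'a) com_prelie = "('k, 'a) module" +
  prelie :: "['a, 'a] \<Rightarrow> 'a" (infixl \<open>\<triangleleft>\<index>\<close> 70)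

locale unitary_com_prelie = algebra K A + field K
  for K :: "('k, 'm) ring_scheme" and A :: "('k, 'a, 'n) com_prelie_scheme" (structure) +
  assumes prelie_closed:
      "\<lbrakk>a \<in> carrier A; b \<in> carrier A\<rbrakk> \<Longrightarrow> a \<triangleleft> b \<in> carrier A"
    and prelie_add_left:
      "\<lbrakk>a \<in> carrier A; b \<in> carrier A; c \<in> carrier A\<rbrakk>
        \<Longrightarrow> (a \<oplus> b) \<triangleleft> c = a \<triangleleft> c \<oplus> b \<triangleleft> c"
    and prelie_add_right:
      "\<lbrakk>a \<in> carrier A; b \<in> carrier A; c \<in> carrier A\<rbrakk>
        \<Longrightarrow> a \<triangleleft> (b \<oplus> c) = a \<triangleleft> b \<oplus> a \<triangleleft> c"
    and prelie_smult_left: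
      "\<lbrakk>r \<in> carrier K; a \<in> carrier A; b \<in> carrier A\<rbrakk>
        \<Longrightarrow> (r \<odot> a) \<triangleleft> b = r \<odot> (a \<triangleleft> b)"
    and prelie_smult_right:
      "\<lbrakk>r \<in> carrier K; a \<in> carrier A; b \<in> carrier A\<rbrakk>
        \<Longrightarrow> a \<triangleleft> (r \<odot> b) = r \<odot> (a \<triangleleft> b)"
    and prelie_identity:
      "\<lbrakk>a \<in> carrier A; b \<in> carrier A; c \<in> carrier A\<rbrakk>
        \<Longrightarrow> ((a \<triangleleft> b) \<triangleleft> c) \<ominus> (a \<triangleleft> (b \<triangleleft> c))
          = ((a \<triangleleft> c) \<triangleleft> b) \<ominus> (a \<triangleleft> (c \<triangleleft> b))"
    and prelie_leibniz:
      "\<lbrakk>a \<in> carrier A; b \<in> carrier A; c \<in> carrier A\<rbrakk>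
        \<Longrightarrow> (a \<otimes> b) \<triangleleft> c = ((a \<triangleleft> c) \<otimes> b) \<oplus> (a \<otimes> (b \<triangleleft> c))"

text \<open>\<open>prelie_times A a b c\<close> is the element \<open>a \<triangleleft> (b \<times> c)\<close>.\<close>

definition prelie_times :: "('k, 'a, 'n) com_prelie_scheme \<Rightarrow> 'a \<Rightarrow> 'a \<Rightarrow> 'a \<Rightarrow> 'a" where
  "prelie_times A a b c =
    ((a \<triangleleft>\<^bsub>A\<^esub> b) \<triangleleft>\<^bsub>A\<^esub> c) \<ominus>\<^bsub>A\<^esub> (a \<triangleleft>\<^bsub>A\<^esub> (b \<triangleleft>\<^bsub>A\<^esub> c))"

definition com_prelie_ideal ::
    "('k, 'm) ring_scheme \<Rightarrow> ('k, 'a, 'n) com_prelie_scheme \<Rightarrow> 'a set \<Rightarrow> bool" where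
  "com_prelie_ideal K A I \<longleftrightarrow>
    VectorSpace.subspace K I A \<and>
    (\<forall>x\<in>I. \<forall>a\<in>carrier A.
       x \<otimes>\<^bsub>A\<^esub> a \<in> I \<and> x \<triangleleft>\<^bsub>A\<^esub> a \<in> I \<and> a \<triangleleft>\<^bsub>A\<^esub> x \<in> I)"

definition com_prelie_ideal_generated ::
    "('k, 'm) ring_scheme \<Rightarrow> ('k, 'a, 'n) com_prelie_scheme \<Rightarrow> 'a set \<Rightarrow> 'a set" where
  "com_prelie_ideal_generated K A G = \<Inter>{I. com_prelie_ideal K A I \<and> G \<subseteq> I}"

text \<open>The ring part is HOL-Algebra's \<open>A Quot I\<close>; the other two operations are defined on cosets
  in the style of \<open>rcoset_mult\<close>.\<close>

definition com_prelie_quotient ::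
    "('k, 'a, 'n) com_prelie_scheme \<Rightarrow> 'a set \<Rightarrow> ('k, 'a set) com_prelie" where
  "com_prelie_quotient A I =
    \<lparr>carrier = carrier (A Quot I), mult = mult (A Quot I), one = one (A Quot I),
     zero = zero (A Quot I), add = add (A Quot I),
     smult = (\<lambda>r X. \<Union>x\<in>X. I +>\<^bsub>A\<^esub> (r \<odot>\<^bsub>A\<^esub> x)),
     prelie = (\<lambda>X Y. \<Union>x\<in>X. \<Union>y\<in>Y. I +>\<^bsub>A\<^esub> (x \<triangleleft>\<^bsub>A\<^esub> y))\<rparr>"


section \<open>Decorated rooted forests and partitioned trees\<close>

text \<open>Vertices are natural numbers, which loses nothing up to isomorphism since all forests are
  finite. An edge \<open>(u, v)\<close> points from the parent \<open>u\<close> to the child \<open>v\<close>. The values of \<open>deco\<close>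
  outside \<open>verts\<close> are irrelevant.\<close>

record 'd forest =
  verts :: "nat set"
  edges :: "(nat \<times> nat) set"
  deco :: "nat \<Rightarrow> 'd"

record 'd pforest = "'d forest" +
  blocks :: "nat set set"

definition rooted_forest :: "('d, 'z) forest_scheme \<Rightarrow> bool" where
  "rooted_forest F \<longleftrightarrow>
    finite (verts F) \<and> edges F \<subseteq> verts F \<times> verts F \<and> acyclic (edges F) \<and>
    (\<forall>u u' v. (u, v) \<in> edges F \<and> (u', v) \<in> edges F \<longrightarrow> u = u')"

definition roots :: "('d, 'z) forest_scheme \<Rightarrow> nat set" where
  "roots F = {v \<in> verts F. \<forall>u. (u, v) \<notin> edges F}"

definition partitioned_forest :: "'d pforest \<Rightarrow> bool" where
  "partitioned_forest F \<longleftrightarrow>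
    rooted_forest F \<and> partition_on (verts F) (blocks F) \<and>
    (\<forall>B\<in>blocks F. \<forall>v\<in>B. \<forall>w\<in>B.
       (v \<in> roots F \<and> w \<in> roots F) \<or> (\<exists>u. (u, v) \<in> edges F \<and> (u, w) \<in> edges F))"

definition partitioned_tree :: "'d pforest \<Rightarrow> bool" where
  "partitioned_tree F \<longleftrightarrow>
    partitioned_forest F \<and> (\<forall>v\<in>roots F. \<forall>w\<in>roots F. \<exists>B\<in>blocks F. v \<in> B \<and> w \<in> B)"

definition forest_isom ::
    "(nat \<Rightarrow> nat) \<Rightarrow> ('d, 'y) forest_scheme \<Rightarrow> ('d, 'z) forest_scheme \<Rightarrow> bool" where
  "forest_isom f F G \<longleftrightarrow>
    bij_betw f (verts F) (verts G) \<and>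
    (\<forall>v\<in>verts F. \<forall>w\<in>verts F. (v, w) \<in> edges F \<longleftrightarrow> (f v, f w) \<in> edges G) \<and>
    (\<forall>v\<in>verts F. deco G (f v) = deco F v)"

definition pforest_isom :: "(nat \<Rightarrow> nat) \<Rightarrow> 'd pforest \<Rightarrow> 'd pforest \<Rightarrow> bool" where
  "pforest_isom f F G \<longleftrightarrow> forest_isom f F G \<and> blocks G = (\<lambda>B. f ` B) ` blocks F"

definition rforest_equiv :: "'d forest \<Rightarrow> 'd forest \<Rightarrow> bool" where
  "rforest_equiv F G \<longleftrightarrow> rooted_forest F \<and> rooted_forest G \<and> (\<exists>f. forest_isom f F G)"

definition ptree_equiv :: "'d pforest \<Rightarrow> 'd pforest \<Rightarrow> bool" where
  "ptree_equiv F G \<longleftrightarrow> partitioned_tree F \<and> partitioned_tree G \<and> (\<exists>f. pforest_isom f F G)"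

lemma forest_isom_id: "forest_isom id F F"
  by (simp add: forest_isom_def)

lemma forest_isom_comp:
  assumes "forest_isom f F G" and "forest_isom g G H"
  shows "forest_isom (g \<circ> f) F H"
proof -
  have bij: "bij_betw f (verts F) (verts G)" using assms(1) by (simp add: forest_isom_def)
  have im: "f v \<in> verts G" if "v \<in> verts F" for v
    using bij that by (auto dest: bij_betwE)
  have bij': "bij_betw (g \<circ> f) (verts F) (verts H)"
    using assms by (auto simp: forest_isom_def intro: bij_betw_trans)
  show ?thesis
    using assms im bij' by (simp add: forest_isom_def)
qed

lemma forest_isom_inv:
  assumes "forest_isom f F G"
  shows "forest_isom (the_inv_into (verts F) f) G F"
proof -
  let ?g = "the_inv_into (verts F) f"
  have bij: "bij_betw f (verts F) (verts G)" using assms by (simp add: forest_isom_def)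
  have g: "bij_betw ?g (verts G) (verts F)" by (rule bij_betw_the_inv_into[OF bij])
  have in_F: "?g w \<in> verts F" if "w \<in> verts G" for w using g that by (auto dest: bij_betwE)
  have fg: "f (?g w) = w" if "w \<in> verts G" for w
    using bij that by (rule f_the_inv_into_f_bij_betw)
  show ?thesis
    unfolding forest_isom_def
  proof (intro conjI ballI)
    fix v w assume vw: "v \<in> verts G" "w \<in> verts G"
    have "(?g v, ?g w) \<in> edges F \<longleftrightarrow> (f (?g v), f (?g w)) \<in> edges G"
      using assms in_F vw by (simp add: forest_isom_def)
    then show "(v, w) \<in> edges G \<longleftrightarrow> (?g v, ?g w) \<in> edges F"
      using fg vw by simp
  next
    fix v assume v: "v \<in> verts G"
    have "deco G (f (?g v)) = deco F (?g v)"
      using assms in_F v by (simp add: forest_isom_def)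
    then show "deco F (?g v) = deco G v" using fg v by simp
  qed (rule g)
qed

lemma pforest_isom_inv:
  assumes "pforest_isom f F G" and "partitioned_tree F"
  shows "pforest_isom (the_inv_into (verts F) f) G F"
proof -
  let ?g = "the_inv_into (verts F) f"
  have iso: "forest_isom f F G" and bl: "blocks G = (\<lambda>B. f ` B) ` blocks F"
    using assms(1) by (auto simp: pforest_isom_def)
  have inj: "inj_on f (verts F)" using iso by (simp add: forest_isom_def bij_betw_def)
  have sub: "B \<subseteq> verts F" if "B \<in> blocks F" for B
    using assms(2) that unfolding partitioned_tree_def partitioned_forest_def partition_on_def
    by auto
  have "?g ` f ` B = B" if "B \<in> blocks F" for B
  proof -
    have "?g (f v) = v" if "v \<in> B" for v
      using the_inv_into_f_f[OF inj] sub[OF \<open>B \<in> blocks F\<close>] that by blast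
    then show ?thesis by (simp add: image_image)
  qed
  then have "(\<lambda>B. ?g ` B) ` blocks G = blocks F"
    by (simp add: bl image_image)
  then show ?thesis using forest_isom_inv[OF iso] by (simp add: pforest_isom_def)
qed

lemma pforest_isom_comp:
  assumes "pforest_isom f F G" and "pforest_isom g G H"
  shows "pforest_isom (g \<circ> f) F H"
proof -
  have "forest_isom (g \<circ> f) F H"
    using assms by (auto simp: pforest_isom_def intro: forest_isom_comp)
  then show ?thesis using assms by (simp add: pforest_isom_def image_image)
qed

definition empty_forest :: "'d forest" where
  "empty_forest = \<lparr>verts = {}, edges = {}, deco = (\<lambda>_. undefined)\<rparr>"

definition empty_pforest :: "'d pforest" where
  "empty_pforest = \<lparr>verts = {}, edges = {}, deco = (\<lambda>_. undefined), blocks = {}\<rparr>"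

definition single_pforest :: "'d \<Rightarrow> 'd pforest" where
  "single_pforest d = \<lparr>verts = {0}, edges = {}, deco = (\<lambda>_. d), blocks = {{0}}\<rparr>"

lemma rooted_forest_empty: "rooted_forest empty_forest"
  by (simp add: rooted_forest_def empty_forest_def acyclic_def)

lemma partitioned_tree_empty: "partitioned_tree empty_pforest"
  by (simp add: partitioned_tree_def partitioned_forest_def rooted_forest_def empty_pforest_def
      acyclic_def roots_def partition_on_def)

lemma partitioned_tree_single: "partitioned_tree (single_pforest d)"
  by (simp add: partitioned_tree_def partitioned_forest_def rooted_forest_def single_pforest_def
      acyclic_def roots_def partition_on_def)

text \<open>Isomorphism classes of finite decorated rooted forests and of partitioned trees.\<close>

quotient_type 'd rforest = "'d forest" / partial: rforest_equiv
proof (rule part_equivpI)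
  show "\<exists>F :: 'd forest. rforest_equiv F F"
    using rooted_forest_empty forest_isom_id unfolding rforest_equiv_def by blast
  show "symp (rforest_equiv :: 'd forest \<Rightarrow> _)"
    unfolding rforest_equiv_def by (intro sympI) (blast dest: forest_isom_inv)
  show "transp (rforest_equiv :: 'd forest \<Rightarrow> _)"
    unfolding rforest_equiv_def by (intro transpI) (blast dest: forest_isom_comp)
qed

quotient_type 'd ptree = "'d pforest" / partial: ptree_equiv
proof (rule part_equivpI)
  have "pforest_isom id F F" for F :: "'d pforest"
    by (simp add: pforest_isom_def forest_isom_id)
  then show "\<exists>F :: 'd pforest. ptree_equiv F F"
    using partitioned_tree_empty unfolding ptree_equiv_def by blast
  show "symp (ptree_equiv :: 'd pforest \<Rightarrow> _)"
    unfolding ptree_equiv_def by (intro sympI) (blast dest: pforest_isom_inv)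
  show "transp (ptree_equiv :: 'd pforest \<Rightarrow> _)"
    unfolding ptree_equiv_def by (intro transpI) (blast dest: pforest_isom_comp)
qed

definition RF :: "'d set \<Rightarrow> 'd rforest set" where
  "RF D = abs_rforest ` {F. rooted_forest F \<and> deco F ` verts F \<subseteq> D}"

definition PT :: "'d set \<Rightarrow> 'd ptree set" where
  "PT D = abs_ptree ` {F. partitioned_tree F \<and> deco F ` verts F \<subseteq> D}"

text \<open>Disjoint unions are formed inside \<open>nat\<close> through the bijection
  \<open>sum_encode :: nat + nat \<Rightarrow> nat\<close>.\<close>

abbreviation inl :: "nat \<Rightarrow> nat" where "inl v \<equiv> sum_encode (Inl v)"
abbreviation inr :: "nat \<Rightarrow> nat" where "inr v \<equiv> sum_encode (Inr v)"

definition forest_union ::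
    "('d, 'y) forest_scheme \<Rightarrow> ('d, 'z) forest_scheme \<Rightarrow> 'd forest" where
  "forest_union F G =
    \<lparr>verts = inl ` verts F \<union> inr ` verts G,
     edges = map_prod inl inl ` edges F \<union> map_prod inr inr ` edges G,
     deco = case_sum (deco F) (deco G) \<circ> sum_decode\<rparr>"

text \<open>In a nonempty partitioned tree the set of all roots is a block; subtracting \<open>{{}}\<close> below only
  matters when both arguments are empty.\<close>

definition pforest_mult :: "'d pforest \<Rightarrow> 'd pforest \<Rightarrow> 'd pforest" where
  "pforest_mult F G =
    \<lparr>verts = verts (forest_union F G),
     edges = edges (forest_union F G),
     deco = deco (forest_union F G),
     blocks = (\<lambda>B. inl ` B) ` (blocks F - {roots F}) \<union> (\<lambda>B. inr ` B) ` (blocks G - {roots G})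
       \<union> ({inl ` roots F \<union> inr ` roots G} - {{}})\<rparr>"

text \<open>\<open>pforest_graft F s G\<close> is \<open>F \<bullet>\<^bsub>s,*\<^esub> G\<close>.\<close>

definition pforest_graft :: "'d pforest \<Rightarrow> nat \<Rightarrow> 'd pforest \<Rightarrow> 'd pforest" where
  "pforest_graft F s G =
    \<lparr>verts = verts (forest_union F G),
     edges = edges (forest_union F G) \<union> {inl s} \<times> inr ` roots G,
     deco = deco (forest_union F G),
     blocks = (\<lambda>B. inl ` B) ` blocks F \<union> (\<lambda>B. inr ` B) ` blocks G\<rparr>"

text \<open>The operations on isomorphism classes use the representatives chosen by
  \<open>rep_ptree\<close> and \<open>rep_rforest\<close>; the results do not depend on the choice.\<close>

definition ptree_empty :: "'d ptree" where
  "ptree_empty = abs_ptree empty_pforest"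

definition ptree_single :: "'d \<Rightarrow> 'd ptree" where
  "ptree_single d = abs_ptree (single_pforest d)"

definition ptree_mult :: "'d ptree \<Rightarrow> 'd ptree \<Rightarrow> 'd ptree" where
  "ptree_mult S T = abs_ptree (pforest_mult (rep_ptree S) (rep_ptree T))"

definition rforest_empty :: "'d rforest" where
  "rforest_empty = abs_rforest empty_forest"

definition rforest_mult :: "'d rforest \<Rightarrow> 'd rforest \<Rightarrow> 'd rforest" where
  "rforest_mult F G = abs_rforest (forest_union (rep_rforest F) (rep_rforest G))"

definition forget_blocks :: "'d ptree \<Rightarrow> 'd rforest" where
  "forget_blocks T = abs_rforest (forest.truncate (rep_ptree T))"


section \<open>The algebras\<close>

text \<open>The vector space with basis \<open>X\<close> is realised by the finitely supported functions whose support
  lies in \<open>X\<close>; the basis element \<open>x\<close> is \<open>Poly_Mapping.single x 1\<close>. The scalar field, of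
  characteristic zero, is a type \<open>'k\<close> of class \<open>field_char_0\<close>, and \<open>class_ring\<close> is the
  corresponding ring structure.\<close>

definition free_smult :: "'k::comm_ring_1 \<Rightarrow> ('a \<Rightarrow>\<^sub>0 'k) \<Rightarrow> ('a \<Rightarrow>\<^sub>0 'k)" where
  "free_smult r x = Poly_Mapping.map (\<lambda>c. r * c) x"

definition bilinear_ext ::
    "('a \<Rightarrow> 'b \<Rightarrow> ('c \<Rightarrow>\<^sub>0 'k)) \<Rightarrow> ('a \<Rightarrow>\<^sub>0 'k) \<Rightarrow> ('b \<Rightarrow>\<^sub>0 'k) \<Rightarrow> ('c \<Rightarrow>\<^sub>0 'k::comm_ring_1)"
  where
  "bilinear_ext f x y = (\<Sum>a\<in>Poly_Mapping.keys x. \<Sum>b\<in>Poly_Mapping.keys y.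
     free_smult (Poly_Mapping.lookup x a * Poly_Mapping.lookup y b) (f a b))"

definition ptree_prelie :: "'d ptree \<Rightarrow> 'd ptree \<Rightarrow> ('d ptree \<Rightarrow>\<^sub>0 'k::comm_ring_1)" where
  "ptree_prelie S T =
    (if T = ptree_empty then Poly_Mapping.single S (of_nat (card (verts (rep_ptree S))))
     else \<Sum>s\<in>verts (rep_ptree S).
       Poly_Mapping.single (abs_ptree (pforest_graft (rep_ptree S) s (rep_ptree T))) 1)"

definition CP :: "'d set \<Rightarrow> ('k::field_char_0, 'd ptree \<Rightarrow>\<^sub>0 'k) com_prelie" where
  "CP D =
    \<lparr>carrier = {x. Poly_Mapping.keys x \<subseteq> PT D},
     mult = bilinear_ext (\<lambda>S T. Poly_Mapping.single (ptree_mult S T) 1),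
     one = Poly_Mapping.single ptree_empty 1,
     zero = 0, add = (+), smult = free_smult,
     prelie = bilinear_ext ptree_prelie\<rparr>"

definition CK_ideal :: "'d set \<Rightarrow> ('d ptree \<Rightarrow>\<^sub>0 'k::field_char_0) set" where
  "CK_ideal D = com_prelie_ideal_generated class_ring (CP D)
    {prelie_times (CP D) (Poly_Mapping.single (ptree_single d) 1)
        (Poly_Mapping.single F1 1) (Poly_Mapping.single F2 1)
      \<ominus>\<^bsub>CP D\<^esub> Poly_Mapping.single (ptree_single d) 1 \<triangleleft>\<^bsub>CP D\<^esub>
        (Poly_Mapping.single F1 1 \<otimes>\<^bsub>CP D\<^esub> Poly_Mapping.single F2 1)
     | d F1 F2. d \<in> D \<and> F1 \<in> PT D \<and> F2 \<in> PT D}"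

definition CK_quotient :: "'d set \<Rightarrow> ('k::field_char_0, ('d ptree \<Rightarrow>\<^sub>0 'k) set) com_prelie" where
  "CK_quotient D = com_prelie_quotient (CP D) (CK_ideal D)"

definition ptree_coset :: "'d set \<Rightarrow> 'd ptree \<Rightarrow> ('d ptree \<Rightarrow>\<^sub>0 'k::field_char_0) set" where
  "ptree_coset D T = CK_ideal D +>\<^bsub>CP D\<^esub> Poly_Mapping.single T 1"

text \<open>The element of the quotient identified with a decorated rooted forest.\<close>

definition rforest_coset :: "'d set \<Rightarrow> 'd rforest \<Rightarrow> ('d ptree \<Rightarrow>\<^sub>0 'k::field_char_0) set" where
  "rforest_coset D F = (THE X. \<exists>T\<in>PT D. forget_blocks T = F \<and> X = ptree_coset D T)"

text \<open>The algebra underlying the Connes-Kreimer Hopf algebra.\<close>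

definition HCK :: "'d set \<Rightarrow> ('k::field_char_0, 'd rforest \<Rightarrow>\<^sub>0 'k) module" where
  "HCK D =
    \<lparr>carrier = {x. Poly_Mapping.keys x \<subseteq> RF D},
     mult = bilinear_ext (\<lambda>F G. Poly_Mapping.single (rforest_mult F G) 1),
     one = Poly_Mapping.single rforest_empty 1,
     zero = 0, add = (+), smult = free_smult\<rparr>"

text \<open>The linear extension of \<open>rforest_coset D\<close>.\<close>

definition HCK_ident ::
    "'d set \<Rightarrow> ('d rforest \<Rightarrow>\<^sub>0 'k::field_char_0) \<Rightarrow> ('d ptree \<Rightarrow>\<^sub>0 'k) set" where
  "HCK_ident D x = finsum (CK_quotient D)
    (\<lambda>F. Poly_Mapping.lookup x F \<odot>\<^bsub>CK_quotient D\<^esub> rforest_coset D F) (Poly_Mapping.keys x)"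

text \<open>\<open>HCK D\<close> with the product \<open>\<triangleleft>\<close> of the quotient transported along \<open>HCK_ident D\<close>.\<close>

definition HCK_com_prelie :: "'d set \<Rightarrow> ('k::field_char_0, 'd rforest \<Rightarrow>\<^sub>0 'k) com_prelie" where
  "HCK_com_prelie D = module.extend (HCK D) (com_prelie.fields
    (\<lambda>x y. inv_into (carrier (HCK D)) (HCK_ident D)
       (HCK_ident D x \<triangleleft>\<^bsub>CK_quotient D\<^esub> HCK_ident D y)))"

end

theory Submission
  imports Defs
begin

text \<open>Forgetting the blocks extends linearly to a map \<open>\<phi>\<close> from \<open>CP D\<close> onto the space \<open>HCK D\<close>. With the
  product \<open>F \<triangleleft> G = \<Sum>\<^sub>s F \<bullet>\<^sub>s G\<close> (graft all trees of \<open>G\<close> at the vertex \<open>s\<close> of \<open>F\<close>) the target is a unitary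
  Com-PreLie algebra and \<open>\<phi>\<close> is a morphism; it kills the generators of the ideal \<open>J\<close>, because grafting two
  forests one after the other at a root is grafting their union. Hence \<open>J \<subseteq> ker \<phi>\<close>, and everything
  follows from \<open>J = ker \<phi>\<close>.

  For the converse inclusion, every partitioned tree \<open>T\<close> is congruent modulo \<open>J\<close> to the tree \<open>T'\<close> with
  the same underlying forest and the coarsest partition, by induction on the number of vertices and then on
  the number of children of the roots. If \<open>T\<close> has several roots, it is a product of smaller trees. If it has
  one root \<open>r\<close>, cut off the descendants \<open>F\<close> of one block of children of \<open>r\<close>, so that \<open>T = S \<bullet>\<^sub>r F\<close>. Then
  \<open>T = S \<triangleleft> F - \<Sum>\<^bsub>s \<noteq> r\<^esub> S \<bullet>\<^sub>s F\<close>, where the root of each \<open>S \<bullet>\<^sub>s F\<close> has fewer children, and by induction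
  \<open>S\<close> and \<open>F\<close> may be replaced by \<open>S'\<close> and \<open>F'\<close>. Finally \<open>S' = \<tau> \<bullet> G'\<close> for a forest \<open>G\<close>, and a generator
  of \<open>J\<close> turns \<open>S' \<bullet>\<^sub>r F'\<close> into \<open>\<tau> \<bullet> (G' \<cdot> F') = T'\<close>.\<close>

section \<open>Linear and bilinear extension\<close>

text \<open>The obstacle: a generator merges blocks only at the root of a tree, and only when the
  children of that root come from two root blocks. Other blocks are reached through the ideal
  operations, but \<open>\<triangleleft>\<close> grafts at all vertices at once, so isolating the
  term at \<open>r\<close> leaves remainder terms with as many vertices as \<open>T\<close>. They
  are smaller only because a graft away from the root leaves it with fewer children; hence the
  second component of the measure. Cutting off one block of children with all descendants splits no
  block, so that grafting back recovers the partition of \<open>T\<close>. Coarsening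
  \<open>S\<close> before a generator is applied is essential: a one-rooted tree is a graft onto a
  single vertex only if the children of its root form one block. The coarsest partition depends on
  the edges alone and thus gives a linear section of \<open>\<phi>\<close>. Cosets of
  \<open>J\<close> are then the fibres of \<open>\<phi>\<close>, indexed by elements of
  \<open>HCK D\<close>. The Com-PreLie identities are verified once, for plain forests, and carried
  to both target structures along bijections.\<close>

lemma lookup_free_smult [simp]:
  "Poly_Mapping.lookup (free_smult r x) a = r * Poly_Mapping.lookup x a"
  by (simp add: free_smult_def map.rep_eq when_def)

lemma free_smult_add_right [simp]: "free_smult r (x + y) = free_smult r x + free_smult r y"
  by (rule poly_mapping_eqI) (simp add: lookup_add distrib_left)

lemma free_smult_add_left [simp]: "free_smult (r + s) x = free_smult r x + free_smult s x"
  by (rule poly_mapping_eqI) (simp add: lookup_add distrib_right)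

lemma free_smult_assoc [simp]: "free_smult r (free_smult s x) = free_smult (r * s) x"
  by (rule poly_mapping_eqI) (simp add: mult.assoc)

lemma free_smult_one [simp]: "free_smult 1 x = x"
  by (rule poly_mapping_eqI) simp

lemma free_smult_zero [simp]: "free_smult 0 x = 0" "free_smult r 0 = 0"
  by (rule poly_mapping_eqI, simp)+

lemma free_smult_diff [simp]: "free_smult r (x - y) = free_smult r x - free_smult r y"
  by (rule poly_mapping_eqI) (simp add: lookup_minus right_diff_distrib)

lemma free_smult_sum: "free_smult r (\<Sum>i\<in>A. f i) = (\<Sum>i\<in>A. free_smult r (f i))"
  by (induction A rule: infinite_finite_induct) simp_all

lemma keys_free_smult: "Poly_Mapping.keys (free_smult r x) \<subseteq> Poly_Mapping.keys x"
  by (auto simp: in_keys_iff)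

lemma sum_free_smult_single:
  assumes "finite A" "Poly_Mapping.keys x \<subseteq> A"
  shows "(\<Sum>a\<in>A. free_smult (Poly_Mapping.lookup x a) (Poly_Mapping.single a 1)) = x"
proof (rule poly_mapping_eqI)
  fix b
  have "Poly_Mapping.lookup (\<Sum>a\<in>A. free_smult (Poly_Mapping.lookup x a) (Poly_Mapping.single a 1)) b
     = (\<Sum>a\<in>A. if a = b then Poly_Mapping.lookup x b else 0)"
    by (auto simp: lookup_sum lookup_single when_def intro: sum.cong)
  also have "\<dots> = Poly_Mapping.lookup x b"
    using assms by (auto simp: in_keys_iff)
  finally show "Poly_Mapping.lookup (\<Sum>a\<in>A. free_smult (Poly_Mapping.lookup x a) (Poly_Mapping.single a 1)) b
     = Poly_Mapping.lookup x b" .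
qed

text \<open>An element is the finite sum of its scaled basis vectors. Identities that are linear in
  each argument are reduced to basis elements by one such induction per argument.\<close>

lemma free_induct [consumes 1, case_names zero single add]:
  assumes "Poly_Mapping.keys x \<subseteq> X"
    and "P 0"
    and "\<And>r a. a \<in> X \<Longrightarrow> P (free_smult r (Poly_Mapping.single a 1))"
    and "\<And>y z. P y \<Longrightarrow> P z \<Longrightarrow> P (y + z)"
  shows "P x"
proof -
  have "P (\<Sum>a\<in>A. free_smult (Poly_Mapping.lookup x a) (Poly_Mapping.single a 1))"
    if "finite A" "A \<subseteq> X" for A
    using that by (induction A rule: finite_induct) (simp_all add: assms)
  from this[of "Poly_Mapping.keys x"] show ?thesis
    using assms(1) by (simp add: sum_free_smult_single)
qed

definition linear_ext :: "('a \<Rightarrow> ('c \<Rightarrow>\<^sub>0 'k)) \<Rightarrow> ('a \<Rightarrow>\<^sub>0 'k) \<Rightarrow> ('c \<Rightarrow>\<^sub>0 'k::comm_ring_1)" where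
  "linear_ext f x = (\<Sum>a\<in>Poly_Mapping.keys x. free_smult (Poly_Mapping.lookup x a) (f a))"

text \<open>Coefficients may cancel in \<open>x + y\<close>, so its keys are not the union of the
  keys of \<open>x\<close> and \<open>y\<close>. Summing over a common finite superset makes
  additivity a termwise statement.\<close>

lemma linear_ext_superset:
  assumes "finite A" "Poly_Mapping.keys x \<subseteq> A"
  shows "linear_ext f x = (\<Sum>a\<in>A. free_smult (Poly_Mapping.lookup x a) (f a))"
  unfolding linear_ext_def using assms by (intro sum.mono_neutral_left) (auto simp: in_keys_iff)

lemma linear_ext_add [simp]: "linear_ext f (x + y) = linear_ext f x + linear_ext f y"
proof -
  let ?A = "Poly_Mapping.keys x \<union> Poly_Mapping.keys y"
  have "Poly_Mapping.keys (x + y) \<subseteq> ?A" by (rule Poly_Mapping.keys_add)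
  then show ?thesis
    by (simp add: linear_ext_superset[of ?A] lookup_add sum.distrib)
qed

lemma linear_ext_smult [simp]: "linear_ext f (free_smult r x) = free_smult r (linear_ext f x)"
  by (subst linear_ext_superset[of "Poly_Mapping.keys x"])
     (simp_all add: keys_free_smult linear_ext_def free_smult_sum)

lemma linear_ext_zero [simp]: "linear_ext f 0 = 0"
  by (simp add: linear_ext_def)

lemma linear_ext_single [simp]: "linear_ext f (Poly_Mapping.single a 1) = f a"
  by (simp add: linear_ext_def)

lemma linear_ext_diff [simp]: "linear_ext f (x - y) = linear_ext f x - linear_ext f y"
  by (metis add_diff_cancel_right' linear_ext_add diff_add_cancel)

lemma linear_ext_sum: "linear_ext f (\<Sum>i\<in>A. g i) = (\<Sum>i\<in>A. linear_ext f (g i))"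
  by (induction A rule: infinite_finite_induct) simp_all

text \<open>Currying: the facts on bilinear extensions follow from those on linear ones.\<close>

lemma bilinear_ext_eq_linear_ext:
  "bilinear_ext f x y = linear_ext (\<lambda>a. linear_ext (f a) y) x"
  by (simp add: bilinear_ext_def linear_ext_def free_smult_sum)

lemma linear_ext_fun_add: "linear_ext (\<lambda>a. f a + g a) x = linear_ext f x + linear_ext g x"
  by (simp add: linear_ext_def sum.distrib)

lemma linear_ext_fun_smult: "linear_ext (\<lambda>a. free_smult r (f a)) x = free_smult r (linear_ext f x)"
  by (simp add: linear_ext_def free_smult_sum mult.commute)

lemma bilinear_ext_add_left [simp]:
  "bilinear_ext f (x + y) z = bilinear_ext f x z + bilinear_ext f y z"
  by (simp add: bilinear_ext_eq_linear_ext)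

lemma bilinear_ext_add_right [simp]:
  "bilinear_ext f x (y + z) = bilinear_ext f x y + bilinear_ext f x z"
  by (simp add: bilinear_ext_eq_linear_ext linear_ext_fun_add)

lemma bilinear_ext_smult_left [simp]:
  "bilinear_ext f (free_smult r x) y = free_smult r (bilinear_ext f x y)"
  by (simp add: bilinear_ext_eq_linear_ext)

lemma bilinear_ext_smult_right [simp]:
  "bilinear_ext f x (free_smult r y) = free_smult r (bilinear_ext f x y)"
  by (simp add: bilinear_ext_eq_linear_ext linear_ext_fun_smult)

lemma bilinear_ext_zero [simp]: "bilinear_ext f 0 y = 0" "bilinear_ext f x 0 = 0"
  by (simp_all add: bilinear_ext_def)

lemma bilinear_ext_single [simp]:
  "bilinear_ext f (Poly_Mapping.single a 1) (Poly_Mapping.single b 1) = f a b"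
  by (simp add: bilinear_ext_eq_linear_ext)

lemma bilinear_ext_diff_left [simp]:
  "bilinear_ext f (x - y) z = bilinear_ext f x z - bilinear_ext f y z"
  by (simp add: bilinear_ext_eq_linear_ext)

lemma bilinear_ext_diff_right [simp]:
  "bilinear_ext f x (y - z) = bilinear_ext f x y - bilinear_ext f x z"
  by (metis add_diff_cancel_right' bilinear_ext_add_right diff_add_cancel)

lemma bilinear_ext_sum_left:
  "bilinear_ext f (\<Sum>i\<in>A. g i) y = (\<Sum>i\<in>A. bilinear_ext f (g i) y)"
  by (simp add: bilinear_ext_eq_linear_ext linear_ext_sum)

lemma bilinear_ext_sum_right:
  "bilinear_ext f x (\<Sum>i\<in>A. g i) = (\<Sum>i\<in>A. bilinear_ext f x (g i))"
  by (induction A rule: infinite_finite_induct) simp_all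

lemma keys_sum_subset:
  assumes "\<And>i. i \<in> A \<Longrightarrow> Poly_Mapping.keys (g i) \<subseteq> X"
  shows "Poly_Mapping.keys (\<Sum>i\<in>A. g i) \<subseteq> X"
  using keys_sum[of g A] UN_least[OF assms] by (rule order_trans)

lemma keys_linear_ext:
  assumes "Poly_Mapping.keys x \<subseteq> X" "\<And>a. a \<in> X \<Longrightarrow> Poly_Mapping.keys (f a) \<subseteq> Z"
  shows "Poly_Mapping.keys (linear_ext f x) \<subseteq> Z"
  unfolding linear_ext_def using assms
  by (intro keys_sum_subset order_trans[OF keys_free_smult]) (auto simp del: in_keys_iff)

lemma keys_bilinear_ext:
  assumes "Poly_Mapping.keys x \<subseteq> X" "Poly_Mapping.keys y \<subseteq> Y"
    and "\<And>a b. a \<in> X \<Longrightarrow> b \<in> Y \<Longrightarrow> Poly_Mapping.keys (f a b) \<subseteq> Z"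
  shows "Poly_Mapping.keys (bilinear_ext f x y) \<subseteq> Z"
  unfolding bilinear_ext_eq_linear_ext
  by (intro keys_linear_ext[OF assms(1)] keys_linear_ext[OF assms(2)] assms(3))

text \<open>Criterion for a linear map to respect a product: it is enough to compare basis elements.
  It is applied to the map forgetting the blocks, for both products.\<close>

lemma linear_ext_bilinear_ext:
  assumes "Poly_Mapping.keys x \<subseteq> X" "Poly_Mapping.keys y \<subseteq> Y"
    and "\<And>a b. a \<in> X \<Longrightarrow> b \<in> Y \<Longrightarrow> linear_ext h (f a b) = bilinear_ext g (u a) (v b)"
  shows "linear_ext h (bilinear_ext f x y) = bilinear_ext g (linear_ext u x) (linear_ext v y)"
  using assms(1)
proof (induction x rule: free_induct)
  case (single r a)
  from assms(2) show ?case
    by (induction y rule: free_induct) (simp_all add: assms(3) single)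
qed simp_all

section \<open>Isomorphisms of rooted forests\<close>

lemma nat_sum_cases:
  obtains a where "v = inl a" | b where "v = inr b"
  by (metis sum.exhaust sum_decode_inverse)

text \<open>The copairing of two maps out of the coded disjoint union. All explicit isomorphisms
  below are nested copairings, so that their values on tagged vertices come from rewriting.\<close>

definition case_nat_sum :: "(nat \<Rightarrow> 'a) \<Rightarrow> (nat \<Rightarrow> 'a) \<Rightarrow> nat \<Rightarrow> 'a" where
  "case_nat_sum f g = case_sum f g \<circ> sum_decode"

lemma case_nat_sum_simps [simp]:
  "case_nat_sum f g (inl a) = f a" "case_nat_sum f g (inr b) = g b"
  by (simp_all add: case_nat_sum_def)

lemma case_nat_sum_image [simp]:
  "case_nat_sum f g ` inl ` A = f ` A" "case_nat_sum f g ` inr ` B = g ` B"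
  by (simp_all add: image_image)

lemma inl_inr_eq [simp]:
  "inl a = inl b \<longleftrightarrow> a = b" "inr a = inr b \<longleftrightarrow> a = b" "inl a \<noteq> inr b" "inr b \<noteq> inl a"
  by (simp_all add: inj_eq[OF inj_sum_encode])

lemma inl_inr_mem [simp]:
  "inl a \<in> inl ` A \<longleftrightarrow> a \<in> A" "inr a \<in> inr ` A \<longleftrightarrow> a \<in> A"
  "inl a \<notin> inr ` A" "inr a \<notin> inl ` A"
  by auto

lemma inl_inr_edge [simp]:
  "(inl a, inl b) \<in> map_prod inl inl ` E \<longleftrightarrow> (a, b) \<in> E"
  "(inr a, inr b) \<in> map_prod inr inr ` E \<longleftrightarrow> (a, b) \<in> E"
  "(v, inr b) \<notin> map_prod inl inl ` E" "(inr b, v) \<notin> map_prod inl inl ` E"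
  "(v, inl b) \<notin> map_prod inr inr ` E" "(inl b, v) \<notin> map_prod inr inr ` E"
  by auto

lemma bij_betw_case_nat_sum:
  assumes "inj_on f A" "inj_on g B" "f ` A \<inter> g ` B = {}" "f ` A \<union> g ` B = C"
  shows "bij_betw (case_nat_sum f g) (inl ` A \<union> inr ` B) C"
proof -
  have "f a \<noteq> g b" if "a \<in> A" "b \<in> B" for a b using assms(3) that by blast
  then have "inj_on (case_nat_sum f g) (inl ` A \<union> inr ` B)"
    using assms(1,2) unfolding inj_on_Un
    by (auto simp: inj_on_def)
  then show ?thesis using assms(4) by (simp add: bij_betw_def image_Un)
qed

lemma bij_betw_nat_sum_map:
  assumes f: "bij_betw f A A'" and g: "bij_betw g B B'"
  shows "bij_betw (case_nat_sum (inl \<circ> f) (inr \<circ> g)) (inl ` A \<union> inr ` B) (inl ` A' \<union> inr ` B')"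
proof (rule bij_betw_case_nat_sum)
  have "A' = f ` A" "B' = g ` B" using f g by (simp_all add: bij_betw_def)
  then show "(inl \<circ> f) ` A \<union> (inr \<circ> g) ` B = inl ` A' \<union> inr ` B'"
    by (simp only: image_comp)
qed (use f g in \<open>auto simp: bij_betw_def inj_on_def\<close>)

text \<open>The forest underlying \<open>pforest_graft\<close>. Arguments of arbitrary record
  extensions are allowed, so that partitioned forests can be inserted directly.\<close>

definition forest_graft ::
    "('d, 'y) forest_scheme \<Rightarrow> nat \<Rightarrow> ('d, 'z) forest_scheme \<Rightarrow> 'd forest" where
  "forest_graft F s G =
    \<lparr>verts = verts (forest_union F G),
     edges = edges (forest_union F G) \<union> {inl s} \<times> inr ` roots G,
     deco = deco (forest_union F G)\<rparr>"

lemma forest_union_simps [simp]: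
  "verts (forest_union F G) = inl ` verts F \<union> inr ` verts G"
  "(inl a, inl b) \<in> edges (forest_union F G) \<longleftrightarrow> (a, b) \<in> edges F"
  "(inr a, inr b) \<in> edges (forest_union F G) \<longleftrightarrow> (a, b) \<in> edges G"
  "(inl a, inr b) \<notin> edges (forest_union F G)"
  "(inr a, inl b) \<notin> edges (forest_union F G)"
  "deco (forest_union F G) (inl a) = deco F a"
  "deco (forest_union F G) (inr b) = deco G b"
  by (auto simp: forest_union_def)

lemma forest_graft_simps [simp]:
  "verts (forest_graft F s G) = inl ` verts F \<union> inr ` verts G"
  "(inl a, inl b) \<in> edges (forest_graft F s G) \<longleftrightarrow> (a, b) \<in> edges F"
  "(inr a, inr b) \<in> edges (forest_graft F s G) \<longleftrightarrow> (a, b) \<in> edges G"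
  "(inl a, inr b) \<in> edges (forest_graft F s G) \<longleftrightarrow> a = s \<and> b \<in> roots G"
  "(inr a, inl b) \<notin> edges (forest_graft F s G)"
  "deco (forest_graft F s G) (inl a) = deco F a"
  "deco (forest_graft F s G) (inr b) = deco G b"
  by (auto simp: forest_graft_def)

text \<open>Being a root and having a unique parent concern edges whose source is not yet known to
  be tagged; these rules determine the tag from the target.\<close>

lemma forest_union_edge_into:
  "(u, inl a) \<in> edges (forest_union F G) \<longleftrightarrow> (\<exists>b. u = inl b \<and> (b, a) \<in> edges F)"
  "(u, inr a) \<in> edges (forest_union F G) \<longleftrightarrow> (\<exists>b. u = inr b \<and> (b, a) \<in> edges G)"
  by (cases u rule: nat_sum_cases; simp)+

lemma forest_graft_edge_into:
  "(u, inl a) \<in> edges (forest_graft F s G) \<longleftrightarrow> (\<exists>b. u = inl b \<and> (b, a) \<in> edges F)"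
  "(u, inr a) \<in> edges (forest_graft F s G) \<longleftrightarrow>
    (\<exists>b. u = inr b \<and> (b, a) \<in> edges G) \<or> u = inl s \<and> a \<in> roots G"
  by (cases u rule: nat_sum_cases; simp)+

lemma roots_forest_union [simp]: "roots (forest_union F G) = inl ` roots F \<union> inr ` roots G"
proof (rule Set.set_eqI)
  fix v show "v \<in> roots (forest_union F G) \<longleftrightarrow> v \<in> inl ` roots F \<union> inr ` roots G"
    by (cases v rule: nat_sum_cases) (simp_all add: roots_def forest_union_edge_into)
qed

lemma rooted_forest_edge:
  assumes "rooted_forest F" "(u, v) \<in> edges F"
  shows "u \<in> verts F" "v \<in> verts F"
  using assms by (auto simp: rooted_forest_def)

lemma rooted_forest_finite: "rooted_forest F \<Longrightarrow> finite (verts F)"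
  by (simp add: rooted_forest_def)

lemma rooted_forest_parent:
  "rooted_forest F \<Longrightarrow> (u, v) \<in> edges F \<Longrightarrow> (u', v) \<in> edges F \<Longrightarrow> u = u'"
  by (auto simp: rooted_forest_def)

lemma rooted_forest_wf:
  assumes "rooted_forest F"
  shows "wf (edges F)"
proof -
  have "finite (edges F)"
    using assms unfolding rooted_forest_def by (meson finite_SigmaI finite_subset)
  then show ?thesis using assms by (simp add: rooted_forest_def finite_acyclic_wf)
qed

text \<open>Well-foundedness replaces acyclicity, to which it is equivalent on finite forests,
  because it passes to unions of relations by a simple disjointness condition.\<close>

lemma rooted_forestI:
  assumes "finite (verts F)" "\<And>u v. (u, v) \<in> edges F \<Longrightarrow> u \<in> verts F \<and> v \<in> verts F"
    "wf (edges F)" "\<And>u u' v. (u, v) \<in> edges F \<Longrightarrow> (u', v) \<in> edges F \<Longrightarrow> u = u'"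
  shows "rooted_forest F"
  unfolding rooted_forest_def using assms by (simp add: wf_acyclic subset_iff) blast

lemma roots_empty_iff:
  assumes "rooted_forest F"
  shows "roots F = {} \<longleftrightarrow> verts F = {}"
proof
  assume *: "roots F = {}"
  show "verts F = {}"
  proof (rule ccontr)
    assume "verts F \<noteq> {}"
    then obtain z where "z \<in> verts F" "\<And>y. (y, z) \<in> edges F \<Longrightarrow> y \<notin> verts F"
      using wfE_min'[OF rooted_forest_wf[OF assms]] by metis
    then have "z \<in> roots F" using assms by (auto simp: roots_def dest: rooted_forest_edge)
    then show False using * by simp
  qed
qed (auto simp: roots_def)

lemma roots_forest_graft [simp]:
  assumes "rooted_forest G"
  shows "roots (forest_graft F s G) = inl ` roots F"
proof (rule Set.set_eqI)
  fix v show "v \<in> roots (forest_graft F s G) \<longleftrightarrow> v \<in> inl ` roots F"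
    using assms
    by (cases v rule: nat_sum_cases) (auto simp: roots_def forest_graft_edge_into)
qed

lemma rooted_forest_graft:
  assumes F: "rooted_forest F" and G: "rooted_forest G" and s: "s \<in> verts F"
  shows "rooted_forest (forest_graft F s G)"
proof (rule rooted_forestI)
  let ?L = "map_prod inl inl ` edges F" and ?R = "map_prod inr inr ` edges G"
    and ?C = "{inl s} \<times> inr ` roots G"
  have "wf ?C" by (rule wf_no_loop) auto
  moreover have "wf ?L" "wf ?R"
    using F G by (auto intro!: wf_map_prod_image rooted_forest_wf injI)
  \<comment> \<open>The rule \<open>wf_Un\<close> asks that no target of the second relation be a
    source of the first. Sources in \<open>?L\<close> and \<open>?C\<close> lie in the left copy,
    targets in \<open>?C\<close> and \<open>?R\<close> in the right one: no edge leads back from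
    right to left.\<close>
  ultimately have "wf ((?L \<union> ?C) \<union> ?R)"
    by (intro wf_Un) auto
  moreover have "edges (forest_graft F s G) = (?L \<union> ?C) \<union> ?R"
    by (auto simp: forest_graft_def forest_union_def)
  ultimately show "wf (edges (forest_graft F s G))" by simp
  show "finite (verts (forest_graft F s G))" using F G by (simp add: rooted_forest_finite)
next
  fix u v assume "(u, v) \<in> edges (forest_graft F s G)"
  then show "u \<in> verts (forest_graft F s G) \<and> v \<in> verts (forest_graft F s G)"
    using F G s by (cases u rule: nat_sum_cases; cases v rule: nat_sum_cases)
      (auto dest: rooted_forest_edge simp: roots_def)
next
  fix u u' v assume "(u, v) \<in> edges (forest_graft F s G)" "(u', v) \<in> edges (forest_graft F s G)"
  then show "u = u'"
    by (cases u rule: nat_sum_cases; cases u' rule: nat_sum_cases; cases v rule: nat_sum_cases)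
       (auto simp: roots_def dest: rooted_forest_parent[OF F] rooted_forest_parent[OF G])
qed

lemma rooted_forest_union:
  assumes F: "rooted_forest F" and G: "rooted_forest G"
  shows "rooted_forest (forest_union F G)"
proof (rule rooted_forestI)
  have "wf (map_prod inl inl ` edges F)" "wf (map_prod inr inr ` edges G)"
    using F G by (auto intro!: wf_map_prod_image rooted_forest_wf injI)
  then have "wf (map_prod inl inl ` edges F \<union> map_prod inr inr ` edges G)"
    by (intro wf_Un) auto
  then show "wf (edges (forest_union F G))"
    by (simp add: forest_union_def)
  show "finite (verts (forest_union F G))" using F G by (simp add: rooted_forest_finite)
next
  fix u v assume "(u, v) \<in> edges (forest_union F G)"
  then show "u \<in> verts (forest_union F G) \<and> v \<in> verts (forest_union F G)"
    using F G by (cases u rule: nat_sum_cases; cases v rule: nat_sum_cases)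
      (auto dest: rooted_forest_edge)
next
  fix u u' v assume "(u, v) \<in> edges (forest_union F G)" "(u', v) \<in> edges (forest_union F G)"
  then show "u = u'"
    by (cases u rule: nat_sum_cases; cases u' rule: nat_sum_cases; cases v rule: nat_sum_cases)
       (auto simp: roots_def dest: rooted_forest_parent[OF F] rooted_forest_parent[OF G])
qed

text \<open>An isomorphism only speaks of edges between vertices. Since both arguments are rooted
  forests, every edge into a vertex starts at a vertex, so having no parent is preserved.\<close>

lemma forest_isom_roots:
  assumes "forest_isom f F G" "rooted_forest F" "rooted_forest G"
  shows "roots G = f ` roots F"
proof -
  have im: "verts G = f ` verts F" using assms(1) by (simp add: forest_isom_def bij_betw_def)
  have e: "(u, v) \<in> edges F \<longleftrightarrow> (f u, f v) \<in> edges G" if "u \<in> verts F" "v \<in> verts F" for u v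
    using assms(1) that by (simp add: forest_isom_def)
  have "f v \<in> roots G \<longleftrightarrow> v \<in> roots F" if v: "v \<in> verts F" for v
  proof -
    have "(\<exists>u. (u, f v) \<in> edges G) \<longleftrightarrow> (\<exists>u\<in>verts F. (f u, f v) \<in> edges G)"
      using rooted_forest_edge[OF assms(3)] unfolding im by blast
    also have "\<dots> \<longleftrightarrow> (\<exists>u. (u, v) \<in> edges F)"
      using e v rooted_forest_edge[OF assms(2)] by blast
    finally show ?thesis using v im by (auto simp: roots_def)
  qed
  then show ?thesis using im by (auto simp: roots_def)
qed

lemma forest_isomI:
  assumes "bij_betw f (verts F) (verts G)"
    and "\<And>v w. v \<in> verts F \<Longrightarrow> w \<in> verts F \<Longrightarrow> (v, w) \<in> edges F \<longleftrightarrow> (f v, f w) \<in> edges G"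
    and "\<And>v. v \<in> verts F \<Longrightarrow> deco G (f v) = deco F v"
  shows "forest_isom f F G"
  using assms by (simp add: forest_isom_def)

lemma forest_union_cong:
  assumes "forest_isom f F F'" "forest_isom g G G'"
  shows "forest_isom (case_nat_sum (inl \<circ> f) (inr \<circ> g)) (forest_union F G) (forest_union F' G')"
proof (rule forest_isomI)
  show "bij_betw (case_nat_sum (inl \<circ> f) (inr \<circ> g)) (verts (forest_union F G)) (verts (forest_union F' G'))"
    unfolding forest_union_simps
    by (rule bij_betw_nat_sum_map) (use assms in \<open>auto simp: forest_isom_def\<close>)
qed (use assms in \<open>auto simp: forest_isom_def\<close>)

lemma forest_graft_cong:
  assumes f: "forest_isom f F F'" and g: "forest_isom g G G'"
    and G: "rooted_forest G" "rooted_forest G'" and s: "s \<in> verts F"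
  shows "forest_isom (case_nat_sum (inl \<circ> f) (inr \<circ> g)) (forest_graft F s G) (forest_graft F' (f s) G')"
proof (rule forest_isomI)
  show "bij_betw (case_nat_sum (inl \<circ> f) (inr \<circ> g)) (verts (forest_graft F s G))
      (verts (forest_graft F' (f s) G'))"
    unfolding forest_graft_simps
    by (rule bij_betw_nat_sum_map) (use f g in \<open>auto simp: forest_isom_def\<close>)
next
  have inj: "f v = f s \<longleftrightarrow> v = s" if "v \<in> verts F" for v
    using f s that by (auto simp: forest_isom_def bij_betw_def inj_on_def)
  have root: "g v \<in> roots G' \<longleftrightarrow> v \<in> roots G" if "v \<in> verts G" for v
    using forest_isom_roots[OF g G] g that
    by (auto simp: forest_isom_def bij_betw_def inj_on_def roots_def)
  fix v w
  assume "v \<in> verts (forest_graft F s G)" "w \<in> verts (forest_graft F s G)"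
  then show "(v, w) \<in> edges (forest_graft F s G) \<longleftrightarrow>
      (case_nat_sum (inl \<circ> f) (inr \<circ> g) v, case_nat_sum (inl \<circ> f) (inr \<circ> g) w)
        \<in> edges (forest_graft F' (f s) G')"
    using f g by (auto simp: inj root forest_isom_def)
qed (use f g in \<open>auto simp: forest_isom_def\<close>)

section \<open>Isomorphisms of forests behind the algebraic identities\<close>

lemma forest_union_commute:
  "forest_isom (case_nat_sum inr inl) (forest_union F G) (forest_union G F)"
proof (rule forest_isomI)
  show "bij_betw (case_nat_sum inr inl) (verts (forest_union F G)) (verts (forest_union G F))"
    unfolding forest_union_simps by (intro bij_betw_case_nat_sum) (auto simp: inj_on_def)
qed auto

lemma forest_union_assoc:
  "forest_isom (case_nat_sum (case_nat_sum inl (inr \<circ> inl)) (inr \<circ> inr))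
    (forest_union (forest_union F G) H) (forest_union F (forest_union G H))"
  (is "forest_isom ?h _ _")
proof (rule forest_isomI)
  show "bij_betw ?h (verts (forest_union (forest_union F G) H)) (verts (forest_union F (forest_union G H)))"
    unfolding forest_union_simps by (intro bij_betw_case_nat_sum) (auto simp: inj_on_def image_Un image_image)
qed auto

lemma forest_union_empty:
  assumes "verts F = {}"
  shows "forest_isom inr G (forest_union F G)"
  by (rule forest_isomI) (use assms in \<open>auto simp: bij_betw_def inj_on_def\<close>)

text \<open>The Leibniz rule for a single vertex: a graft at a vertex of one factor does not touch
  the other factor.\<close>

lemma forest_graft_union:
  assumes "s \<in> verts F" "rooted_forest H"
  shows "forest_isom (case_nat_sum (case_nat_sum (inl \<circ> inl) inr) (inl \<circ> inr))
    (forest_graft (forest_union F G) (inl s) H) (forest_union (forest_graft F s H) G)"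
  (is "forest_isom ?h _ _")
proof (rule forest_isomI)
  show "bij_betw ?h (verts (forest_graft (forest_union F G) (inl s) H)) (verts (forest_union (forest_graft F s H) G))"
    unfolding forest_union_simps forest_graft_simps
    by (intro bij_betw_case_nat_sum) (auto simp: inj_on_def image_Un image_image)
qed auto

text \<open>These are the terms that cancel in the associator: grafting \<open>H\<close> onto the
  part that came from \<open>G\<close> may be done before \<open>G\<close> is grafted onto
  \<open>F\<close>.\<close>

lemma forest_graft_graft_inr:
  assumes "rooted_forest G" "rooted_forest H"
  shows "forest_isom (case_nat_sum (case_nat_sum inl (inr \<circ> inl)) (inr \<circ> inr))
    (forest_graft (forest_graft F s G) (inr t) H) (forest_graft F s (forest_graft G t H))"
  (is "forest_isom ?h _ _")
proof (rule forest_isomI)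
  show "bij_betw ?h (verts (forest_graft (forest_graft F s G) (inr t) H)) (verts (forest_graft F s (forest_graft G t H)))"
    unfolding forest_graft_simps
    by (intro bij_betw_case_nat_sum) (auto simp: inj_on_def image_Un image_image)
qed (use assms in auto)

text \<open>Two grafts at vertices of \<open>F\<close> commute, also when \<open>s = t\<close>. This
  is the symmetry in the pre-Lie identity.\<close>

lemma forest_graft_graft_inl:
  "forest_isom (case_nat_sum (case_nat_sum (inl \<circ> inl) inr) (inl \<circ> inr))
    (forest_graft (forest_graft F s G) (inl t) H) (forest_graft (forest_graft F t H) (inl s) G)"
  (is "forest_isom ?h _ _")
proof (rule forest_isomI)
  show "bij_betw ?h (verts (forest_graft (forest_graft F s G) (inl t) H)) (verts (forest_graft (forest_graft F t H) (inl s) G))"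
    unfolding forest_graft_simps
    by (intro bij_betw_case_nat_sum) (auto simp: inj_on_def image_Un image_image)
qed auto

section \<open>Partitioned trees\<close>

lemma partition_on_Un:
  assumes "partition_on A P" "partition_on B Q" "A \<inter> B = {}"
  shows "partition_on (A \<union> B) (P \<union> Q)"
  using assms unfolding partition_on_def by (auto intro!: disjoint_union)

lemma partition_on_image:
  assumes "partition_on A P" "inj_on f A"
  shows "partition_on (f ` A) ((`) f ` P)"
proof -
  have "(`) f ` P - {{}} = (`) f ` P" using partition_onD3[OF assms(1)] by auto
  then show ?thesis using partition_on_inj_image[OF assms] by simp
qed

text \<open>The case \<open>B = {}\<close> covers the empty tree, whose set of roots is not a
  block.\<close>

lemma partition_on_remove:
  assumes P: "partition_on A P" and B: "B = {} \<or> B \<in> P"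
  shows "partition_on (A - B) (P - {B})"
proof -
  have "C \<inter> B = {}" if "C \<in> P" "C \<noteq> B" for C
    using B partition_onD2[OF P] that by (auto simp: disjoint_def)
  then have "\<Union>(P - {B}) = A - B"
    using partition_onD1[OF P] B by blast
  moreover have "disjoint (P - {B})"
    using partition_onD2[OF P] by (auto simp: disjoint_def)
  ultimately show ?thesis using partition_onD3[OF P] by (auto simp: partition_on_def)
qed

lemma partition_on_eq:
  "partition_on A P \<Longrightarrow> B \<in> P \<Longrightarrow> C \<in> P \<Longrightarrow> v \<in> B \<Longrightarrow> v \<in> C \<Longrightarrow> B = C"
  by (auto simp: partition_on_def disjoint_def)

text \<open>The definition compares vertices in pairs. Uniqueness of parents turns this into a
  uniform alternative: a block is the whole set of roots or has one common parent.\<close>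

lemma partitioned_tree_iff:
  "partitioned_tree F \<longleftrightarrow>
    rooted_forest F \<and> partition_on (verts F) (blocks F) \<and>
    (\<forall>B\<in>blocks F. B = roots F \<or> (\<exists>u. \<forall>v\<in>B. (u, v) \<in> edges F)) \<and>
    (roots F = {} \<or> roots F \<in> blocks F)"
  (is "_ \<longleftrightarrow> ?rhs")
proof
  assume T: "partitioned_tree F"
  then have F: "rooted_forest F" and P: "partition_on (verts F) (blocks F)"
    and B: "\<And>B v w. B \<in> blocks F \<Longrightarrow> v \<in> B \<Longrightarrow> w \<in> B \<Longrightarrow>
       (v \<in> roots F \<and> w \<in> roots F) \<or> (\<exists>u. (u, v) \<in> edges F \<and> (u, w) \<in> edges F)"
    and R: "\<And>v w. v \<in> roots F \<Longrightarrow> w \<in> roots F \<Longrightarrow> \<exists>B\<in>blocks F. v \<in> B \<and> w \<in> B"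
    unfolding partitioned_tree_def partitioned_forest_def by blast+
  have root: "B = roots F" if B': "B \<in> blocks F" "r \<in> B" "r \<in> roots F" for B r
  proof
    show "B \<subseteq> roots F"
      using B[OF B'(1,2)] B'(3) by (auto simp: roots_def)
    show "roots F \<subseteq> B"
    proof
      fix v assume "v \<in> roots F"
      then obtain C where "C \<in> blocks F" "r \<in> C" "v \<in> C" using R B'(3) by blast
      then show "v \<in> B" using partition_on_eq[OF P B'(1) _ B'(2)] by blast
    qed
  qed
  have "B = roots F \<or> (\<exists>u. \<forall>v\<in>B. (u, v) \<in> edges F)" if BB: "B \<in> blocks F" for B
  proof -
    obtain v where v: "v \<in> B" using BB partition_onD3[OF P] by (metis all_not_in_conv)
    show ?thesis
    proof (cases "v \<in> roots F")
      case True
      then show ?thesis using root BB v by blast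
    next
      case False
      moreover have "v \<in> verts F" using v BB partition_onD1[OF P] by blast
      ultimately obtain u where u: "(u, v) \<in> edges F" by (auto simp: roots_def)
      \<comment> \<open>The pairwise condition for \<open>v\<close> and \<open>w\<close> gives a
        common parent, and \<open>v\<close> has no parent other than \<open>u\<close>.\<close>
      have "(u, w) \<in> edges F" if "w \<in> B" for w
        using B[OF BB v that] False rooted_forest_parent[OF F u] by blast
      then show ?thesis by blast
    qed
  qed
  moreover have "roots F = {} \<or> roots F \<in> blocks F"
    using R root by blast
  ultimately show ?rhs using F P by blast
next
  assume rhs: ?rhs
  then have "(v \<in> roots F \<and> w \<in> roots F) \<or> (\<exists>u. (u, v) \<in> edges F \<and> (u, w) \<in> edges F)"
    if "B \<in> blocks F" "v \<in> B" "w \<in> B" for B v w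
    using that by metis
  moreover have "\<exists>B\<in>blocks F. v \<in> B \<and> w \<in> B" if "v \<in> roots F" "w \<in> roots F" for v w
    using that rhs by auto
  ultimately show "partitioned_tree F"
    using rhs by (simp add: partitioned_tree_def partitioned_forest_def)
qed

lemma partitioned_treeD:
  assumes "partitioned_tree F"
  shows "rooted_forest F" "partition_on (verts F) (blocks F)"
    "B \<in> blocks F \<Longrightarrow> B = roots F \<or> (\<exists>u. \<forall>v\<in>B. (u, v) \<in> edges F)"
    "roots F = {} \<or> roots F \<in> blocks F"
  using assms unfolding partitioned_tree_iff by blast+

lemma block_subset: "partitioned_tree F \<Longrightarrow> B \<in> blocks F \<Longrightarrow> B \<subseteq> verts F"
  using partition_onD1 partitioned_treeD(2) by blast

lemma truncate_simps [simp]: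
  "verts (forest.truncate F) = verts F" "edges (forest.truncate F) = edges F"
  "deco (forest.truncate F) = deco F"
  by (simp_all add: forest.truncate_def)

lemma truncate_roots [simp]: "roots (forest.truncate F) = roots F"
  by (simp add: roots_def)

lemma truncate_rooted_forest [simp]: "rooted_forest (forest.truncate F) = rooted_forest F"
  by (simp add: rooted_forest_def)

lemma truncate_forest_isom [simp]:
  "forest_isom f (forest.truncate F) G = forest_isom f F G"
  "forest_isom f F (forest.truncate G) = forest_isom f F G"
  by (simp_all add: forest_isom_def)

lemma truncate_forest_union [simp]:
  "forest_union (forest.truncate F) G = forest_union F G"
  "forest_union F (forest.truncate G) = forest_union F G"
  by (simp_all add: forest_union_def)

lemma truncate_forest_graft [simp]:
  "forest_graft (forest.truncate F) s G = forest_graft F s G"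
  "forest_graft F s (forest.truncate G) = forest_graft F s G"
  by (simp_all add: forest_graft_def)

lemma truncate_pforest [simp]:
  "forest.truncate (pforest_mult F G) = forest_union F G"
  "forest.truncate (pforest_graft F s G) = forest_graft F s G"
  by (simp_all add: forest.truncate_def pforest_mult_def pforest_graft_def forest_graft_def)

lemma pforest_mult_simps [simp]:
  "verts (pforest_mult F G) = inl ` verts F \<union> inr ` verts G"
  "edges (pforest_mult F G) = edges (forest_union F G)"
  "deco (pforest_mult F G) = deco (forest_union F G)"
  "roots (pforest_mult F G) = inl ` roots F \<union> inr ` roots G"
  "rooted_forest (pforest_mult F G) = rooted_forest (forest_union F G)"
  "forest_isom f (pforest_mult F G) F' = forest_isom f (forest_union F G) F'"
  "forest_isom f F' (pforest_mult F G) = forest_isom f F' (forest_union F G)"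
  "forest_union (pforest_mult F G) H = forest_union (forest_union F G) H"
  "forest_union H (pforest_mult F G) = forest_union H (forest_union F G)"
  "forest_graft (pforest_mult F G) s H = forest_graft (forest_union F G) s H"
  "forest_graft H s (pforest_mult F G) = forest_graft H s (forest_union F G)"
proof -
  show "roots (pforest_mult F G) = inl ` roots F \<union> inr ` roots G"
    by (simp flip: truncate_roots[of "pforest_mult F G"])
qed (simp_all add: pforest_mult_def forest_union_def rooted_forest_def forest_isom_def
      forest_graft_def roots_def)

lemma pforest_mult_blocks:
  "blocks (pforest_mult F G) = (`) inl ` (blocks F - {roots F}) \<union> (`) inr ` (blocks G - {roots G})
    \<union> ({roots (pforest_mult F G)} - {{}})"
  by simp (simp add: pforest_mult_def)

lemma pforest_graft_simps [simp]:
  "verts (pforest_graft F s G) = inl ` verts F \<union> inr ` verts G"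
  "edges (pforest_graft F s G) = edges (forest_graft F s G)"
  "deco (pforest_graft F s G) = deco (forest_graft F s G)"
  "blocks (pforest_graft F s G) = (`) inl ` blocks F \<union> (`) inr ` blocks G"
  "roots (pforest_graft F s G) = roots (forest_graft F s G)"
  "rooted_forest (pforest_graft F s G) = rooted_forest (forest_graft F s G)"
  "forest_isom f (pforest_graft F s G) F' = forest_isom f (forest_graft F s G) F'"
  "forest_isom f F' (pforest_graft F s G) = forest_isom f F' (forest_graft F s G)"
  "forest_graft (pforest_graft F s G) t H = forest_graft (forest_graft F s G) t H"
  "forest_graft H t (pforest_graft F s G) = forest_graft H t (forest_graft F s G)"
  by (simp_all add: pforest_graft_def forest_graft_def roots_def rooted_forest_def forest_isom_def forest_union_def)

text \<open>The vertices split into the non-roots of \<open>F\<close>, the non-roots of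
  \<open>G\<close> and the merged roots; blocks of non-roots keep their parents.\<close>

lemma partitioned_tree_mult:
  assumes F: "partitioned_tree F" and G: "partitioned_tree G"
  shows "partitioned_tree (pforest_mult F G)"
  unfolding partitioned_tree_iff
proof (intro conjI ballI)
  note F' = partitioned_treeD[OF F] and G' = partitioned_treeD[OF G]
  show "rooted_forest (pforest_mult F G)"
    using F'(1) G'(1) by (simp add: rooted_forest_union)
  let ?R = "inl ` roots F \<union> inr ` roots G"
  have "partition_on ?R ({?R} - {{}})"
    by (cases "?R = {}") (auto simp: partition_on_empty intro: partition_on_space)
  moreover have "partition_on (inl ` (verts F - roots F)) ((`) inl ` (blocks F - {roots F}))"
    using F' by (intro partition_on_image partition_on_remove) (auto simp: inj_on_def)
  moreover have "partition_on (inr ` (verts G - roots G)) ((`) inr ` (blocks G - {roots G}))"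
    using G' by (intro partition_on_image partition_on_remove) (auto simp: inj_on_def)
  ultimately have "partition_on (inl ` (verts F - roots F) \<union> inr ` (verts G - roots G) \<union> ?R) (blocks (pforest_mult F G))"
    unfolding pforest_mult_def pforest.simps
    by (intro partition_on_Un) auto
  moreover have "inl ` (verts F - roots F) \<union> inr ` (verts G - roots G) \<union> ?R = verts (pforest_mult F G)"
    by (auto simp: roots_def)
  ultimately show "partition_on (verts (pforest_mult F G)) (blocks (pforest_mult F G))" by simp
next
  fix B assume "B \<in> blocks (pforest_mult F G)"
  then consider (F) C where "C \<in> blocks F" "C \<noteq> roots F" "B = inl ` C"
    | (G) C where "C \<in> blocks G" "C \<noteq> roots G" "B = inr ` C"
    | "B = roots (pforest_mult F G)"
    unfolding pforest_mult_blocks by blast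
  then show "B = roots (pforest_mult F G) \<or> (\<exists>u. \<forall>v\<in>B. (u, v) \<in> edges (pforest_mult F G))"
  proof cases
    case F
    then obtain u where "\<forall>v\<in>C. (u, v) \<in> edges F" using partitioned_treeD(3)[OF assms(1)] by blast
    then have "\<forall>v\<in>B. (inl u, v) \<in> edges (pforest_mult F G)" using F by auto
    then show ?thesis by blast
  next
    case G
    then obtain u where "\<forall>v\<in>C. (u, v) \<in> edges G" using partitioned_treeD(3)[OF assms(2)] by blast
    then have "\<forall>v\<in>B. (inr u, v) \<in> edges (pforest_mult F G)" using G by auto
    then show ?thesis by blast
  qed simp
next
  show "roots (pforest_mult F G) = {} \<or> roots (pforest_mult F G) \<in> blocks (pforest_mult F G)"
    unfolding pforest_mult_blocks by blast
qed

text \<open>All blocks survive: the root block of \<open>G\<close> acquires the common parent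
  \<open>inl s\<close>, and every other block keeps its role.\<close>

lemma partitioned_tree_graft:
  assumes F: "partitioned_tree F" and G: "partitioned_tree G" and s: "s \<in> verts F"
  shows "partitioned_tree (pforest_graft F s G)"
  unfolding partitioned_tree_iff
proof (intro conjI ballI)
  note F' = partitioned_treeD[OF F] and G' = partitioned_treeD[OF G]
  show "rooted_forest (pforest_graft F s G)"
    using F'(1) G'(1) s by (simp add: rooted_forest_graft)
  show "partition_on (verts (pforest_graft F s G)) (blocks (pforest_graft F s G))"
    unfolding pforest_graft_simps
    using F'(2) G'(2) by (intro partition_on_Un partition_on_image) (auto simp: inj_on_def)
  have r: "roots (pforest_graft F s G) = inl ` roots F"
    using G'(1) by simp
  show "roots (pforest_graft F s G) = {} \<or> roots (pforest_graft F s G) \<in> blocks (pforest_graft F s G)"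
    unfolding r using F'(4) by auto
  fix B assume "B \<in> blocks (pforest_graft F s G)"
  then consider (F) C where "C \<in> blocks F" "B = inl ` C" | (G) C where "C \<in> blocks G" "B = inr ` C"
    by auto
  then show "B = roots (pforest_graft F s G) \<or> (\<exists>u. \<forall>v\<in>B. (u, v) \<in> edges (pforest_graft F s G))"
  proof cases
    case F
    show ?thesis
    proof (cases "C = roots F")
      case True
      then show ?thesis using F r by simp
    next
      case False
      then obtain u where "\<forall>v\<in>C. (u, v) \<in> edges F" using F F'(3) by blast
      then have "\<forall>v\<in>B. (inl u, v) \<in> edges (pforest_graft F s G)" using F by auto
      then show ?thesis by blast
    qed
  next
    case G
    show ?thesis
    proof (cases "C = roots G")
      case True
      then have "\<forall>v\<in>B. (inl s, v) \<in> edges (pforest_graft F s G)" using G by auto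
      then show ?thesis by blast
    next
      case False
      then obtain u where "\<forall>v\<in>C. (u, v) \<in> edges G" using G G'(3) by blast
      then have "\<forall>v\<in>B. (inr u, v) \<in> edges (pforest_graft F s G)" using G by auto
      then show ?thesis by blast
    qed
  qed
qed

lemma pforest_mult_cong:
  assumes f: "pforest_isom f F F'" and g: "pforest_isom g G G'"
    and "partitioned_tree F" "partitioned_tree F'" "partitioned_tree G" "partitioned_tree G'"
  shows "pforest_isom (case_nat_sum (inl \<circ> f) (inr \<circ> g)) (pforest_mult F G) (pforest_mult F' G')"
proof -
  let ?h = "case_nat_sum (inl \<circ> f) (inr \<circ> g)"
  have isos: "forest_isom f F F'" "forest_isom g G G'" using f g by (auto simp: pforest_isom_def)
  have *: "blocks F' - {roots F'} = (`) f ` (blocks F - {roots F})" "roots F' = f ` roots F"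
    if "pforest_isom f F F'" "partitioned_tree F" "partitioned_tree F'" for f and F F' :: "'a pforest"
  proof -
    have iso: "forest_isom f F F'" and bl: "blocks F' = (`) f ` blocks F"
      using that(1) by (simp_all add: pforest_isom_def)
    show r: "roots F' = f ` roots F" by (rule forest_isom_roots) (use iso that partitioned_treeD in auto)
    \<comment> \<open>Injectivity of the image map on sets of vertices lets the removal of the root
      block commute with taking images.\<close>
    have "inj_on f (verts F)" using iso by (simp add: forest_isom_def bij_betw_def)
    then have "inj_on ((`) f) (Pow (verts F))" by (rule inj_on_image_Pow)
    moreover have "insert (roots F) (blocks F) \<subseteq> Pow (verts F)"
      using block_subset[OF that(2)] by (auto simp: roots_def)
    ultimately have "inj_on ((`) f) (insert (roots F) (blocks F))" by (rule inj_on_subset)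
    then show "blocks F' - {roots F'} = (`) f ` (blocks F - {roots F})"
      unfolding bl r by (auto simp: inj_on_def)
  qed
  note F' = *[OF f assms(3,4)] and G' = *[OF g assms(5,6)]
  have "blocks (pforest_mult F' G') = (`) ?h ` blocks (pforest_mult F G)"
  proof -
    have single: "(`) ?h ` ({c} - {{}}) = {?h ` c} - {{}}" for c by (cases "c = {}") auto
    show ?thesis
      unfolding pforest_mult_def pforest.simps F'(1) G'(1)
      unfolding F'(2) G'(2) image_Un single
      by (simp add: image_image image_Un o_def)
  qed
  then show ?thesis
    using forest_union_cong[OF isos] by (simp add: pforest_isom_def)
qed

lemma pforest_graft_cong:
  assumes f: "pforest_isom f F F'" and g: "pforest_isom g G G'"
    and "partitioned_tree G" "partitioned_tree G'" and s: "s \<in> verts F"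
  shows "pforest_isom (case_nat_sum (inl \<circ> f) (inr \<circ> g)) (pforest_graft F s G) (pforest_graft F' (f s) G')"
proof -
  have isos: "forest_isom f F F'" "forest_isom g G G'" using f g by (auto simp: pforest_isom_def)
  show ?thesis
    using forest_graft_cong[OF isos assms(3,4)[THEN partitioned_treeD(1)] s] f g
    by (simp add: pforest_isom_def image_Un image_image)
qed

lemma pforest_graft_empty:
  assumes "partitioned_tree E" "verts E = {}"
  shows "pforest_isom inl F (pforest_graft F s E)"
proof -
  have "roots E = {}" "blocks E = {}"
    using assms partitioned_treeD(2)[OF assms(1)] by (auto simp: roots_def partition_on_empty)
  moreover have "forest_isom inl F (forest_graft F s E)"
    by (rule forest_isomI) (use assms in \<open>auto simp: bij_betw_def inj_on_def\<close>)
  ultimately show ?thesis by (simp add: pforest_isom_def)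
qed

lemma pforest_graft_graft_inr:
  assumes "partitioned_tree G" "partitioned_tree H"
  shows "pforest_isom (case_nat_sum (case_nat_sum inl (inr \<circ> inl)) (inr \<circ> inr))
    (pforest_graft (pforest_graft F s G) (inr t) H) (pforest_graft F s (pforest_graft G t H))"
  using forest_graft_graft_inr[OF assms[THEN partitioned_treeD(1)]]
  by (simp add: pforest_isom_def image_Un image_image Un_assoc)

text \<open>The two sides of a generator have the same underlying forest. The isomorphism does not
  extend to blocks in general: grafting twice keeps the root blocks of \<open>G\<close> and
  \<open>H\<close> apart, whereas the product merges them.\<close>

lemma forest_graft_graft_same:
  assumes "rooted_forest G"
  shows "forest_isom (case_nat_sum (case_nat_sum inl (inr \<circ> inl)) (inr \<circ> inr))
    (forest_graft (forest_graft F s G) (inl s) H) (forest_graft F s (forest_union G H))"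
  (is "forest_isom ?h _ _")
proof (rule forest_isomI)
  show "bij_betw ?h (verts (forest_graft (forest_graft F s G) (inl s) H)) (verts (forest_graft F s (forest_union G H)))"
    unfolding forest_graft_simps forest_union_simps
    by (intro bij_betw_case_nat_sum) (auto simp: inj_on_def image_Un image_image)
qed (use assms in auto)

section \<open>Children and the coarsest partition\<close>

definition children :: "('d, 'z) forest_scheme \<Rightarrow> nat \<Rightarrow> nat set" where
  "children F u = {v. (u, v) \<in> edges F}"

text \<open>The normal form of a partitioned tree modulo the ideal: siblings, and likewise the roots, form one
  block.\<close>

definition coarse_pforest :: "('d, 'z) forest_scheme \<Rightarrow> 'd pforest" where
  "coarse_pforest F = \<lparr>verts = verts F, edges = edges F, deco = deco F,
    blocks = insert (roots F) (children F ` verts F) - {{}}\<rparr>"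

lemma coarse_pforest_simps [simp]:
  "verts (coarse_pforest F) = verts F" "edges (coarse_pforest F) = edges F"
  "deco (coarse_pforest F) = deco F"
  "blocks (coarse_pforest F) = insert (roots F) (children F ` verts F) - {{}}"
  "roots (coarse_pforest F) = roots F"
  "rooted_forest (coarse_pforest F) = rooted_forest F"
  "forest_isom f (coarse_pforest F) G = forest_isom f F G"
  "forest_isom f H (coarse_pforest F) = forest_isom f H F"
  "forest_union (coarse_pforest F) G = forest_union F G"
  "forest_union H (coarse_pforest F) = forest_union H F"
  "forest_graft (coarse_pforest F) s G = forest_graft F s G"
  "forest_graft H s (coarse_pforest F) = forest_graft H s F"
  "forest.truncate (coarse_pforest F) = forest.truncate F"
  by (simp_all add: coarse_pforest_def roots_def rooted_forest_def forest_isom_def forest_union_def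
      forest_graft_def forest.truncate_def)

lemma coarse_truncate [simp]: "coarse_pforest (forest.truncate F) = coarse_pforest F"
  by (simp add: coarse_pforest_def children_def)

lemma partitioned_tree_coarse:
  assumes F: "rooted_forest F"
  shows "partitioned_tree (coarse_pforest F)"
  unfolding partitioned_tree_iff
proof (intro conjI ballI)
  show "partition_on (verts (coarse_pforest F)) (blocks (coarse_pforest F))"
    unfolding coarse_pforest_simps
  proof (rule partition_onI)
    have "verts F \<subseteq> roots F \<union> (\<Union>u\<in>verts F. children F u)"
      using rooted_forest_edge(1)[OF F] unfolding roots_def children_def by blast
    moreover have "roots F \<subseteq> verts F" "children F u \<subseteq> verts F" for u
      using rooted_forest_edge(2)[OF F] unfolding roots_def children_def by blast+
    moreover have "\<Union> (insert (roots F) (children F ` verts F) - {{}}) =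
        roots F \<union> (\<Union>u\<in>verts F. children F u)"
      by auto
    ultimately show "\<Union> (insert (roots F) (children F ` verts F) - {{}}) = verts F"
      by (simp only:) (simp add: subset_antisym UN_least)
    \<comment> \<open>A block is recovered from any one of its elements, as the set of roots or as
      the children of the parent of that element. Two blocks with a common element are therefore
      equal.\<close>
    have eq: "p = (if x \<in> roots F then roots F else children F (THE u. (u, x) \<in> edges F))"
      if "p \<in> insert (roots F) (children F ` verts F) - {{}}" "x \<in> p" for p x
    proof (cases "p = roots F")
      case False
      with that obtain u where u: "p = children F u" by blast
      with that have "(u, x) \<in> edges F" by (simp add: children_def)
      moreover from this have "(THE u. (u, x) \<in> edges F) = u"
        by (intro the_equality rooted_forest_parent[OF F])
      ultimately show ?thesis using u by (auto simp: roots_def)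
    qed (use that in simp)
    fix p q assume "p \<in> insert (roots F) (children F ` verts F) - {{}}"
      "q \<in> insert (roots F) (children F ` verts F) - {{}}" "p \<noteq> q"
    then show "disjnt p q" using eq unfolding disjnt_iff by metis
  qed auto
qed (use F in \<open>auto simp: children_def\<close>)

text \<open>The coarsest partition is determined by the edges, so every isomorphism of forests
  respects it. This makes coarsening well defined on isomorphism classes of forests.\<close>

lemma coarse_pforest_cong:
  assumes f: "forest_isom f F G" and F: "rooted_forest F" and G: "rooted_forest G"
  shows "pforest_isom f (coarse_pforest F) (coarse_pforest G)"
proof -
  have im: "verts G = f ` verts F" using f by (simp add: forest_isom_def bij_betw_def)
  have ch: "children G (f u) = f ` children F u" if "u \<in> verts F" for u
  proof
    show "children G (f u) \<subseteq> f ` children F u"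
    proof
      fix w assume "w \<in> children G (f u)"
      then have w: "(f u, w) \<in> edges G" by (simp add: children_def)
      then obtain v where "w = f v" "v \<in> verts F" using rooted_forest_edge(2)[OF G] im by blast
      then show "w \<in> f ` children F u" using w f that by (auto simp: children_def forest_isom_def)
    qed
    show "f ` children F u \<subseteq> children G (f u)"
      using f that by (auto simp: children_def forest_isom_def dest: rooted_forest_edge(2)[OF F])
  qed
  have "blocks (coarse_pforest G) = (`) f ` blocks (coarse_pforest F)"
    unfolding coarse_pforest_simps im forest_isom_roots[OF f F G]
    by (auto simp: ch image_image)
  then show ?thesis using f by (simp add: pforest_isom_def)
qed

lemma children_forest_union:
  "children (forest_union F G) (inl u) = inl ` children F u"
  "children (forest_union F G) (inr u) = inr ` children G u"
proof -
  show "children (forest_union F G) (inl u) = inl ` children F u"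
  proof (rule Set.set_eqI)
    fix v show "v \<in> children (forest_union F G) (inl u) \<longleftrightarrow> v \<in> inl ` children F u"
      by (cases v rule: nat_sum_cases) (auto simp: children_def)
  qed
  show "children (forest_union F G) (inr u) = inr ` children G u"
  proof (rule Set.set_eqI)
    fix v show "v \<in> children (forest_union F G) (inr u) \<longleftrightarrow> v \<in> inr ` children G u"
      by (cases v rule: nat_sum_cases) (auto simp: children_def)
  qed
qed

lemma children_forest_graft:
  "children (forest_graft F s G) (inl u) = inl ` children F u \<union> (if u = s then inr ` roots G else {})"
  "children (forest_graft F s G) (inr u) = inr ` children G u"
proof -
  show "children (forest_graft F s G) (inl u) = inl ` children F u \<union> (if u = s then inr ` roots G else {})"
  proof (rule Set.set_eqI)
    fix v show "v \<in> children (forest_graft F s G) (inl u) \<longleftrightarrow>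
        v \<in> inl ` children F u \<union> (if u = s then inr ` roots G else {})"
      by (cases v rule: nat_sum_cases) (auto simp: children_def)
  qed
  show "children (forest_graft F s G) (inr u) = inr ` children G u"
  proof (rule Set.set_eqI)
    fix v show "v \<in> children (forest_graft F s G) (inr u) \<longleftrightarrow> v \<in> inr ` children G u"
      by (cases v rule: nat_sum_cases) (auto simp: children_def)
  qed
qed

text \<open>Children have an incoming edge and roots have none, so a nonempty set of children is
  never the root block that the product removes.\<close>

lemma coarse_blocks_nonroot:
  "blocks (coarse_pforest F) - {roots F} = children F ` verts F - {{}}"
proof -
  have "children F u \<noteq> roots F" if "children F u \<noteq> {}" for u
    using that by (auto simp: roots_def children_def)
  then show ?thesis by fastforce
qed

text \<open>The product merges precisely the two root blocks, and sets of children are unchanged, so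
  coarseness is preserved. Both sides are built on the same union, which gives an equality and not
  merely an isomorphism.\<close>

lemma pforest_mult_coarse:
  assumes F: "rooted_forest F" and G: "rooted_forest G"
  shows "pforest_mult (coarse_pforest F) (coarse_pforest G) = coarse_pforest (forest_union F G)"
proof -
  have "blocks (pforest_mult (coarse_pforest F) (coarse_pforest G)) = blocks (coarse_pforest (forest_union F G))"
    unfolding pforest_mult_def pforest.simps coarse_pforest_simps(5) coarse_blocks_nonroot
    by (auto simp: image_Un image_image children_forest_union)
  then show ?thesis
    by (intro pforest.equality) (simp_all del: coarse_pforest_simps(4))
qed

lemma single_pforest_simps [simp]:
  "verts (single_pforest d) = {0}" "edges (single_pforest d) = {}"
  "deco (single_pforest d) v = d" "blocks (single_pforest d) = {{0}}"
  "roots (single_pforest d) = {0}"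
  by (simp_all add: single_pforest_def roots_def)

lemma children_single_pforest [simp]: "children (single_pforest d) u = {}"
  by (simp add: children_def)

text \<open>A single vertex has no children of its own, so the roots of \<open>G\<close> are all the
  children it gets. Grafting onto a vertex with children would produce separate blocks of
  siblings.\<close>

lemma pforest_graft_coarse:
  assumes G: "rooted_forest G"
  shows "pforest_graft (single_pforest d) 0 (coarse_pforest G) = coarse_pforest (forest_graft (single_pforest d) 0 G)"
proof -
  have "blocks (pforest_graft (single_pforest d) 0 (coarse_pforest G)) =
      blocks (coarse_pforest (forest_graft (single_pforest d) 0 G))"
    using G by (auto simp: image_Un image_image children_forest_graft)
  then show ?thesis
    by (intro pforest.equality) (simp_all del: coarse_pforest_simps(4) pforest_graft_simps(4))
qed

section \<open>Isomorphism classes\<close>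

lemma rforest_eq_iff:
  assumes "rooted_forest F" "rooted_forest G"
  shows "abs_rforest F = abs_rforest G \<longleftrightarrow> (\<exists>f. forest_isom f F G)"
proof -
  have "rforest_equiv F F" "rforest_equiv G G"
    using assms forest_isom_id unfolding rforest_equiv_def by blast+
  then have "abs_rforest F = abs_rforest G \<longleftrightarrow> rforest_equiv F G"
    using Quotient3_rel[OF Quotient3_rforest, of F G] by blast
  then show ?thesis using assms by (simp add: rforest_equiv_def)
qed

lemma rforest_eqI:
  "forest_isom f F G \<Longrightarrow> rooted_forest F \<Longrightarrow> rooted_forest G \<Longrightarrow> abs_rforest F = abs_rforest G"
  using rforest_eq_iff by blast

lemma rooted_forest_rep: "rooted_forest (rep_rforest X)"
  using Quotient3_rep_reflp[OF Quotient3_rforest, of X] by (simp add: rforest_equiv_def)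

lemma abs_rep_rforest: "abs_rforest (rep_rforest X) = X"
  by (rule Quotient3_abs_rep[OF Quotient3_rforest])

lemma rforest_rep_isom:
  assumes "rooted_forest F"
  obtains f where "forest_isom f F (rep_rforest (abs_rforest F))"
  using rforest_eq_iff[OF assms rooted_forest_rep] abs_rep_rforest by metis

lemma rforest_cases:
  obtains F where "rooted_forest F" "X = abs_rforest F"
  using rooted_forest_rep abs_rep_rforest by metis

lemma pforest_isom_id: "pforest_isom id F F"
  by (simp add: pforest_isom_def forest_isom_id)

lemma ptree_eq_iff:
  assumes "partitioned_tree F" "partitioned_tree G"
  shows "abs_ptree F = abs_ptree G \<longleftrightarrow> (\<exists>f. pforest_isom f F G)"
proof -
  have "ptree_equiv F F" "ptree_equiv G G"
    using assms pforest_isom_id unfolding ptree_equiv_def by blast+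
  then have "abs_ptree F = abs_ptree G \<longleftrightarrow> ptree_equiv F G"
    using Quotient3_rel[OF Quotient3_ptree, of F G] by blast
  then show ?thesis using assms by (simp add: ptree_equiv_def)
qed

lemma ptree_eqI:
  "pforest_isom f F G \<Longrightarrow> partitioned_tree F \<Longrightarrow> partitioned_tree G \<Longrightarrow> abs_ptree F = abs_ptree G"
  using ptree_eq_iff by blast

lemma partitioned_tree_rep: "partitioned_tree (rep_ptree X)"
  using Quotient3_rep_reflp[OF Quotient3_ptree, of X] by (simp add: ptree_equiv_def)

lemma abs_rep_ptree: "abs_ptree (rep_ptree X) = X"
  by (rule Quotient3_abs_rep[OF Quotient3_ptree])

lemma ptree_rep_isom:
  assumes "partitioned_tree F"
  obtains f where "pforest_isom f F (rep_ptree (abs_ptree F))"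
  using ptree_eq_iff[OF assms partitioned_tree_rep] abs_rep_ptree by metis

text \<open>Operations on classes are defined through chosen representatives. This lemma and its
  analogues compute them with arbitrary ones.\<close>

lemma ptree_mult_abs:
  assumes F: "partitioned_tree F" and G: "partitioned_tree G"
  shows "ptree_mult (abs_ptree F) (abs_ptree G) = abs_ptree (pforest_mult F G)"
proof -
  obtain f where f: "pforest_isom f F (rep_ptree (abs_ptree F))" using ptree_rep_isom[OF F] .
  obtain g where g: "pforest_isom g G (rep_ptree (abs_ptree G))" using ptree_rep_isom[OF G] .
  show ?thesis
    unfolding ptree_mult_def
    by (rule ptree_eqI[symmetric, OF pforest_mult_cong[OF f g]])
       (simp_all add: partitioned_tree_mult partitioned_tree_rep F G)
qed

lemma rforest_mult_abs:
  assumes F: "rooted_forest F" and G: "rooted_forest G"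
  shows "rforest_mult (abs_rforest F) (abs_rforest G) = abs_rforest (forest_union F G)"
proof -
  obtain f where f: "forest_isom f F (rep_rforest (abs_rforest F))" using rforest_rep_isom[OF F] .
  obtain g where g: "forest_isom g G (rep_rforest (abs_rforest G))" using rforest_rep_isom[OF G] .
  show ?thesis
    unfolding rforest_mult_def
    by (rule rforest_eqI[symmetric, OF forest_union_cong[OF f g]])
       (simp_all add: rooted_forest_union rooted_forest_rep F G)
qed

text \<open>The empty forest needs no separate clause: grafting it at each vertex of
  \<open>F\<close> gives as many copies of \<open>F\<close> as there are vertices, in agreement with
  \<open>T \<bullet> \<emptyset> = |T| T\<close>.\<close>

definition rforest_prelie :: "'d rforest \<Rightarrow> 'd rforest \<Rightarrow> ('d rforest \<Rightarrow>\<^sub>0 'k::comm_ring_1)" where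
  "rforest_prelie F G = (\<Sum>s\<in>verts (rep_rforest F).
     Poly_Mapping.single (abs_rforest (forest_graft (rep_rforest F) s (rep_rforest G))) 1)"

text \<open>Changing the representative moves the vertex \<open>s\<close> to \<open>f s\<close>, so
  the sum over the vertices is reindexed along the bijection \<open>f\<close>.\<close>

lemma rforest_prelie_abs:
  assumes F: "rooted_forest F" and G: "rooted_forest G"
  shows "rforest_prelie (abs_rforest F) (abs_rforest G) =
    (\<Sum>s\<in>verts F. Poly_Mapping.single (abs_rforest (forest_graft F s G)) 1)"
proof -
  obtain f where f: "forest_isom f F (rep_rforest (abs_rforest F))" using rforest_rep_isom[OF F] .
  obtain g where g: "forest_isom g G (rep_rforest (abs_rforest G))" using rforest_rep_isom[OF G] .
  let ?F = "rep_rforest (abs_rforest F)" and ?G = "rep_rforest (abs_rforest G)"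
  have bij: "bij_betw f (verts F) (verts ?F)" using f by (simp add: forest_isom_def)
  have "abs_rforest (forest_graft ?F (f s) ?G) = abs_rforest (forest_graft F s G)"
    if s: "s \<in> verts F" for s
    using bij_betwE[OF bij] s
    by (intro rforest_eqI[symmetric, OF forest_graft_cong[OF f g G rooted_forest_rep s]])
       (simp_all add: rooted_forest_graft rooted_forest_rep F G)
  then show ?thesis
    unfolding rforest_prelie_def sum.reindex_bij_betw[OF bij, symmetric] by simp
qed

text \<open>No case distinction for the empty tree is left: grafting it at any vertex of \<open>F\<close> gives \<open>F\<close> back.\<close>

lemma ptree_prelie_abs:
  assumes F: "partitioned_tree F" and G: "partitioned_tree G"
  shows "ptree_prelie (abs_ptree F) (abs_ptree G) =
    (\<Sum>s\<in>verts F. Poly_Mapping.single (abs_ptree (pforest_graft F s G)) 1)"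
proof -
  obtain f where f: "pforest_isom f F (rep_ptree (abs_ptree F))" using ptree_rep_isom[OF F] .
  obtain g where g: "pforest_isom g G (rep_ptree (abs_ptree G))" using ptree_rep_isom[OF G] .
  let ?F = "rep_ptree (abs_ptree F)" and ?G = "rep_ptree (abs_ptree G)"
  have bij: "bij_betw f (verts F) (verts ?F)" using f by (simp add: forest_isom_def pforest_isom_def)
  show ?thesis
  proof (cases "abs_ptree G = ptree_empty")
    case True
    then obtain h where "pforest_isom h G empty_pforest"
      using ptree_eq_iff[OF G partitioned_tree_empty] by (auto simp: ptree_empty_def)
    then have "verts G = {}"
      by (auto simp: pforest_isom_def forest_isom_def bij_betw_def empty_pforest_def)
    then have "abs_ptree (pforest_graft F s G) = abs_ptree F" if "s \<in> verts F" for s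
      using that
      by (intro ptree_eqI[symmetric, OF pforest_graft_empty[OF G]] partitioned_tree_graft F G)
    then show ?thesis
      using True bij_betw_same_card[OF bij]
      by (simp add: ptree_prelie_def) (rule poly_mapping_eqI, simp add: lookup_sum lookup_single when_def)
  next
    case False
    have "abs_ptree (pforest_graft ?F (f s) ?G) = abs_ptree (pforest_graft F s G)"
      if s: "s \<in> verts F" for s
      using bij_betwE[OF bij] s
      by (intro ptree_eqI[symmetric, OF pforest_graft_cong[OF f g G partitioned_tree_rep s]])
         (simp_all add: partitioned_tree_graft partitioned_tree_rep F G)
    then show ?thesis
      using False unfolding ptree_prelie_def sum.reindex_bij_betw[OF bij, symmetric] by simp
  qed
qed

lemma forget_blocks_abs:
  assumes F: "partitioned_tree F"
  shows "forget_blocks (abs_ptree F) = abs_rforest (forest.truncate F)"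
proof -
  obtain f where f: "pforest_isom f F (rep_ptree (abs_ptree F))" using ptree_rep_isom[OF F] .
  then have "forest_isom f (forest.truncate F) (forest.truncate (rep_ptree (abs_ptree F)))"
    by (simp add: pforest_isom_def)
  then show ?thesis
    unfolding forget_blocks_def
    by (rule rforest_eqI[symmetric]) (simp_all add: partitioned_treeD(1) F partitioned_tree_rep)
qed

definition forest_on :: "'d set \<Rightarrow> 'd forest \<Rightarrow> bool" where
  "forest_on D F \<longleftrightarrow> rooted_forest F \<and> deco F ` verts F \<subseteq> D"

definition ptree_on :: "'d set \<Rightarrow> 'd pforest \<Rightarrow> bool" where
  "ptree_on D F \<longleftrightarrow> partitioned_tree F \<and> deco F ` verts F \<subseteq> D"

lemma RF_cases:
  assumes "X \<in> RF D"
  obtains F where "forest_on D F" "X = abs_rforest F"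
  using assms unfolding RF_def forest_on_def by blast

lemma PT_cases:
  assumes "X \<in> PT D"
  obtains F where "ptree_on D F" "X = abs_ptree F"
  using assms unfolding PT_def ptree_on_def by blast

lemma abs_in_RF: "forest_on D F \<Longrightarrow> abs_rforest F \<in> RF D"
  unfolding RF_def forest_on_def by blast

lemma abs_in_PT: "ptree_on D F \<Longrightarrow> abs_ptree F \<in> PT D"
  unfolding PT_def ptree_on_def by blast

lemma ptree_onD: "ptree_on D F \<Longrightarrow> partitioned_tree F" "ptree_on D F \<Longrightarrow> rooted_forest F"
  by (auto simp: ptree_on_def dest: partitioned_treeD(1))

lemma forest_on_union: "forest_on D F \<Longrightarrow> forest_on D G \<Longrightarrow> forest_on D (forest_union F G)"
  by (auto simp: forest_on_def rooted_forest_union)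

lemma forest_on_graft:
  "forest_on D F \<Longrightarrow> forest_on D G \<Longrightarrow> s \<in> verts F \<Longrightarrow> forest_on D (forest_graft F s G)"
  by (auto simp: forest_on_def rooted_forest_graft)

lemma ptree_on_mult: "ptree_on D F \<Longrightarrow> ptree_on D G \<Longrightarrow> ptree_on D (pforest_mult F G)"
  by (auto simp: ptree_on_def partitioned_tree_mult)

lemma ptree_on_graft:
  "ptree_on D F \<Longrightarrow> ptree_on D G \<Longrightarrow> s \<in> verts F \<Longrightarrow> ptree_on D (pforest_graft F s G)"
  by (auto simp: ptree_on_def partitioned_tree_graft)

lemma ptree_on_single: "d \<in> D \<Longrightarrow> ptree_on D (single_pforest d)"
  by (simp add: ptree_on_def partitioned_tree_single)

lemma ptree_on_coarse: "rooted_forest F \<Longrightarrow> deco F ` verts F \<subseteq> D \<Longrightarrow> ptree_on D (coarse_pforest F)"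
  by (simp add: ptree_on_def partitioned_tree_coarse del: coarse_pforest_simps(4))

lemma forest_on_truncate: "ptree_on D F \<Longrightarrow> forest_on D (forest.truncate F)"
  by (simp add: ptree_on_def forest_on_def partitioned_treeD(1))

text \<open>A section of \<open>forget_blocks\<close>. It provides the canonical partitioned tree
  over each forest.\<close>

definition coarse_ptree :: "'d rforest \<Rightarrow> 'd ptree" where
  "coarse_ptree X = abs_ptree (coarse_pforest (rep_rforest X))"

lemma coarse_ptree_abs:
  assumes F: "rooted_forest F"
  shows "coarse_ptree (abs_rforest F) = abs_ptree (coarse_pforest F)"
proof -
  obtain f where f: "forest_isom f F (rep_rforest (abs_rforest F))" using rforest_rep_isom[OF F] .
  show ?thesis
    unfolding coarse_ptree_def
    by (rule ptree_eqI[symmetric, OF coarse_pforest_cong[OF f F rooted_forest_rep]])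
       (rule partitioned_tree_coarse, simp add: F rooted_forest_rep)+
qed

lemma forget_coarse: "forget_blocks (coarse_ptree X) = X"
proof (cases X rule: rforest_cases)
  case (1 F)
  have "forget_blocks (coarse_ptree X) = abs_rforest (forest.truncate F)"
    using 1 by (simp add: coarse_ptree_abs forget_blocks_abs partitioned_tree_coarse del: coarse_pforest_simps(4))
  also have "forest.truncate F = F" by (simp add: forest.truncate_def)
  finally show ?thesis using 1 by simp
qed

lemma coarse_in_PT: "X \<in> RF D \<Longrightarrow> coarse_ptree X \<in> PT D"
  by (elim RF_cases) (simp add: coarse_ptree_abs abs_in_PT ptree_on_coarse forest_on_def)

lemma forget_in_RF: "T \<in> PT D \<Longrightarrow> forget_blocks T \<in> RF D"
  by (elim PT_cases) (simp add: forget_blocks_abs ptree_onD abs_in_RF forest_on_truncate)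

lemma forget_mult: "forget_blocks (ptree_mult S T) = rforest_mult (forget_blocks S) (forget_blocks T)"
proof -
  obtain F G where "partitioned_tree F" "S = abs_ptree F" "partitioned_tree G" "T = abs_ptree G"
    using partitioned_tree_rep abs_rep_ptree by metis
  then show ?thesis
    by (simp add: ptree_mult_abs forget_blocks_abs partitioned_tree_mult rforest_mult_abs partitioned_treeD(1))
qed

text \<open>Once the case of the empty tree is absorbed, both sums run over the vertices of the same
  representative and agree term by term.\<close>

lemma forget_prelie:
  "linear_ext (\<lambda>T. Poly_Mapping.single (forget_blocks T) 1) (ptree_prelie S T) =
    rforest_prelie (forget_blocks S) (forget_blocks T)"
proof -
  obtain F G where "partitioned_tree F" "S = abs_ptree F" "partitioned_tree G" "T = abs_ptree G"
    using partitioned_tree_rep abs_rep_ptree by metis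
  then show ?thesis
    by (simp add: ptree_prelie_abs forget_blocks_abs partitioned_tree_graft rforest_prelie_abs
        partitioned_treeD(1) linear_ext_sum)
qed

lemma forget_empty: "forget_blocks ptree_empty = rforest_empty"
proof -
  have "forest.truncate empty_pforest = (empty_forest :: 'a forest)"
    by (simp add: empty_pforest_def empty_forest_def forest.truncate_def)
  then show ?thesis
    by (simp add: ptree_empty_def forget_blocks_abs partitioned_tree_empty rforest_empty_def)
qed

section \<open>Com-PreLie identities for isomorphism classes of forests\<close>

lemma rforest_mult_commute: "rforest_mult X Y = rforest_mult Y X"
proof -
  obtain F G where "rooted_forest F" "X = abs_rforest F" "rooted_forest G" "Y = abs_rforest G"
    using rforest_cases by metis
  then show ?thesis
    by (simp add: rforest_mult_abs)
       (intro rforest_eqI[OF forest_union_commute] rooted_forest_union)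
qed

lemma rforest_mult_assoc: "rforest_mult (rforest_mult X Y) Z = rforest_mult X (rforest_mult Y Z)"
proof -
  obtain F G H where "rooted_forest F" "X = abs_rforest F" "rooted_forest G" "Y = abs_rforest G"
    "rooted_forest H" "Z = abs_rforest H"
    using rforest_cases by metis
  then show ?thesis
    by (simp add: rforest_mult_abs rforest_eqI[OF forest_union_assoc] rooted_forest_union)
qed

lemma rforest_mult_empty: "rforest_mult rforest_empty X = X"
proof (cases X rule: rforest_cases)
  case (1 F)
  then show ?thesis
    by (simp add: rforest_mult_abs rforest_empty_def rooted_forest_empty)
       (intro rforest_eqI[symmetric, OF forest_union_empty] rooted_forest_union rooted_forest_empty,
        simp_all add: empty_forest_def)
qed

lemma rforest_prelie_leibniz:
  "bilinear_ext rforest_prelie (Poly_Mapping.single (rforest_mult X Y) 1) (Poly_Mapping.single Z 1) =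
    bilinear_ext (\<lambda>F G. Poly_Mapping.single (rforest_mult F G) 1) (rforest_prelie X Z) (Poly_Mapping.single Y 1)
    + bilinear_ext (\<lambda>F G. Poly_Mapping.single (rforest_mult F G) 1)
        (Poly_Mapping.single X 1) (rforest_prelie Y Z)"
proof -
  obtain F G H where F: "rooted_forest F" "X = abs_rforest F" and G: "rooted_forest G" "Y = abs_rforest G"
    and H: "rooted_forest H" "Z = abs_rforest H"
    using rforest_cases by metis
  have l: "abs_rforest (forest_graft (forest_union F G) (inl s) H) = rforest_mult (abs_rforest (forest_graft F s H)) Y"
    if "s \<in> verts F" for s
    using that F G H
    by (simp add: rforest_mult_abs rooted_forest_graft rooted_forest_union
        rforest_eqI[OF forest_graft_union])
  have r: "abs_rforest (forest_graft (forest_union F G) (inr s) H) = rforest_mult X (abs_rforest (forest_graft G s H))"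
    if s: "s \<in> verts G" for s
  proof -
    \<comment> \<open>A graft in the right factor is reduced to one in the left factor by exchanging
      the factors; commutativity of the product exchanges them back.\<close>
    have "abs_rforest (forest_graft (forest_union F G) (inr s) H) =
        abs_rforest (forest_graft (forest_union G F) (inl s) H)"
    proof (rule rforest_eqI)
      show "forest_isom (case_nat_sum (inl \<circ> case_nat_sum inr inl) (inr \<circ> id))
          (forest_graft (forest_union F G) (inr s) H) (forest_graft (forest_union G F) (inl s) H)"
        using forest_graft_cong[OF forest_union_commute[of F G] forest_isom_id H(1) H(1), of "inr s"] s
        by simp
    qed (use s F G H in \<open>simp_all add: rooted_forest_graft rooted_forest_union\<close>)
    also have "\<dots> = rforest_mult (abs_rforest (forest_graft G s H)) X"
      using s F G H
      by (simp add: rforest_mult_abs rooted_forest_graft rooted_forest_union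
        rforest_eqI[OF forest_graft_union])
    finally show ?thesis by (simp add: rforest_mult_commute)
  qed
  have "rforest_prelie (rforest_mult X Y) Z =
      (\<Sum>s\<in>verts F. Poly_Mapping.single (abs_rforest (forest_graft (forest_union F G) (inl s) H)) 1) +
      (\<Sum>s\<in>verts G. Poly_Mapping.single (abs_rforest (forest_graft (forest_union F G) (inr s) H)) 1)"
    using F G H rooted_forest_finite
    by (simp add: rforest_mult_abs rforest_prelie_abs rooted_forest_union)
       (subst sum.union_disjoint, auto simp: sum.reindex inj_on_def)
  then show ?thesis
    using F G H
    by (simp add: l r rforest_prelie_abs bilinear_ext_sum_left bilinear_ext_sum_right)
qed

text \<open>The vertices of \<open>F \<bullet>\<^sub>s G\<close> come from \<open>F\<close> or from
  \<open>G\<close>. Grafts of \<open>H\<close> onto \<open>G\<close> cancel against the second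
  product, and those where \<open>G\<close> and \<open>H\<close> both sit on vertices of
  \<open>F\<close> remain.\<close>

lemma rforest_prelie_graft:
  assumes F: "rooted_forest F" and G: "rooted_forest G" and H: "rooted_forest H"
  shows "bilinear_ext rforest_prelie (rforest_prelie (abs_rforest F) (abs_rforest G)) (Poly_Mapping.single (abs_rforest H) 1)
     - bilinear_ext rforest_prelie (Poly_Mapping.single (abs_rforest F) 1) (rforest_prelie (abs_rforest G) (abs_rforest H))
    = (\<Sum>s\<in>verts F. \<Sum>t\<in>verts F.
        Poly_Mapping.single (abs_rforest (forest_graft (forest_graft F s G) (inl t) H)) 1)"
proof -
  have *: "rforest_prelie (abs_rforest (forest_graft F s G)) (abs_rforest H) =
      (\<Sum>t\<in>verts F. Poly_Mapping.single (abs_rforest (forest_graft (forest_graft F s G) (inl t) H)) 1) +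
      (\<Sum>t\<in>verts G. Poly_Mapping.single (abs_rforest (forest_graft F s (forest_graft G t H))) 1)"
    if s: "s \<in> verts F" for s
  proof -
    have "rforest_prelie (abs_rforest (forest_graft F s G)) (abs_rforest H) =
      (\<Sum>t\<in>verts F. Poly_Mapping.single (abs_rforest (forest_graft (forest_graft F s G) (inl t) H)) 1) +
      (\<Sum>t\<in>verts G. Poly_Mapping.single (abs_rforest (forest_graft (forest_graft F s G) (inr t) H)) 1)"
      using F G H rooted_forest_finite s
      by (simp add: rforest_prelie_abs rooted_forest_graft)
         (subst sum.union_disjoint, auto simp: sum.reindex inj_on_def)
    then show ?thesis
      using F G H s by (simp add: rforest_eqI[OF forest_graft_graft_inr] rooted_forest_graft)
  qed
  \<comment> \<open>The cancelling double sums run over \<open>verts F\<close> and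
    \<open>verts G\<close> in opposite orders, which accounts for the exchange of
    summations.\<close>
  show ?thesis
    using F G H
    by (simp add: rforest_prelie_abs[OF F G] rforest_prelie_abs[OF G H] bilinear_ext_sum_left bilinear_ext_sum_right *
        rforest_prelie_abs[OF F] rooted_forest_graft sum.distrib)
       (subst (2) sum.swap, simp)
qed

lemma rforest_prelie_identity:
  "bilinear_ext rforest_prelie (rforest_prelie X Y) (Poly_Mapping.single Z 1)
     - bilinear_ext rforest_prelie (Poly_Mapping.single X 1) (rforest_prelie Y Z)
   = bilinear_ext rforest_prelie (rforest_prelie X Z) (Poly_Mapping.single Y 1)
     - bilinear_ext rforest_prelie (Poly_Mapping.single X 1) (rforest_prelie Z Y)"
proof -
  obtain F G H where F: "rooted_forest F" "X = abs_rforest F" and G: "rooted_forest G" "Y = abs_rforest G"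
    and H: "rooted_forest H" "Z = abs_rforest H"
    using rforest_cases by metis
  have "abs_rforest (forest_graft (forest_graft F s G) (inl t) H) =
      abs_rforest (forest_graft (forest_graft F t H) (inl s) G)"
    if "s \<in> verts F" "t \<in> verts F" for s t
    using that F G H by (intro rforest_eqI[OF forest_graft_graft_inl] rooted_forest_graft) auto
  then show ?thesis
    unfolding F(2) G(2) H(2) rforest_prelie_graft[OF F(1) G(1) H(1)] rforest_prelie_graft[OF F(1) H(1) G(1)]
    by (subst sum.swap) simp
qed

section \<open>Decomposition of partitioned trees\<close>

text \<open>A vertex whose parent lies outside \<open>W\<close> becomes a root. Blocks are traces on
  \<open>W\<close>, and empty traces must be discarded to have a partition.\<close>

definition prestrict :: "'d pforest \<Rightarrow> nat set \<Rightarrow> 'd pforest" where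
  "prestrict T W = \<lparr>verts = W, edges = edges T \<inter> W \<times> W, deco = deco T,
    blocks = (\<inter>) W ` blocks T - {{}}\<rparr>"

lemma prestrict_simps [simp]:
  "verts (prestrict T W) = W" "edges (prestrict T W) = edges T \<inter> W \<times> W"
  "deco (prestrict T W) = deco T" "blocks (prestrict T W) = (\<inter>) W ` blocks T - {{}}"
  by (simp_all add: prestrict_def)

lemma rooted_forest_prestrict:
  assumes T: "rooted_forest T" and W: "W \<subseteq> verts T"
  shows "rooted_forest (prestrict T W)"
proof (rule rooted_forestI)
  show "finite (verts (prestrict T W))"
    using W finite_subset[OF W rooted_forest_finite[OF T]] by simp
  show "wf (edges (prestrict T W))"
    using wf_subset[OF rooted_forest_wf[OF T]] by simp
qed (use rooted_forest_parent[OF T] in auto)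

text \<open>Asking that the new roots be the trace of one block is what makes the restriction a
  tree. The other blocks must then keep their common parent.\<close>

lemma partitioned_tree_prestrict:
  assumes T: "partitioned_tree T" and W: "W \<subseteq> verts T"
    and B: "B \<in> blocks T" and roots: "roots (prestrict T W) = W \<inter> B"
  shows "partitioned_tree (prestrict T W)"
  unfolding partitioned_tree_iff
proof (intro conjI ballI)
  note T' = partitioned_treeD[OF T]
  show "rooted_forest (prestrict T W)" by (rule rooted_forest_prestrict[OF T'(1) W])
  show "partition_on (verts (prestrict T W)) (blocks (prestrict T W))"
    using partition_on_restrict[OF T'(2), of W] W by (simp add: inf.absorb1)
  show "roots (prestrict T W) = {} \<or> roots (prestrict T W) \<in> blocks (prestrict T W)"
    unfolding roots using B by auto
  fix C' assume "C' \<in> blocks (prestrict T W)"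
  then obtain C where C: "C \<in> blocks T" "C' = W \<inter> C" "C' \<noteq> {}" by auto
  have root: "C' = roots (prestrict T W)" if "v \<in> C'" "v \<in> roots (prestrict T W)" for v
    using partition_on_eq[OF T'(2) C(1) B, of v] that C(2) roots by auto
  show "C' = roots (prestrict T W) \<or> (\<exists>u. \<forall>v\<in>C'. (u, v) \<in> edges (prestrict T W))"
  proof (cases "C = roots T")
    case True
    obtain v where "v \<in> C'" using C(3) by blast
    moreover from this have "v \<in> roots (prestrict T W)"
      using True C(2) by (auto simp: roots_def)
    ultimately show ?thesis using root by blast
  next
    case False
    then obtain u where u: "\<forall>v\<in>C. (u, v) \<in> edges T" using T'(3) C(1) by blast
    show ?thesis
    proof (cases "u \<in> W")
      case True
      then have "\<forall>v\<in>C'. (u, v) \<in> edges (prestrict T W)" using u C(2) by auto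
      then show ?thesis by blast
    next
      \<comment> \<open>If the parent of the block is lost, all its remaining vertices are roots, so
        the block is the root block.\<close>
      case False
      obtain v where v: "v \<in> C'" using C(3) by blast
      then have "v \<in> roots (prestrict T W)"
        using False u C(2) rooted_forest_parent[OF T'(1), of u v] by (auto simp: roots_def)
      then show ?thesis using root v by blast
    qed
  qed
qed

text \<open>When no block crosses the boundary of \<open>W\<close>, each block equals one of its two
  traces, and no other nonempty trace occurs.\<close>

lemma Un_partition_restrict:
  assumes P: "partition_on V P" and C: "\<And>C. C \<in> P \<Longrightarrow> C \<subseteq> W \<or> C \<inter> W = {}"
  shows "((\<inter>) (V - W) ` P - {{}}) \<union> ((\<inter>) W ` P - {{}}) = P"
proof
  show "((\<inter>) (V - W) ` P - {{}}) \<union> ((\<inter>) W ` P - {{}}) \<subseteq> P"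
  proof
    fix X assume "X \<in> ((\<inter>) (V - W) ` P - {{}}) \<union> ((\<inter>) W ` P - {{}})"
    then obtain B where B: "B \<in> P" "X \<noteq> {}" "X = (V - W) \<inter> B \<or> X = W \<inter> B" by blast
    have "B \<subseteq> V" using partition_onD1[OF P] B(1) by blast
    then have "X = B" using C[OF B(1)] B(2,3) by blast
    then show "X \<in> P" using B by simp
  qed
  show "P \<subseteq> ((\<inter>) (V - W) ` P - {{}}) \<union> ((\<inter>) W ` P - {{}})"
  proof
    fix B assume B: "B \<in> P"
    have "B \<subseteq> V" "B \<noteq> {}" using partition_onD1[OF P] partition_onD3[OF P] B by auto
    then have "B = (V - W) \<inter> B \<or> B = W \<inter> B" using C[OF B] by blast
    then show "B \<in> ((\<inter>) (V - W) ` P - {{}}) \<union> ((\<inter>) W ` P - {{}})"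
      using B \<open>B \<noteq> {}\<close> by auto
  qed
qed

lemma bij_betw_restrict_parts:
  "W \<subseteq> V \<Longrightarrow> bij_betw (case_nat_sum id id) (inl ` (V - W) \<union> inr ` W) V"
  by (rule bij_betw_case_nat_sum) auto

text \<open>The condition on edges says that \<open>W\<close> is a union of connected components.
  Separating components inverts the product.\<close>

lemma mult_decomposition:
  assumes T: "partitioned_tree T" and W: "W \<subseteq> verts T"
    and ne: "verts T \<noteq> {}" and cross: "\<And>u v. (u, v) \<in> edges T \<Longrightarrow> u \<in> W \<longleftrightarrow> v \<in> W"
  defines "S \<equiv> prestrict T (verts T - W)" and "R \<equiv> prestrict T W"
  shows "partitioned_tree S" "partitioned_tree R"
    "pforest_isom (case_nat_sum id id) (pforest_mult S R) T"
proof -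
  note T' = partitioned_treeD[OF T]
  have rT: "roots T \<in> blocks T" using T' ne roots_empty_iff[OF T'(1)] by blast
  have rR: "roots R = W \<inter> roots T"
    unfolding R_def roots_def prestrict_simps using W cross by blast
  have rS: "roots S = (verts T - W) \<inter> roots T"
    unfolding S_def roots_def prestrict_simps
    using W cross rooted_forest_edge[OF T'(1)] by blast
  show "partitioned_tree S" "partitioned_tree R"
    using partitioned_tree_prestrict[OF T _ rT] rS rR W unfolding S_def R_def by auto
  have iso: "forest_isom (case_nat_sum id id) (forest_union S R) T"
  proof (rule forest_isomI)
    show "bij_betw (case_nat_sum id id) (verts (forest_union S R)) (verts T)"
      using bij_betw_restrict_parts[OF W] by (simp add: S_def R_def)
  qed (auto simp: S_def R_def dest: cross)
  \<comment> \<open>Only the root block can cross the boundary of \<open>W\<close>, since any other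
    block has one common parent. It is set aside here and restored below as the merged block of the
    product.\<close>
  let ?R = "roots T"
  have "partition_on (verts T - ?R) (blocks T - {?R})"
    by (rule partition_on_remove[OF T'(2) T'(4)])
  moreover have C: "C \<subseteq> W \<or> C \<inter> W = {}" if "C \<in> blocks T - {?R}" for C
    using T'(3)[of C] that cross by blast
  ultimately have "((\<inter>) (verts T - ?R - W) ` (blocks T - {?R}) - {{}}) \<union> ((\<inter>) W ` (blocks T - {?R}) - {{}})
      = blocks T - {?R}"
    by (rule Un_partition_restrict)
  moreover have nr: "C \<inter> ?R = {}" if "C \<in> blocks T - {?R}" for C
    using partition_on_eq[OF T'(2) _ rT] that by blast
  have inter: "(\<inter>) X ` (blocks T - {?R}) - {{}} = (\<inter>) X ` blocks T - {{}} - {X \<inter> ?R}" for X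
    using nr by blast
  have "(\<inter>) (verts T - ?R - W) ` (blocks T - {?R}) = (\<inter>) (verts T - W) ` (blocks T - {?R})"
    using nr by (intro image_cong) auto
  then have "(\<inter>) (verts T - ?R - W) ` (blocks T - {?R}) - {{}} = blocks S - {roots S}"
    "(\<inter>) W ` (blocks T - {?R}) - {{}} = blocks R - {roots R}"
    unfolding rS rR by (simp_all add: inter) (simp_all add: S_def R_def)
  ultimately have bl: "blocks S - {roots S} \<union> (blocks R - {roots R}) = blocks T - {?R}" by simp
  have "(`) (case_nat_sum id id) ` blocks (pforest_mult S R) =
      (blocks S - {roots S}) \<union> (blocks R - {roots R}) \<union> {?R}"
  proof -
    have un: "roots S \<union> roots R = ?R" unfolding rS rR by (auto simp: roots_def)
    have ne': "roots (pforest_mult S R) \<noteq> {}"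
      using un rT partition_onD3[OF T'(2)] by auto
    then show ?thesis
      unfolding pforest_mult_blocks using un by (simp add: image_Un image_image)
  qed
  then have "(`) (case_nat_sum id id) ` blocks (pforest_mult S R) = blocks T"
    using bl rT by auto
  then show "pforest_isom (case_nat_sum id id) (pforest_mult S R) T"
    using iso by (simp add: pforest_isom_def)
qed

text \<open>Inverse of grafting: \<open>W\<close> is closed under descent and is entered only along
  the edges from \<open>r\<close> to the block \<open>B\<close>, so \<open>B\<close> becomes the
  root block of the part cut off.\<close>

lemma graft_decomposition:
  assumes T: "partitioned_tree T" and W: "W \<subseteq> verts T" and r: "r \<in> verts T - W"
    and B: "B \<in> blocks T" "B \<subseteq> W" "\<And>v. v \<in> B \<Longrightarrow> (r, v) \<in> edges T"
    and down: "\<And>u v. (u, v) \<in> edges T \<Longrightarrow> u \<in> W \<Longrightarrow> v \<in> W"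
    and up: "\<And>u v. (u, v) \<in> edges T \<Longrightarrow> v \<in> W \<Longrightarrow> u \<notin> W \<Longrightarrow> u = r \<and> v \<in> B"
    and nr: "W \<inter> roots T = {}"
  defines "S \<equiv> prestrict T (verts T - W)" and "F \<equiv> prestrict T W"
  shows "partitioned_tree S" "partitioned_tree F" "roots S = roots T"
    "pforest_isom (case_nat_sum id id) (pforest_graft S r F) T"
proof -
  note T' = partitioned_treeD[OF T]
  have "roots T \<noteq> {}" using roots_empty_iff[OF T'(1)] r by blast
  then have rT: "roots T \<in> blocks T" using T'(4) by blast
  show rS: "roots S = roots T"
  proof
    show "roots S \<subseteq> roots T"
      unfolding S_def roots_def using down rooted_forest_edge[OF T'(1)] by auto
    show "roots T \<subseteq> roots S"
      unfolding S_def using nr by (auto simp: roots_def)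
  qed
  have rF: "roots F = B"
  proof
    show "roots F \<subseteq> B"
    proof
      fix v assume v: "v \<in> roots F"
      then have vW: "v \<in> W" by (simp add: F_def roots_def)
      then obtain u where u: "(u, v) \<in> edges T" using nr W by (auto simp: roots_def)
      then have "u \<notin> W" using v vW by (auto simp: F_def roots_def)
      then show "v \<in> B" using up[OF u vW] by simp
    qed
    show "B \<subseteq> roots F"
      using B r rooted_forest_parent[OF T'(1)] unfolding F_def roots_def by fastforce
  qed
  show "partitioned_tree S"
    using partitioned_tree_prestrict[OF T _ rT, of "verts T - W"] rS nr unfolding S_def
    by (auto simp: roots_def)
  show "partitioned_tree F"
    using partitioned_tree_prestrict[OF T W B(1)] rF B(2) unfolding F_def
    by (auto simp: inf.absorb2)
  have iso: "forest_isom (case_nat_sum id id) (forest_graft S r F) T"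
  proof (rule forest_isomI)
    show "bij_betw (case_nat_sum id id) (verts (forest_graft S r F)) (verts T)"
      using bij_betw_restrict_parts[OF W] by (simp add: S_def F_def)
    fix v w assume "v \<in> verts (forest_graft S r F)" "w \<in> verts (forest_graft S r F)"
    then show "(v, w) \<in> edges (forest_graft S r F) \<longleftrightarrow>
        (case_nat_sum id id v, case_nat_sum id id w) \<in> edges T"
      using down up B by (auto simp: rF) (auto simp: S_def F_def)
  qed (auto simp: S_def F_def)
  \<comment> \<open>If the parent of a block meeting \<open>W\<close> is outside \<open>W\<close>,
    the block shares a vertex with \<open>B\<close>, hence equals \<open>B\<close> and lies in
    \<open>W\<close>.\<close>
  have "C \<subseteq> W \<or> C \<inter> W = {}" if C: "C \<in> blocks T" for C
  proof (cases "C = roots T")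
    case True
    then show ?thesis using nr by blast
  next
    case False
    then obtain u where u: "\<And>v. v \<in> C \<Longrightarrow> (u, v) \<in> edges T" using T'(3) C by blast
    show ?thesis
    proof (cases "u \<in> W \<or> C \<inter> W = {}")
      case True
      then show ?thesis using down u by blast
    next
      case False
      then obtain v where "v \<in> C" "v \<in> B" using up u by blast
      then show ?thesis using partition_on_eq[OF T'(2) C B(1)] B(2) by blast
    qed
  qed
  from Un_partition_restrict[OF T'(2) this]
  have "(`) (case_nat_sum id id) ` blocks (pforest_graft S r F) = blocks T"
    by (simp add: image_Un image_image S_def F_def)
  then show "pforest_isom (case_nat_sum id id) (pforest_graft S r F) T"
    using iso by (simp add: pforest_isom_def)
qed

text \<open>Deleting the root turns its children into roots, and grafting what remains onto a single
  vertex restores the tree. The value \<open>f (inl 0) = r\<close> identifies the vertex at which a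
  further forest is to be grafted.\<close>

lemma root_decomposition:
  assumes S: "rooted_forest S" and r: "roots S = {r}"
  obtains f and G :: "'d forest" where "rooted_forest G" "deco G = deco S" "verts G = verts S - {r}"
    "forest_isom f (forest_graft (single_pforest (deco S r)) 0 G) S" "f (inl 0) = r"
proof -
  define G where "G = \<lparr>verts = verts S - {r}, edges = edges S \<inter> (verts S - {r}) \<times> (verts S - {r}),
    deco = deco S\<rparr>"
  have G: "rooted_forest G"
  proof (rule rooted_forestI)
    show "finite (verts G)" using rooted_forest_finite[OF S] by (simp add: G_def)
    show "wf (edges G)" using wf_subset[OF rooted_forest_wf[OF S]] by (simp add: G_def)
  qed (use rooted_forest_parent[OF S] in \<open>auto simp: G_def\<close>)
  have rv: "r \<in> verts S" "(u, r) \<notin> edges S" for u using r by (auto simp: roots_def)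
  have rG: "v \<in> roots G \<longleftrightarrow> (r, v) \<in> edges S" for v
  proof
    assume v: "v \<in> roots G"
    then have "v \<in> verts S" "v \<notin> roots S" by (auto simp: r) (auto simp: G_def roots_def)
    then obtain u where u: "(u, v) \<in> edges S" by (auto simp: roots_def)
    then have "u = r" using v rooted_forest_edge[OF S u] by (auto simp: G_def roots_def)
    then show "(r, v) \<in> edges S" using u by simp
  next
    assume rv': "(r, v) \<in> edges S"
    then have "v \<noteq> r" using rv by auto
    then show "v \<in> roots G"
      using rooted_forest_edge[OF S rv'] rooted_forest_parent[OF S rv'] by (auto simp: G_def roots_def)
  qed
  have "forest_isom (case_nat_sum (\<lambda>_. r) id) (forest_graft (single_pforest (deco S r)) 0 G) S"
  proof (rule forest_isomI)
    show "bij_betw (case_nat_sum (\<lambda>_. r) id) (verts (forest_graft (single_pforest (deco S r)) 0 G)) (verts S)"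
      unfolding forest_graft_simps
      by (rule bij_betw_case_nat_sum) (use rv in \<open>auto simp: G_def\<close>)
  qed (use rv in \<open>auto simp: rG\<close>, auto simp: G_def)
  then show thesis using that[OF G] by (simp add: G_def)
qed

text \<open>The vertices at depth one. Their number is the second component of the measure in the
  reduction to coarse trees.\<close>

definition level_one :: "('d, 'z) forest_scheme \<Rightarrow> nat set" where
  "level_one F = {v. \<exists>u\<in>roots F. (u, v) \<in> edges F}"

lemma card_level_one_isom:
  assumes f: "forest_isom f F G" and F: "rooted_forest F" and G: "rooted_forest G"
  shows "card (level_one G) = card (level_one F)"
proof -
  have inj: "inj_on f (verts F)" and im: "verts G = f ` verts F"
    using f by (simp_all add: forest_isom_def bij_betw_def)
  have sub: "level_one F \<subseteq> verts F" "roots F \<subseteq> verts F"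
    using rooted_forest_edge(2)[OF F] by (auto simp: level_one_def roots_def)
  have e: "(u, v) \<in> edges F \<longleftrightarrow> (f u, f v) \<in> edges G" if "u \<in> verts F" "v \<in> verts F" for u v
    using f that by (simp add: forest_isom_def)
  have "level_one G = f ` level_one F"
  proof
    show "level_one G \<subseteq> f ` level_one F"
    proof
      fix w assume "w \<in> level_one G"
      then obtain u where u: "u \<in> roots F" "(f u, w) \<in> edges G"
        by (auto simp: level_one_def forest_isom_roots[OF f F G])
      then obtain v where v: "w = f v" "v \<in> verts F" using rooted_forest_edge(2)[OF G] im by blast
      then have "(u, v) \<in> edges F" using u e sub(2) by blast
      then show "w \<in> f ` level_one F" using u(1) v(1) by (auto simp: level_one_def)
    qed
    show "f ` level_one F \<subseteq> level_one G"
      using e sub by (auto simp: level_one_def forest_isom_roots[OF f F G]) blast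
  qed
  then show ?thesis using card_image[OF inj_on_subset[OF inj sub(1)]] by simp
qed

lemma level_one_single_root: "roots F = {r} \<Longrightarrow> level_one F = children F r"
  by (auto simp: level_one_def children_def)

text \<open>A graft away from the root places the roots of \<open>F\<close> at depth at least two,
  so depth one gains vertices only if \<open>s = r\<close>.\<close>

lemma card_level_one_graft:
  assumes F: "rooted_forest F" and S: "rooted_forest S" and r: "roots S = {r}"
  shows "card (level_one (forest_graft S s F)) =
    card (level_one S) + (if s = r then card (roots F) else 0)"
proof -
  have fin: "finite (children S r)" "finite (roots F)"
    using rooted_forest_finite[OF S] rooted_forest_finite[OF F] rooted_forest_edge(2)[OF S]
    by (auto simp: children_def roots_def intro: finite_subset)
  have "level_one S = children S r" "level_one (forest_graft S s F) = children (forest_graft S s F) (inl r)"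
    using F r by (simp_all add: level_one_single_root)
  moreover have "card (inl ` A \<union> inr ` B) = card A + card B" if "finite A" "finite B" for A B
    using that by (subst card_Un_disjoint) (auto simp: card_image inj_on_def)
  ultimately show ?thesis
    using fin by (auto simp: children_forest_graft card_image inj_on_def)
qed

lemma pforest_mult_commute:
  "pforest_isom (case_nat_sum inr inl) (pforest_mult F G) (pforest_mult G F)"
proof -
  have single: "(`) h ` ({c} - {{}}) = {h ` c} - {{}}" for h :: "nat \<Rightarrow> nat" and c
    by (cases "c = {}") auto
  have "blocks (pforest_mult G F) = (`) (case_nat_sum inr inl) ` blocks (pforest_mult F G)"
    unfolding pforest_mult_def pforest.simps image_Un single
    by (simp add: image_Un image_image) (simp add: Un_ac)
  then show ?thesis using forest_union_commute by (simp add: pforest_isom_def)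
qed

text \<open>An ideal is closed under multiplication on one side by definition; commutativity gives
  congruence in the other factor.\<close>

lemma ptree_mult_commute: "ptree_mult X Y = ptree_mult Y X"
proof -
  obtain F G where "partitioned_tree F" "X = abs_ptree F" "partitioned_tree G" "Y = abs_ptree G"
    using partitioned_tree_rep abs_rep_ptree by metis
  then show ?thesis
    by (simp add: ptree_mult_abs)
       (intro ptree_eqI[OF pforest_mult_commute] partitioned_tree_mult)
qed

section \<open>Descendants of a set of vertices\<close>

lemma roots_reach:
  assumes F: "rooted_forest F" and v: "v \<in> verts F"
  shows "v \<in> (edges F)\<^sup>* `` roots F"
  using v
proof (induction v rule: wf_induct_rule[OF rooted_forest_wf[OF F]])
  case (1 v)
  show ?case
  proof (cases "v \<in> roots F")
    case False
    then obtain u where u: "(u, v) \<in> edges F" using 1(2) by (auto simp: roots_def)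
    then show ?thesis using 1(1)[OF u] rooted_forest_edge(1)[OF F u] by (meson Image_iff rtrancl.simps)
  qed auto
qed

lemma descendants_subset:
  assumes F: "rooted_forest F" and A: "A \<subseteq> verts F"
  shows "(edges F)\<^sup>* `` A \<subseteq> verts F"
proof
  fix v assume "v \<in> (edges F)\<^sup>* `` A"
  then obtain a where "(a, v) \<in> (edges F)\<^sup>*" "a \<in> A" by blast
  then show "v \<in> verts F"
    using A rooted_forest_edge(2)[OF F] by (induction rule: rtrancl_induct) auto
qed

lemma descendants_down: "u \<in> E\<^sup>* `` A \<Longrightarrow> (u, v) \<in> E \<Longrightarrow> v \<in> E\<^sup>* `` A"
  by (meson Image_iff rtrancl.rtrancl_into_rtrancl)

text \<open>A nontrivial path from \<open>A\<close> to \<open>v\<close> ends with an edge into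
  \<open>v\<close>, and \<open>(u, v)\<close> is the only such edge.\<close>

lemma descendants_up:
  assumes F: "rooted_forest F" and v: "v \<in> (edges F)\<^sup>* `` A" and u: "(u, v) \<in> edges F"
  shows "u \<in> (edges F)\<^sup>* `` A \<or> v \<in> A"
proof -
  obtain a where a: "a \<in> A" "(a, v) \<in> (edges F)\<^sup>*" using v by blast
  from a(2) show ?thesis
  proof (cases rule: rtranclE)
    case (step y)
    then show ?thesis using rooted_forest_parent[OF F u] a(1) by blast
  qed (use a in simp)
qed

section \<open>Reduction to the coarsest partition\<close>

text \<open>If there is no block besides the root block, every vertex is a root and no vertex has
  children. The empty tree is included.\<close>

lemma coarse_pforest_eq_self:
  assumes T: "partitioned_tree T" and bl: "blocks T \<subseteq> {roots T}"
  shows "coarse_pforest T = T"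
proof -
  note T' = partitioned_treeD[OF T]
  have V: "verts T \<subseteq> roots T" using partition_onD1[OF T'(2)] bl by auto
  have "children T u = {}" for u
    using V rooted_forest_edge(2)[OF T'(1)] by (fastforce simp: children_def roots_def)
  then have "blocks (coarse_pforest T) = {roots T} - {{}}" by auto
  also have "\<dots> = blocks T"
    using bl T'(4) partition_onD3[OF T'(2)] by (cases "roots T = {}") auto
  finally show ?thesis
    by (intro pforest.equality) (simp_all del: coarse_pforest_simps(4))
qed

text \<open>Truncation allows each of \<open>F\<close> and \<open>G\<close> to carry blocks or not;
  their coarse versions depend only on the underlying forests.\<close>

lemma abs_coarse_pforest_eqI:
  assumes "forest_isom f F G" "rooted_forest F" "rooted_forest G"
  shows "abs_ptree (coarse_pforest F) = abs_ptree (coarse_pforest G)"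
proof -
  have "abs_rforest (forest.truncate F) = abs_rforest (forest.truncate G)"
    using assms by (intro rforest_eqI[of f]) simp_all
  then show ?thesis
    using coarse_ptree_abs[of "forest.truncate F"] coarse_ptree_abs[of "forest.truncate G"] assms(2,3)
    by simp
qed

lemma coarse_pforest_graft: "coarse_pforest (pforest_graft F s G) = coarse_pforest (forest_graft F s G)"
  by (metis coarse_truncate truncate_pforest(2))

abbreviation ptree_basis :: "'d pforest \<Rightarrow> ('d ptree \<Rightarrow>\<^sub>0 'k::comm_ring_1)" where
  "ptree_basis T \<equiv> Poly_Mapping.single (abs_ptree T) 1"

abbreviation ptree_mult_ext where
  "ptree_mult_ext \<equiv> bilinear_ext (\<lambda>S T. Poly_Mapping.single (ptree_mult S T) 1)"

lemma ptree_mult_ext_basis: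
  assumes "partitioned_tree F" "partitioned_tree G"
  shows "ptree_mult_ext (ptree_basis F) (ptree_basis G) = ptree_basis (pforest_mult F G)"
  using assms by (simp add: ptree_mult_abs)

text \<open>The graft at the chosen vertex \<open>r\<close> is singled out, so that it can be
  expressed as a product minus grafts at the other vertices.\<close>

lemma ptree_prelie_basis:
  assumes F: "partitioned_tree F" and G: "partitioned_tree G" and r: "r \<in> verts F"
  shows "bilinear_ext ptree_prelie (ptree_basis F) (ptree_basis G) =
    ptree_basis (pforest_graft F r G) + (\<Sum>s\<in>verts F - {r}. ptree_basis (pforest_graft F s G))"
  using r rooted_forest_finite[OF partitioned_treeD(1)[OF F]]
  by (simp add: ptree_prelie_abs[OF F G] sum.remove[of "verts F" r])

text \<open>The properties of a Com-PreLie ideal containing the generators, with each generator written out as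
  the difference of two trees.\<close>

locale generator_ideal =
  fixes D :: "'d set" and I :: "('d ptree \<Rightarrow>\<^sub>0 'k::field_char_0) set"
  assumes zero: "0 \<in> I"
    and add: "\<And>x y. x \<in> I \<Longrightarrow> y \<in> I \<Longrightarrow> x + y \<in> I"
    and smult: "\<And>r x. x \<in> I \<Longrightarrow> free_smult r x \<in> I"
    and mult: "\<And>x y. x \<in> I \<Longrightarrow> Poly_Mapping.keys y \<subseteq> PT D \<Longrightarrow> ptree_mult_ext x y \<in> I"
    and prelie_left: "\<And>x y. x \<in> I \<Longrightarrow> Poly_Mapping.keys y \<subseteq> PT D \<Longrightarrow> bilinear_ext ptree_prelie x y \<in> I"
    and prelie_right: "\<And>x y. x \<in> I \<Longrightarrow> Poly_Mapping.keys y \<subseteq> PT D \<Longrightarrow> bilinear_ext ptree_prelie y x \<in> I"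
    and generator: "\<And>d F G. d \<in> D \<Longrightarrow> ptree_on D F \<Longrightarrow> ptree_on D G \<Longrightarrow>
      ptree_basis (pforest_graft (pforest_graft (single_pforest d) 0 F) (inl 0) G)
      - ptree_basis (pforest_graft (single_pforest d) 0 (pforest_mult F G)) \<in> I"
begin

lemma uminus: "x \<in> I \<Longrightarrow> - x \<in> I"
proof -
  have "free_smult (-1) x = - x" by (rule poly_mapping_eqI) simp
  then show "x \<in> I \<Longrightarrow> - x \<in> I" using smult[of x "-1"] by simp
qed

lemma diff: "x \<in> I \<Longrightarrow> y \<in> I \<Longrightarrow> x - y \<in> I"
  using add[of x "- y"] uminus by simp

lemma sum: "(\<And>i. i \<in> A \<Longrightarrow> f i \<in> I) \<Longrightarrow> (\<Sum>i\<in>A. f i) \<in> I"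
  by (induction A rule: infinite_finite_induct) (simp_all add: zero add)

lemma trans: "x - y \<in> I \<Longrightarrow> y - z \<in> I \<Longrightarrow> x - z \<in> I"
  using add[of "x - y" "y - z"] by simp

lemma keys_basis: "ptree_on D T \<Longrightarrow> Poly_Mapping.keys (ptree_basis T) \<subseteq> PT D"
  by (simp add: abs_in_PT)

text \<open>One factor is replaced at a time, the second one after exchanging the factors.\<close>

lemma mult_cong:
  assumes F: "ptree_on D F" "ptree_on D F'" and G: "ptree_on D G" "ptree_on D G'"
    and FI: "ptree_basis F - ptree_basis F' \<in> I" and GI: "ptree_basis G - ptree_basis G' \<in> I"
  shows "ptree_basis (pforest_mult F G) - ptree_basis (pforest_mult F' G') \<in> I"
proof (rule trans)
  have comm: "ptree_basis (pforest_mult F G) = ptree_basis (pforest_mult G F)"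
    if "ptree_on D F" "ptree_on D G" for F G
    using ptree_mult_commute[of "abs_ptree F" "abs_ptree G"] that by (simp add: ptree_mult_abs ptree_onD)
  show "ptree_basis (pforest_mult F G) - ptree_basis (pforest_mult F' G) \<in> I"
    using mult[OF FI keys_basis[OF G(1)]] F G by (simp add: ptree_mult_abs ptree_onD)
  have "ptree_basis (pforest_mult G F') - ptree_basis (pforest_mult G' F') \<in> I"
    using mult[OF GI keys_basis[OF F(2)]] F G by (simp add: ptree_mult_abs ptree_onD)
  then show "ptree_basis (pforest_mult F' G) - ptree_basis (pforest_mult F' G') \<in> I"
    using comm F G by metis
qed

lemma prelie_cong:
  assumes F: "ptree_on D F" "ptree_on D F'" and G: "ptree_on D G" "ptree_on D G'"
    and FI: "ptree_basis F - ptree_basis F' \<in> I" and GI: "ptree_basis G - ptree_basis G' \<in> I"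
  shows "bilinear_ext ptree_prelie (ptree_basis F) (ptree_basis G)
    - bilinear_ext ptree_prelie (ptree_basis F') (ptree_basis G') \<in> I"
proof (rule trans)
  show "bilinear_ext ptree_prelie (ptree_basis F) (ptree_basis G)
    - bilinear_ext ptree_prelie (ptree_basis F') (ptree_basis G) \<in> I"
    using prelie_left[OF FI keys_basis[OF G(1)]] by (simp del: bilinear_ext_single)
  show "bilinear_ext ptree_prelie (ptree_basis F') (ptree_basis G)
    - bilinear_ext ptree_prelie (ptree_basis F') (ptree_basis G') \<in> I"
    using prelie_right[OF GI keys_basis[OF F(2)]] by (simp del: bilinear_ext_single)
qed

theorem coarse_equiv:
  assumes "ptree_on D T"
  shows "ptree_basis T - ptree_basis (coarse_pforest T) \<in> I"
  using assms
proof (induction T rule: wf_induct_rule[OF wf_inv_image[OF wf_lex_prod[OF wf_less_than wf_less_than],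
      where f = "\<lambda>T :: 'd pforest. (card (verts T), card (level_one T))"], case_names less])
  case (less T)
  note T = ptree_onD(1)[OF \<open>ptree_on D T\<close>] and T' = partitioned_treeD[OF ptree_onD(1)[OF \<open>ptree_on D T\<close>]]
  have D: "deco T ` verts T \<subseteq> D" using \<open>ptree_on D T\<close> by (simp add: ptree_on_def)
  have fin: "finite (verts T)" by (rule rooted_forest_finite[OF T'(1)])
  have IH: "ptree_basis S - ptree_basis (coarse_pforest S) \<in> I"
    if "ptree_on D S" "card (verts S) < card (verts T) \<or>
      card (verts S) = card (verts T) \<and> card (level_one S) < card (level_one T)" for S
    using less(1)[of S] that by simp
  let ?E = "edges T"
  \<comment> \<open>A tree that has a non-root block and at most one root must have a block of
    children of that root.\<close>
  consider (trivial) "blocks T \<subseteq> {roots T}" | (mult) r r' where "r \<in> roots T" "r' \<in> roots T" "r \<noteq> r'"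
    | (graft) r B where "roots T = {r}" "B \<in> blocks T" "B \<noteq> roots T" "\<And>v. v \<in> B \<Longrightarrow> (r, v) \<in> ?E"
  proof (cases "blocks T \<subseteq> {roots T} \<or> (\<exists>r\<in>roots T. \<exists>r'\<in>roots T. r \<noteq> r')")
    case False
    then obtain C where C: "C \<in> blocks T" "C \<noteq> roots T" by blast
    obtain c where c: "c \<in> C" using C(1) partition_onD3[OF T'(2)] by (metis all_not_in_conv)
    have nr: "v \<notin> roots T" if "A \<in> blocks T" "A \<noteq> roots T" "v \<in> A" for A v
      using T'(3)[OF that(1)] that by (auto simp: roots_def)
    \<comment> \<open>The block \<open>C\<close> may lie deep in the tree. The first edge of a path
      from the root to \<open>c\<close> ends in a child \<open>y\<close> of the root, and the block
      of \<open>y\<close> serves as \<open>B\<close>.\<close>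
    have "c \<in> verts T" using block_subset[OF T C(1)] c by blast
    from roots_reach[OF T'(1) this] obtain r where r: "r \<in> roots T" "(r, c) \<in> ?E\<^sup>*" by blast
    have "r \<noteq> c" using nr[OF C c] r(1) by blast
    with r(2) obtain y where y: "(r, y) \<in> ?E" by (meson converse_rtranclE)
    then have "y \<in> verts T" "y \<notin> roots T"
      using rooted_forest_edge(2)[OF T'(1)] by (auto simp: roots_def)
    then obtain B where B: "B \<in> blocks T" "y \<in> B" "B \<noteq> roots T"
      using partition_onD1[OF T'(2)] by blast
    then obtain u where u: "\<And>v. v \<in> B \<Longrightarrow> (u, v) \<in> ?E" using T'(3) by blast
    then have "u = r" using rooted_forest_parent[OF T'(1) _ y] B(2) by blast
    moreover have "roots T = {r}" using r(1) False by blast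
    ultimately show ?thesis using that(3) B u by blast
  qed (use that(1,2) in blast)
  then show ?case
  proof cases
    case trivial
    then show ?thesis by (simp add: coarse_pforest_eq_self[OF T] zero)
  next
    case (mult r r')
    \<comment> \<open>The component of \<open>r\<close>. The complement contains \<open>r'\<close>,
      so both parts have fewer vertices than \<open>T\<close>.\<close>
    let ?W = "?E\<^sup>* `` {r}"
    have rv: "r \<in> verts T" "r' \<in> verts T" "(u, r) \<notin> ?E" "(u, r') \<notin> ?E" for u
      using mult by (auto simp: roots_def)
    have W: "?W \<subseteq> verts T" using descendants_subset[OF T'(1)] rv by blast
    have r': "r' \<notin> ?W" using rv(4) mult(3) by (auto elim: rtranclE)
    have cross: "u \<in> ?W \<longleftrightarrow> v \<in> ?W" if "(u, v) \<in> ?E" for u v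
      using descendants_down[OF _ that] descendants_up[OF T'(1) _ that] rv(3) that by blast
    let ?S = "prestrict T (verts T - ?W)" and ?R = "prestrict T ?W"
    have SR: "partitioned_tree ?S" "partitioned_tree ?R"
      "pforest_isom (case_nat_sum id id) (pforest_mult ?S ?R) T"
      using mult_decomposition[OF T W] rv(1) cross by blast+
    have on: "ptree_on D ?S" "ptree_on D ?R"
      using SR D W by (auto simp: ptree_on_def)
    have "verts T - ?W \<subset> verts T" "?W \<subset> verts T"
      using rv W r' by blast+
    then have "card (verts ?S) < card (verts T)" "card (verts ?R) < card (verts T)"
      using psubset_card_mono[OF fin] by simp_all
    then have "ptree_basis ?S - ptree_basis (coarse_pforest ?S) \<in> I"
      "ptree_basis ?R - ptree_basis (coarse_pforest ?R) \<in> I"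
      using IH on by blast+
    moreover have on': "ptree_on D (coarse_pforest ?S)" "ptree_on D (coarse_pforest ?R)"
      using on by (auto simp: ptree_on_def partitioned_tree_coarse partitioned_treeD(1) simp del: coarse_pforest_simps(4))
    ultimately have "ptree_basis (pforest_mult ?S ?R)
        - ptree_basis (pforest_mult (coarse_pforest ?S) (coarse_pforest ?R)) \<in> I"
      using mult_cong on by blast
    moreover have "abs_ptree (pforest_mult ?S ?R) = abs_ptree T"
      by (rule ptree_eqI[OF SR(3) partitioned_tree_mult[OF SR(1,2)] T])
    moreover have "abs_ptree (pforest_mult (coarse_pforest ?S) (coarse_pforest ?R)) = abs_ptree (coarse_pforest T)"
      unfolding pforest_mult_coarse[OF SR(1,2)[THEN partitioned_treeD(1)]]
      using SR T' by (intro abs_coarse_pforest_eqI[where f = "case_nat_sum id id"])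
        (auto simp: pforest_isom_def rooted_forest_union partitioned_treeD(1))
    ultimately show ?thesis by simp
  next
    case (graft r B)
    \<comment> \<open>The part to be cut off: the block \<open>B\<close> with all its descendants.
      It is nonempty and misses \<open>r\<close>, so both parts are again smaller.\<close>
    let ?W = "?E\<^sup>* `` B"
    have Bv: "B \<subseteq> verts T" by (rule block_subset[OF T graft(2)])
    have rv: "r \<in> verts T" "(u, r) \<notin> ?E" for u
      using graft(1) by (auto simp: roots_def)
    have W: "?W \<subseteq> verts T" by (rule descendants_subset[OF T'(1) Bv])
    have BW: "B \<subseteq> ?W" by auto
    have up: "u = r \<and> v \<in> B" if "(u, v) \<in> ?E" "v \<in> ?W" "u \<notin> ?W" for u v
      using descendants_up[OF T'(1) that(2,1)] that(3) rooted_forest_parent[OF T'(1) that(1)] graft(4) by blast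
    have rW: "r \<notin> ?W"
    proof
      assume "r \<in> ?W"
      then obtain b where b: "b \<in> B" "(b, r) \<in> ?E\<^sup>*" by blast
      from b(2) have "b = r" using rv(2) by (auto elim: rtranclE)
      then show False using graft(4)[OF b(1)] rv(2) by simp
    qed
    have down: "v \<in> ?W" if "(u, v) \<in> ?E" "u \<in> ?W" for u v
      using descendants_down that by metis
    have rW': "r \<in> verts T - ?W" and nr': "?W \<inter> roots T = {}"
      using rv rW graft(1) by auto
    let ?S = "prestrict T (verts T - ?W)" and ?F = "prestrict T ?W"
    have dec: "partitioned_tree ?S" "partitioned_tree ?F" "roots ?S = roots T"
      "pforest_isom (case_nat_sum id id) (pforest_graft ?S r ?F) T"
      by (rule graft_decomposition[OF T W rW' graft(2) BW];
          (fact graft(4) | fact down | fact up | fact nr'))+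
    define S F where "S = ?S" and "F = ?F"
    have S: "partitioned_tree S" "rooted_forest S" "roots S = {r}" and F: "partitioned_tree F" "rooted_forest F"
      using dec graft(1) partitioned_treeD(1) by (simp_all add: S_def F_def)
    have verts: "verts S = verts T - ?W" "verts F = ?W" "deco S = deco T" "deco F = deco T"
      by (simp_all add: S_def F_def)
    have on: "ptree_on D S" "ptree_on D F"
      using S(1) F(1) order_trans[OF image_mono[OF W] D] order_trans[OF image_mono[OF Diff_subset] D]
      by (simp_all only: ptree_on_def verts)
    have on': "ptree_on D (coarse_pforest S)" "ptree_on D (coarse_pforest F)"
      using on S F by (auto simp: ptree_on_def partitioned_tree_coarse simp del: coarse_pforest_simps(4))
    have iso: "pforest_isom (case_nat_sum id id) (pforest_graft S r F) T"
      using dec(4) by (simp add: S_def F_def)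
    have rS: "r \<in> verts S" using rv rW verts by simp
    have ne: "?W \<noteq> {}" using graft(2) partition_onD3[OF T'(2)] BW by auto
    have "verts T - ?W \<subset> verts T" "?W \<subset> verts T"
      using rv W rW ne by blast+
    then have "card (verts S) < card (verts T)" "card (verts F) < card (verts T)"
      using psubset_card_mono[OF fin] by (simp_all add: verts)
    then have "ptree_basis S - ptree_basis (coarse_pforest S) \<in> I"
      "ptree_basis F - ptree_basis (coarse_pforest F) \<in> I"
      using IH on by blast+
    then have 1: "bilinear_ext ptree_prelie (ptree_basis S) (ptree_basis F)
        - bilinear_ext ptree_prelie (ptree_basis (coarse_pforest S)) (ptree_basis (coarse_pforest F)) \<in> I"
      using prelie_cong on on' by blast
    \<comment> \<open>The two grafts carry different partitions but the same underlying forest. Both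
      have as many vertices as \<open>T\<close> and fewer at depth one, so by induction both are
      congruent to the same coarse tree.\<close>
    have 2: "ptree_basis (pforest_graft S s F) - ptree_basis (pforest_graft (coarse_pforest S) s (coarse_pforest F)) \<in> I"
      if s: "s \<in> verts S - {r}" for s
    proof -
      have "card (verts (forest_graft S s F)) = card (verts (forest_graft S r F))" by simp
      also have "\<dots> = card (verts T)"
        using iso by (auto simp: pforest_isom_def forest_isom_def dest!: bij_betw_same_card)
      finally have c1: "card (verts (forest_graft S s F)) = card (verts T)" .
      have "card (level_one T) = card (level_one (forest_graft S r F))"
        using iso S F rS T' by (intro card_level_one_isom) (auto simp: pforest_isom_def rooted_forest_graft)
      \<comment> \<open>This makes the decrease strict: the graft at \<open>r\<close> that restores
        \<open>T\<close> puts at least one additional vertex at depth one.\<close>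
      moreover have "card (roots F) > 0"
        using ne verts roots_empty_iff[OF F(2)] rooted_forest_finite[OF F(2)]
        by (auto simp: card_gt_0_iff roots_def)
      ultimately have c2: "card (level_one (forest_graft S s F)) < card (level_one T)"
        using s by (simp add: card_level_one_graft[OF F(2) S(2,3)])
      have l1: "level_one (pforest_graft A s B) = level_one (forest_graft A s B)" for A B :: "'d pforest"
        by (simp add: level_one_def)
      have "ptree_basis (pforest_graft S s F) - ptree_basis (coarse_pforest (forest_graft S s F)) \<in> I"
        using IH[OF ptree_on_graft[OF on, of s]] s c1 c2 by (simp add: l1 coarse_pforest_graft)
      moreover have "ptree_basis (pforest_graft (coarse_pforest S) s (coarse_pforest F))
          - ptree_basis (coarse_pforest (forest_graft S s F)) \<in> I"
        using IH[OF ptree_on_graft[OF on', of s]] s c1 c2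
        by (simp add: l1 coarse_pforest_graft)
      ultimately show ?thesis using diff by fastforce
    qed
    \<comment> \<open>Subtracting the congruences at the vertices \<open>s \<noteq> r\<close> from
      the one for the full products isolates the grafts at \<open>r\<close>.\<close>
    have "(\<Sum>s\<in>verts S - {r}. ptree_basis (pforest_graft S s F)) -
        (\<Sum>s\<in>verts S - {r}. ptree_basis (pforest_graft (coarse_pforest S) s (coarse_pforest F))) \<in> I"
      unfolding sum_subtractf[symmetric] using 2 by (rule sum)
    from diff[OF 1 this] have 3: "ptree_basis (pforest_graft S r F)
        - ptree_basis (pforest_graft (coarse_pforest S) r (coarse_pforest F)) \<in> I"
      using on on' rS by (simp add: ptree_prelie_basis ptree_onD del: bilinear_ext_single)
    \<comment> \<open>The coarse version of \<open>S\<close> is a graft of the coarse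
      \<open>G\<close> onto one vertex, because the children of its root form a single
      block.\<close>
    obtain f and G :: "'d forest" where G: "rooted_forest G" "deco G = deco S" "verts G = verts S - {r}"
      and f: "forest_isom f (forest_graft (single_pforest (deco S r)) 0 G) S" "f (inl 0) = r"
      using root_decomposition[OF S(2,3)] by metis
    let ?\<tau> = "single_pforest (deco S r)"
    have d: "deco S r \<in> D" using D rv verts by auto
    have onG: "ptree_on D (coarse_pforest G)"
    proof (rule ptree_on_coarse[OF G(1) order_trans[OF _ D]])
      show "deco G ` verts G \<subseteq> deco T ` verts T"
        unfolding G verts by (rule image_mono) blast
    qed
    have \<tau>: "rooted_forest ?\<tau>" "partitioned_tree ?\<tau>"
      by (rule partitioned_treeD(1)[OF partitioned_tree_single], rule partitioned_tree_single)
    have pf: "pforest_isom f (pforest_graft ?\<tau> 0 (coarse_pforest G)) (coarse_pforest S)"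
      unfolding pforest_graft_coarse[OF G(1)]
      by (rule coarse_pforest_cong[OF f(1) _ S(2)]) (simp add: rooted_forest_graft \<tau> G)
    \<comment> \<open>Grafting the coarse \<open>F\<close> at the root of the coarse
      \<open>S\<close> thus gives the first term of a generator, in which two root blocks hang on
      one vertex.\<close>
    have "abs_ptree (pforest_graft (pforest_graft ?\<tau> 0 (coarse_pforest G)) (inl 0) (coarse_pforest F)) =
        abs_ptree (pforest_graft (coarse_pforest S) r (coarse_pforest F))"
      using pforest_graft_cong[OF pf pforest_isom_id, of "coarse_pforest F" "inl 0"] on' onG f(2) rS \<tau>
      by (intro ptree_eqI) (auto intro!: partitioned_tree_graft dest: ptree_onD)
    then have 4: "ptree_basis (pforest_graft (coarse_pforest S) r (coarse_pforest F))
        - ptree_basis (pforest_graft ?\<tau> 0 (pforest_mult (coarse_pforest G) (coarse_pforest F))) \<in> I"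
      using generator[OF d onG on'(2)] by simp
    have rg: "rooted_forest (forest_graft ?\<tau> 0 G)" "rooted_forest (forest_graft ?\<tau> 0 (forest_union G F))"
      "rooted_forest (forest_graft S r F)"
      using rS by (simp_all add: rooted_forest_graft rooted_forest_union \<tau> G(1) F(2) S(2))
    have rg': "rooted_forest (forest_graft (forest_graft ?\<tau> 0 G) (inl 0) F)"
      by (rule rooted_forest_graft[OF rg(1) F(2)]) simp
    \<comment> \<open>The second term of the generator is already coarse, since products and grafts
      onto a single vertex preserve coarseness. It remains to compare its underlying forest with
      that of \<open>T\<close>.\<close>
    have "pforest_graft ?\<tau> 0 (pforest_mult (coarse_pforest G) (coarse_pforest F)) =
        coarse_pforest (forest_graft ?\<tau> 0 (forest_union G F))"
      by (simp add: pforest_mult_coarse G F pforest_graft_coarse rooted_forest_union)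
    also have "abs_ptree \<dots> = abs_ptree (coarse_pforest (forest_graft (forest_graft ?\<tau> 0 G) (inl 0) F))"
      by (rule abs_coarse_pforest_eqI[symmetric, OF forest_graft_graft_same[OF G(1)] rg' rg(2)])
    also have "\<dots> = abs_ptree (coarse_pforest (forest_graft S r F))"
      using forest_graft_cong[OF f(1) forest_isom_id F(2) F(2), of "inl 0"] f(2)
      by (intro abs_coarse_pforest_eqI[OF _ rg' rg(3)]) simp
    also have "\<dots> = abs_ptree (coarse_pforest T)"
      using iso by (intro abs_coarse_pforest_eqI[where f = "case_nat_sum id id", OF _ rg(3) T'(1)]) (simp add: pforest_isom_def)
    finally have 5: "abs_ptree (pforest_graft ?\<tau> 0 (pforest_mult (coarse_pforest G) (coarse_pforest F))) =
        abs_ptree (coarse_pforest T)" .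
    have "abs_ptree (pforest_graft S r F) = abs_ptree T"
      by (rule ptree_eqI[OF iso partitioned_tree_graft[OF S(1) F(1) rS] T])
    then show ?thesis using trans[OF 3 4] by (simp add: 5)
  qed
qed

end

section \<open>The Com-PreLie algebra of rooted forests\<close>

abbreviation ptree_prelie_ext where
  "ptree_prelie_ext \<equiv> bilinear_ext ptree_prelie"

abbreviation rforest_mult_ext where
  "rforest_mult_ext \<equiv> bilinear_ext (\<lambda>F G. Poly_Mapping.single (rforest_mult F G) 1)"

abbreviation rforest_prelie_ext where
  "rforest_prelie_ext \<equiv> bilinear_ext rforest_prelie"

lemmas free_induct_UNIV = free_induct[OF subset_UNIV, case_names zero single add]

lemma rforest_mult_ext_commute: "rforest_mult_ext x y = rforest_mult_ext y x"
proof (induction x rule: free_induct_UNIV)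
  case (single r a)
  show ?case
    by (induction y rule: free_induct_UNIV) (simp_all add: rforest_mult_commute[of a] mult.commute)
qed simp_all

lemma rforest_mult_ext_assoc:
  "rforest_mult_ext (rforest_mult_ext x y) z = rforest_mult_ext x (rforest_mult_ext y z)"
proof (induction x rule: free_induct_UNIV)
  case (single r a)
  show ?case
  proof (induction y rule: free_induct_UNIV)
    case (single s b)
    show ?case
      by (induction z rule: free_induct_UNIV) (simp_all add: rforest_mult_assoc mult.assoc)
  qed simp_all
qed simp_all

lemma rforest_mult_ext_one: "rforest_mult_ext (Poly_Mapping.single rforest_empty 1) x = x"
  by (induction x rule: free_induct_UNIV) (simp_all add: rforest_mult_empty)

lemma rforest_prelie_ext_leibniz:
  "rforest_prelie_ext (rforest_mult_ext x y) z =
    rforest_mult_ext (rforest_prelie_ext x z) y + rforest_mult_ext x (rforest_prelie_ext y z)"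
proof (induction x rule: free_induct_UNIV)
  case (single r a)
  show ?case
  proof (induction y rule: free_induct_UNIV)
    case (single s b)
    show ?case
    proof (induction z rule: free_induct_UNIV)
      case (single t c)
      have "rforest_prelie (rforest_mult a b) c =
          rforest_mult_ext (rforest_prelie a c) (Poly_Mapping.single b 1) +
          rforest_mult_ext (Poly_Mapping.single a 1) (rforest_prelie b c :: _ \<Rightarrow>\<^sub>0 'b)"
        by (rule trans[OF _ rforest_prelie_leibniz]) simp
      then show ?case by (simp add: mult_ac flip: free_smult_add_right)
    qed (simp_all add: add_ac)
  qed (simp_all add: add_ac)
qed (simp_all add: add_ac)

lemma rforest_prelie_ext_identity:
  "rforest_prelie_ext (rforest_prelie_ext x y) z - rforest_prelie_ext x (rforest_prelie_ext y z) =
    rforest_prelie_ext (rforest_prelie_ext x z) y - rforest_prelie_ext x (rforest_prelie_ext z y)"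
proof -
  \<comment> \<open>The associator is trilinear, so that its symmetry can be checked on basis elements.\<close>
  define T where "T x y z = rforest_prelie_ext (rforest_prelie_ext x y) z
    - rforest_prelie_ext x (rforest_prelie_ext y z)" for x y z :: "'a rforest \<Rightarrow>\<^sub>0 'b"
  have [simp]: "T (x + x') y z = T x y z + T x' y z" "T x (y + y') z = T x y z + T x y' z"
    "T x y (z + z') = T x y z + T x y z'" for x x' y y' z z'
    by (simp_all add: T_def)
  have [simp]: "T (free_smult r x) y z = free_smult r (T x y z)"
    "T x (free_smult r y) z = free_smult r (T x y z)" "T x y (free_smult r z) = free_smult r (T x y z)"
    for r x y z by (simp_all add: T_def)
  have [simp]: "T 0 y z = 0" "T x 0 z = 0" "T x y 0 = 0" for x y z by (simp_all add: T_def)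
  have basis: "T (Poly_Mapping.single a 1) (Poly_Mapping.single b 1) (Poly_Mapping.single c 1) =
    T (Poly_Mapping.single a 1) (Poly_Mapping.single c 1) (Poly_Mapping.single b 1)" for a b c
    unfolding T_def by (simp add: rforest_prelie_identity[of a b c])
  have "T x y z = T x z y"
  proof (induction x rule: free_induct_UNIV)
    case (single r a)
    show ?case
    proof (induction y rule: free_induct_UNIV)
      case (single s b)
      show ?case
        by (induction z rule: free_induct_UNIV) (simp_all add: basis[of a b] ac_simps)
    qed simp_all
  qed simp_all
  then show ?thesis by (simp only: T_def)
qed

section \<open>Algebraic structure of the free vector spaces and of the forest algebra\<close>

lemma field_class_ring: "field (class_ring :: 'k::field ring)"
proof -
  have "cring (class_ring :: 'k ring)"
    by (intro cringI abelian_groupI comm_monoidI) (auto simp: algebra_simps intro: exI[of _ "- _"])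
  then show ?thesis
    by (rule cring.cring_fieldI2) (simp_all, metis right_inverse)
qed

text \<open>Formulated for any record with these operations, so that it serves for trees and forests
  alike.\<close>

lemma abelian_group_free:
  fixes A :: "('a \<Rightarrow>\<^sub>0 'k::comm_ring_1, 'm) ring_scheme"
  assumes [simp]: "carrier A = {x. Poly_Mapping.keys x \<subseteq> X}" "add A = (+)" "zero A = 0"
  shows "abelian_group A"
proof (rule abelian_groupI)
  fix x assume "x \<in> carrier A"
  then show "\<exists>y\<in>carrier A. y \<oplus>\<^bsub>A\<^esub> x = \<zero>\<^bsub>A\<^esub>"
    by (intro bexI[of _ "- x"]) simp_all
qed (use Poly_Mapping.keys_add in \<open>fastforce simp: add_ac\<close>)+

text \<open>Subtraction in the record uses the additive inverse inside its carrier; membership of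
  \<open>y\<close> identifies that inverse with \<open>- y\<close>.\<close>

lemma free_minus:
  fixes A :: "('a \<Rightarrow>\<^sub>0 'k::comm_ring_1, 'm) ring_scheme"
  assumes A: "carrier A = {x. Poly_Mapping.keys x \<subseteq> X}" "add A = (+)" "zero A = 0"
    and y: "Poly_Mapping.keys y \<subseteq> X"
  shows "x \<ominus>\<^bsub>A\<^esub> y = x - y"
proof -
  interpret abelian_group A by (rule abelian_group_free[OF A])
  have "\<ominus>\<^bsub>A\<^esub> y = - y" by (rule minus_equality) (use y in \<open>simp_all add: A\<close>)
  then show ?thesis by (simp add: a_minus_def A)
qed

lemma keys_free_smult_subset:
  "Poly_Mapping.keys x \<subseteq> X \<Longrightarrow> Poly_Mapping.keys (free_smult r x) \<subseteq> X"
  by (rule order_trans[OF keys_free_smult])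

lemma module_free:
  fixes A :: "('k::field, 'a \<Rightarrow>\<^sub>0 'k, 'm) module_scheme"
  assumes A: "carrier A = {x. Poly_Mapping.keys x \<subseteq> X}" "add A = (+)" "zero A = 0" "smult A = free_smult"
  shows "module class_ring A"
  using abelian_group_free[OF A(1-3)] fieldE(1)[OF field_class_ring] keys_free_smult_subset
  by (intro moduleI) (simp_all add: A)

text \<open>The explicit model of the structure that \<open>HCK_com_prelie\<close> obtains through
  the quotient. Being defined without the quotient, it can be used to prove that the quotient is
  Com-PreLie.\<close>

definition grafting_algebra :: "'d set \<Rightarrow> ('k::field_char_0, 'd rforest \<Rightarrow>\<^sub>0 'k) com_prelie" where
  "grafting_algebra D = module.extend (HCK D) (com_prelie.fields rforest_prelie_ext)"

lemma CP_simps [simp]: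
  "carrier (CP D) = {x. Poly_Mapping.keys x \<subseteq> PT D}" "add (CP D) = (+)" "zero (CP D) = 0"
  "mult (CP D) = ptree_mult_ext" "one (CP D) = Poly_Mapping.single ptree_empty 1"
  "smult (CP D) = free_smult" "prelie (CP D) = ptree_prelie_ext"
  by (simp_all add: CP_def)

lemma HCK_simps [simp]:
  "carrier (HCK D) = {x. Poly_Mapping.keys x \<subseteq> RF D}" "add (HCK D) = (+)" "zero (HCK D) = 0"
  "mult (HCK D) = rforest_mult_ext" "one (HCK D) = Poly_Mapping.single rforest_empty 1"
  "smult (HCK D) = free_smult"
  by (simp_all add: HCK_def)

lemma extend_simps [simp]:
  "carrier (module.extend M (com_prelie.fields p)) = carrier M"
  "add (module.extend M (com_prelie.fields p)) = add M"
  "zero (module.extend M (com_prelie.fields p)) = zero M"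
  "mult (module.extend M (com_prelie.fields p)) = mult M"
  "one (module.extend M (com_prelie.fields p)) = one M"
  "smult (module.extend M (com_prelie.fields p)) = smult M"
  "prelie (module.extend M (com_prelie.fields p)) = p"
  by (simp_all add: module.defs com_prelie.defs)

lemma grafting_algebra_simps [simp]:
  "carrier (grafting_algebra D) = {x. Poly_Mapping.keys x \<subseteq> RF D}" "add (grafting_algebra D) = (+)"
  "zero (grafting_algebra D) = 0" "mult (grafting_algebra D) = rforest_mult_ext"
  "one (grafting_algebra D) = Poly_Mapping.single rforest_empty 1"
  "smult (grafting_algebra D) = free_smult" "prelie (grafting_algebra D) = rforest_prelie_ext"
  by (simp_all add: grafting_algebra_def)

lemma forest_onD: "forest_on D F \<Longrightarrow> rooted_forest F"
  by (simp add: forest_on_def)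

lemma rforest_mult_in_RF: "F \<in> RF D \<Longrightarrow> G \<in> RF D \<Longrightarrow> rforest_mult F G \<in> RF D"
  by (elim RF_cases) (simp add: rforest_mult_abs forest_onD abs_in_RF forest_on_union)

lemma keys_rforest_prelie:
  assumes "F \<in> RF D" "G \<in> RF D"
  shows "Poly_Mapping.keys (rforest_prelie F G :: 'd rforest \<Rightarrow>\<^sub>0 'k::comm_ring_1) \<subseteq> RF D"
proof -
  obtain S T where "forest_on D S" "F = abs_rforest S" "forest_on D T" "G = abs_rforest T"
    using assms by (elim RF_cases)
  then show ?thesis
    by (auto simp: rforest_prelie_abs forest_onD abs_in_RF forest_on_graft intro!: keys_sum_subset)
qed

lemma ptree_mult_in_PT: "S \<in> PT D \<Longrightarrow> T \<in> PT D \<Longrightarrow> ptree_mult S T \<in> PT D"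
  by (elim PT_cases) (simp add: ptree_mult_abs ptree_onD abs_in_PT ptree_on_mult)

lemma keys_ptree_prelie: 
  assumes "S \<in> PT D" "T \<in> PT D"
  shows "Poly_Mapping.keys (ptree_prelie S T :: 'd ptree \<Rightarrow>\<^sub>0 'k::comm_ring_1) \<subseteq> PT D"
proof -
  obtain F G where "ptree_on D F" "S = abs_ptree F" "ptree_on D G" "T = abs_ptree G"
    using assms by (elim PT_cases)
  then show ?thesis
    by (auto simp: ptree_prelie_abs ptree_onD abs_in_PT ptree_on_graft intro!: keys_sum_subset)
qed

lemma rforest_empty_in_RF: "rforest_empty \<in> RF D"
  unfolding rforest_empty_def
  by (rule abs_in_RF) (simp add: forest_on_def rooted_forest_empty, simp add: empty_forest_def)

lemma ptree_empty_in_PT: "ptree_empty \<in> PT D"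
  unfolding ptree_empty_def
  by (rule abs_in_PT) (simp add: ptree_on_def partitioned_tree_empty, simp add: empty_pforest_def)

lemma rforest_ext_closed:
  assumes "Poly_Mapping.keys x \<subseteq> RF D" "Poly_Mapping.keys y \<subseteq> RF D"
  shows "Poly_Mapping.keys (rforest_mult_ext x y) \<subseteq> RF D" "Poly_Mapping.keys (rforest_prelie_ext x y) \<subseteq> RF D"
  by (rule keys_bilinear_ext[OF assms]; simp add: rforest_mult_in_RF keys_rforest_prelie)+

lemma ptree_ext_closed:
  assumes "Poly_Mapping.keys x \<subseteq> PT D" "Poly_Mapping.keys y \<subseteq> PT D"
  shows "Poly_Mapping.keys (ptree_mult_ext x y) \<subseteq> PT D" "Poly_Mapping.keys (ptree_prelie_ext x y) \<subseteq> PT D"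
  by (rule keys_bilinear_ext[OF assms]; simp add: ptree_mult_in_PT keys_ptree_prelie)+

lemma unitary_com_prelie_grafting_algebra:
  "unitary_com_prelie class_ring (grafting_algebra D :: ('k::field_char_0, _) com_prelie)"
proof -
  let ?A = "grafting_algebra D :: ('k, _) com_prelie"
  have "comm_monoid ?A"
    by (rule comm_monoidI)
      (simp_all add: rforest_ext_closed rforest_mult_ext_assoc rforest_mult_ext_one rforest_empty_in_RF,
        rule rforest_mult_ext_commute)
  then have "cring ?A"
    by (intro cringI abelian_group_free[of ?A "RF D"]) simp_all
  then have "algebra class_ring ?A"
    unfolding algebra_def algebra_axioms_def using module_free[of ?A "RF D"] by simp
  moreover have m: "x \<ominus>\<^bsub>?A\<^esub> y = x - y" if "Poly_Mapping.keys y \<subseteq> RF D" for x y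
    by (rule free_minus[OF _ _ _ that]) simp_all
  ultimately show ?thesis
    unfolding unitary_com_prelie_def unitary_com_prelie_axioms_def
    by (simp add: field_class_ring m rforest_ext_closed rforest_prelie_ext_leibniz)
      (intro allI impI, rule rforest_prelie_ext_identity)
qed

section \<open>The ideal is the kernel of forgetting the blocks\<close>

abbreviation forget_ext :: "('d ptree \<Rightarrow>\<^sub>0 'k::comm_ring_1) \<Rightarrow> ('d rforest \<Rightarrow>\<^sub>0 'k)" where
  "forget_ext \<equiv> linear_ext (\<lambda>T. Poly_Mapping.single (forget_blocks T) 1)"

abbreviation coarse_ext :: "('d rforest \<Rightarrow>\<^sub>0 'k::comm_ring_1) \<Rightarrow> ('d ptree \<Rightarrow>\<^sub>0 'k)" where
  "coarse_ext \<equiv> linear_ext (\<lambda>F. Poly_Mapping.single (coarse_ptree F) 1)"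

lemma forget_ext_mult: "forget_ext (ptree_mult_ext x y) = rforest_mult_ext (forget_ext x) (forget_ext y)"
  by (rule linear_ext_bilinear_ext[OF subset_UNIV subset_UNIV]) (simp add: forget_mult)

lemma forget_ext_prelie: "forget_ext (ptree_prelie_ext x y) = rforest_prelie_ext (forget_ext x) (forget_ext y)"
  by (rule linear_ext_bilinear_ext[OF subset_UNIV subset_UNIV]) (simp add: forget_prelie)

lemma forget_ext_coarse_ext: "forget_ext (coarse_ext y) = y"
  by (induction y rule: free_induct_UNIV) (simp_all add: forget_coarse)

lemma keys_forget_ext: "Poly_Mapping.keys x \<subseteq> PT D \<Longrightarrow> Poly_Mapping.keys (forget_ext x) \<subseteq> RF D"
  by (erule keys_linear_ext) (simp add: forget_in_RF)

lemma keys_coarse_ext: "Poly_Mapping.keys y \<subseteq> RF D \<Longrightarrow> Poly_Mapping.keys (coarse_ext y) \<subseteq> PT D"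
  by (erule keys_linear_ext) (simp add: coarse_in_PT)

lemma keys_diff_subset:
  fixes x y :: "'a \<Rightarrow>\<^sub>0 'k::comm_ring_1"
  assumes "Poly_Mapping.keys x \<subseteq> X" "Poly_Mapping.keys y \<subseteq> X"
  shows "Poly_Mapping.keys (x - y) \<subseteq> X"
  by (rule order_trans[OF keys_diff]) (use assms in simp)

lemma keys_add_subset:
  assumes "Poly_Mapping.keys x \<subseteq> X" "Poly_Mapping.keys y \<subseteq> X"
  shows "Poly_Mapping.keys (x + y) \<subseteq> X"
  by (rule order_trans[OF Poly_Mapping.keys_add]) (use assms in simp)

lemma CP_minus: "Poly_Mapping.keys y \<subseteq> PT D \<Longrightarrow> x \<ominus>\<^bsub>CP D\<^esub> y = x - y"
  by (rule free_minus[of _ "PT D"]) simp_all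

text \<open>For a single vertex the product \<open>\<tau> \<triangleleft> H\<close> has one term. In
  the associator the grafts of \<open>G\<close> onto vertices of \<open>F\<close> cancel, leaving
  the graft of \<open>G\<close> at the root.\<close>

lemma generator_eq:
  assumes d: "d \<in> D" and F: "ptree_on D F" and G: "ptree_on D G"
  shows "prelie_times (CP D) (Poly_Mapping.single (ptree_single d) 1) (ptree_basis F) (ptree_basis G)
      \<ominus>\<^bsub>CP D\<^esub> Poly_Mapping.single (ptree_single d) 1 \<triangleleft>\<^bsub>CP D\<^esub> (ptree_basis F \<otimes>\<^bsub>CP D\<^esub> ptree_basis G)
    = ptree_basis (pforest_graft (pforest_graft (single_pforest d) 0 F) (inl 0) G)
      - ptree_basis (pforest_graft (single_pforest d) 0 (pforest_mult F G))"
    (is "?lhs = ?rhs")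
proof -
  let ?\<tau> = "single_pforest d"
  note PT = partitioned_tree_single[of d] ptree_onD(1)[OF F] ptree_onD(1)[OF G]
  have \<tau>F: "partitioned_tree (pforest_graft ?\<tau> 0 F)"
    using PT by (simp add: partitioned_tree_graft)
  have single: "ptree_prelie_ext (ptree_basis ?\<tau>) (ptree_basis H) = ptree_basis (pforest_graft ?\<tau> 0 H)"
    if "partitioned_tree H" for H :: "'a pforest"
    using that PT(1) by (simp add: ptree_prelie_abs)
  have iso: "abs_ptree (pforest_graft (pforest_graft ?\<tau> 0 F) (inr t) G) = abs_ptree (pforest_graft ?\<tau> 0 (pforest_graft F t G))"
    if t: "t \<in> verts F" for t
    using t PT \<tau>F
    by (intro ptree_eqI[OF pforest_graft_graft_inr[OF PT(2,3)]] partitioned_tree_graft) auto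
  have "finite (verts F)"
    by (rule rooted_forest_finite[OF partitioned_treeD(1)[OF PT(2)]])
  then have 1: "ptree_prelie_ext (ptree_basis (pforest_graft ?\<tau> 0 F)) (ptree_basis G) =
      ptree_basis (pforest_graft (pforest_graft ?\<tau> 0 F) (inl 0) G)
      + (\<Sum>t\<in>verts F. ptree_basis (pforest_graft (pforest_graft ?\<tau> 0 F) (inr t) G))"
    using ptree_prelie_abs[OF \<tau>F PT(3)] by (simp add: sum.reindex inj_on_def)
  have 2: "ptree_prelie_ext (ptree_basis ?\<tau>) (ptree_prelie_ext (ptree_basis F) (ptree_basis G)) =
      (\<Sum>t\<in>verts F. ptree_basis (pforest_graft (pforest_graft ?\<tau> 0 F) (inr t) G))"
    using PT by (simp add: ptree_prelie_abs[OF PT(2,3)] bilinear_ext_sum_right iso partitioned_tree_graft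
        ptree_prelie_abs[OF PT(1)])
  have keys: "Poly_Mapping.keys (ptree_basis F) \<subseteq> PT D" "Poly_Mapping.keys (ptree_basis G) \<subseteq> PT D"
    "Poly_Mapping.keys (ptree_basis ?\<tau>) \<subseteq> PT D"
    using abs_in_PT[OF F] abs_in_PT[OF G] abs_in_PT[OF ptree_on_single[OF d]] by simp_all
  have "?lhs = ptree_prelie_ext (ptree_prelie_ext (ptree_basis ?\<tau>) (ptree_basis F)) (ptree_basis G)
      - ptree_prelie_ext (ptree_basis ?\<tau>) (ptree_prelie_ext (ptree_basis F) (ptree_basis G))
      - ptree_prelie_ext (ptree_basis ?\<tau>) (ptree_mult_ext (ptree_basis F) (ptree_basis G))"
    unfolding prelie_times_def ptree_single_def CP_simps
    by (simp only: CP_minus ptree_ext_closed keys)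
  also have "\<dots> = ?rhs"
    unfolding ptree_mult_ext_basis[OF PT(2,3)] single[OF PT(2)] single[OF partitioned_tree_mult[OF PT(2,3)]] 1 2
    by simp
  finally show ?thesis .
qed

definition forget_kernel :: "'d set \<Rightarrow> ('d ptree \<Rightarrow>\<^sub>0 'k::field_char_0) set" where
  "forget_kernel D = {x. Poly_Mapping.keys x \<subseteq> PT D \<and> forget_ext x = 0}"

lemma vectorspace_CP: "vectorspace class_ring (CP D :: ('k::field_char_0, _) com_prelie)"
  unfolding vectorspace_def using module_free[of "CP D" "PT D"] field_class_ring by simp

lemma com_prelie_ideal_forget_kernel:
  "com_prelie_ideal class_ring (CP D) (forget_kernel D :: ('d ptree \<Rightarrow>\<^sub>0 'k::field_char_0) set)"
proof -
  have "submodule class_ring (forget_kernel D) (CP D :: ('k, _) com_prelie)"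
    unfolding submodule_def using vectorspace_CP[of D]
    by (auto simp: vectorspace_def forget_kernel_def keys_add_subset keys_free_smult_subset simp del: in_keys_iff)
  then show ?thesis
    using vectorspace_CP[of D]
    by (simp add: com_prelie_ideal_def subspace_def)
       (simp add: forget_kernel_def ptree_ext_closed forget_ext_mult forget_ext_prelie)
qed

lemma generator_in_kernel:
  assumes d: "d \<in> D" and F: "ptree_on D F" and G: "ptree_on D G"
  shows "ptree_basis (pforest_graft (pforest_graft (single_pforest d) 0 F) (inl 0) G)
      - ptree_basis (pforest_graft (single_pforest d) 0 (pforest_mult F G)) \<in> forget_kernel D"
proof -
  let ?A = "pforest_graft (pforest_graft (single_pforest d) 0 F) (inl 0) G"
    and ?B = "pforest_graft (single_pforest d) 0 (pforest_mult F G)"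
  have on: "ptree_on D ?A" "ptree_on D ?B"
    using ptree_on_single[OF d] F G by (auto intro!: ptree_on_graft ptree_on_mult)
  have "abs_rforest (forest.truncate ?A) = abs_rforest (forest.truncate ?B)"
    using on[THEN ptree_onD(2)]
    by (intro rforest_eqI) (simp_all, rule forest_graft_graft_same, rule ptree_onD[OF F])
  then show ?thesis
    using on by (simp add: forget_kernel_def keys_diff_subset abs_in_PT forget_blocks_abs ptree_onD
        del: truncate_pforest)
qed

text \<open>By linearity, reduction to coarse trees gives that
  \<open>x - coarse_ext (forget_ext x)\<close> lies in \<open>I\<close> for every \<open>x\<close>;
  on the kernel the subtracted term vanishes.\<close>

lemma forget_kernel_subset:
  assumes I: "com_prelie_ideal class_ring (CP D) I"
    and gen: "\<And>d F G. d \<in> D \<Longrightarrow> ptree_on D F \<Longrightarrow> ptree_on D G \<Longrightarrow>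
      ptree_basis (pforest_graft (pforest_graft (single_pforest d) 0 F) (inl 0) G)
      - ptree_basis (pforest_graft (single_pforest d) 0 (pforest_mult F G)) \<in> I"
  shows "forget_kernel D \<subseteq> (I :: ('d ptree \<Rightarrow>\<^sub>0 'k::field_char_0) set)"
proof
  have sub: "submodule class_ring I (CP D)" using I by (simp add: com_prelie_ideal_def subspace_def)
  interpret generator_ideal D I
  proof
    show "0 \<in> I" using submodule.zero_closed[OF sub] by simp
    show "x + y \<in> I" if "x \<in> I" "y \<in> I" for x y using submodule.m_closed[OF sub that] by simp
    show "free_smult r x \<in> I" if "x \<in> I" for r x using submodule.smult_closed[OF sub _ that] by simp
  qed (use I gen in \<open>simp_all add: com_prelie_ideal_def\<close>)
  fix x :: "'d ptree \<Rightarrow>\<^sub>0 'k" assume x: "x \<in> forget_kernel D"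
  then have "Poly_Mapping.keys x \<subseteq> PT D" by (simp add: forget_kernel_def)
  then have "x - coarse_ext (forget_ext x) \<in> I"
  proof (induction x rule: free_induct)
    case (single r a)
    then obtain T where T: "ptree_on D T" "a = abs_ptree T" by (elim PT_cases)
    have "coarse_ptree (abs_rforest (forest.truncate T)) = abs_ptree (coarse_pforest T)"
      by (subst coarse_ptree_abs) (simp_all add: ptree_onD[OF T(1)])
    then have "Poly_Mapping.single a 1 - coarse_ext (forget_ext (Poly_Mapping.single a 1)) \<in> I"
      using coarse_equiv[OF T(1)] T by (simp add: forget_blocks_abs ptree_onD)
    from smult[OF this, of r] show ?case by simp
  next
    case (add y z)
    from generator_ideal_axioms this have "(y - coarse_ext (forget_ext y)) + (z - coarse_ext (forget_ext z)) \<in> I"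
      by (simp add: generator_ideal_def)
    then show ?case by (simp add: algebra_simps)
  qed (simp add: zero)
  then show "x \<in> I" using x by (simp add: forget_kernel_def)
qed

text \<open>The generated ideal is an intersection. The kernel is one of the intersected ideals and
  is contained in each of them.\<close>

theorem CK_ideal_eq_forget_kernel: "CK_ideal D = (forget_kernel D :: ('d ptree \<Rightarrow>\<^sub>0 'k::field_char_0) set)"
proof
  let ?G = "{prelie_times (CP D) (Poly_Mapping.single (ptree_single d) 1)
        (Poly_Mapping.single F1 1) (Poly_Mapping.single F2 1)
      \<ominus>\<^bsub>CP D\<^esub> Poly_Mapping.single (ptree_single d) 1 \<triangleleft>\<^bsub>CP D\<^esub>
        (Poly_Mapping.single F1 1 \<otimes>\<^bsub>CP D\<^esub> Poly_Mapping.single F2 1)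
     | d F1 F2. d \<in> D \<and> F1 \<in> PT D \<and> F2 \<in> PT D} :: ('d ptree \<Rightarrow>\<^sub>0 'k) set"
  have "?G \<subseteq> forget_kernel D"
  proof
    fix g assume "g \<in> ?G"
    then obtain d F1 F2 where g: "g = prelie_times (CP D) (Poly_Mapping.single (ptree_single d) 1)
        (Poly_Mapping.single F1 1) (Poly_Mapping.single F2 1)
      \<ominus>\<^bsub>CP D\<^esub> Poly_Mapping.single (ptree_single d) 1 \<triangleleft>\<^bsub>CP D\<^esub>
        (Poly_Mapping.single F1 1 \<otimes>\<^bsub>CP D\<^esub> Poly_Mapping.single F2 1)" "d \<in> D" "F1 \<in> PT D" "F2 \<in> PT D"
      by blast
    obtain F G where "ptree_on D F" "F1 = abs_ptree F" "ptree_on D G" "F2 = abs_ptree G"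
      using g by (elim PT_cases)
    then show "g \<in> forget_kernel D"
      using g generator_eq[of d D F G] generator_in_kernel[of d D F G] by metis
  qed
  then show "CK_ideal D \<subseteq> (forget_kernel D :: ('d ptree \<Rightarrow>\<^sub>0 'k) set)"
    unfolding CK_ideal_def com_prelie_ideal_generated_def
    using com_prelie_ideal_forget_kernel by blast
  have "forget_kernel D \<subseteq> I" if I: "com_prelie_ideal class_ring (CP D) I" and G: "?G \<subseteq> I" for I
  proof (rule forget_kernel_subset[OF I])
    fix d F G assume d: "d \<in> D" and F: "ptree_on D F" "ptree_on D G"
    have "prelie_times (CP D) (Poly_Mapping.single (ptree_single d) 1) (ptree_basis F) (ptree_basis G)
      \<ominus>\<^bsub>CP D\<^esub> Poly_Mapping.single (ptree_single d) 1 \<triangleleft>\<^bsub>CP D\<^esub> (ptree_basis F \<otimes>\<^bsub>CP D\<^esub> ptree_basis G) \<in> ?G"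
      using d F[THEN abs_in_PT] by blast
    with G show "ptree_basis (pforest_graft (pforest_graft (single_pforest d) 0 F) (inl 0) G)
      - ptree_basis (pforest_graft (single_pforest d) 0 (pforest_mult F G)) \<in> I"
      unfolding generator_eq[OF d F] by (rule subsetD)
  qed
  then show "forget_kernel D \<subseteq> (CK_ideal D :: ('d ptree \<Rightarrow>\<^sub>0 'k) set)"
    unfolding CK_ideal_def com_prelie_ideal_generated_def by (intro Inter_greatest) simp
qed

section \<open>The quotient\<close>

text \<open>The identities can be pulled back along a bijection that respects the operations. The
  target starts as a mere record of operations, so its ring and module structure is derived here as
  well.\<close>

lemma unitary_com_prelie_transport:
  fixes A :: "('k, 'a, 'n) com_prelie_scheme" and B :: "('k, 'b, 'l) com_prelie_scheme"
  assumes A: "unitary_com_prelie K A" and bij: "bij_betw h (carrier A) (carrier B)"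
    and zero: "h \<zero>\<^bsub>A\<^esub> = \<zero>\<^bsub>B\<^esub>" and one: "h \<one>\<^bsub>A\<^esub> = \<one>\<^bsub>B\<^esub>"
    and add: "\<And>x y. x \<in> carrier A \<Longrightarrow> y \<in> carrier A \<Longrightarrow> h (x \<oplus>\<^bsub>A\<^esub> y) = h x \<oplus>\<^bsub>B\<^esub> h y"
    and mult: "\<And>x y. x \<in> carrier A \<Longrightarrow> y \<in> carrier A \<Longrightarrow> h (x \<otimes>\<^bsub>A\<^esub> y) = h x \<otimes>\<^bsub>B\<^esub> h y"
    and smult: "\<And>r x. r \<in> carrier K \<Longrightarrow> x \<in> carrier A \<Longrightarrow> h (r \<odot>\<^bsub>A\<^esub> x) = r \<odot>\<^bsub>B\<^esub> h x"
    and prelie: "\<And>x y. x \<in> carrier A \<Longrightarrow> y \<in> carrier A \<Longrightarrow> h (x \<triangleleft>\<^bsub>A\<^esub> y) = h x \<triangleleft>\<^bsub>B\<^esub> h y"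
  shows "unitary_com_prelie K B"
proof -
  interpret A: unitary_com_prelie K A by (rule A)
  have iso: "h \<in> ring_iso A B"
    unfolding ring_iso_def Ring.ring_hom_def using bij_betwE[OF bij] one add mult bij by auto
  \<comment> \<open>The image ring supplied by \<open>ring_iso_imp_img_cring\<close> has its zero
    overwritten by the image of zero; the assumption \<open>zero\<close> makes it equal to
    \<open>B\<close>.\<close>
  have "cring B"
    using A.ring_iso_imp_img_cring[OF iso] by (simp add: zero)
  interpret B: cring B by fact
  have closed [simp]: "h x \<in> carrier B" if "x \<in> carrier A" for x using bij_betwE[OF bij] that by blast
  have surj: "\<exists>x\<in>carrier A. y = h x" if "y \<in> carrier B" for y
    using that unfolding bij_betw_imp_surj_on[OF bij, symmetric] by blast
  have "h (\<ominus>\<^bsub>A\<^esub> y) = \<ominus>\<^bsub>B\<^esub> h y" if "y \<in> carrier A" for y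
    using that by (intro B.minus_equality[symmetric]) (simp_all add: add[symmetric] zero A.l_neg)
  then have minus: "h (x \<ominus>\<^bsub>A\<^esub> y) = h x \<ominus>\<^bsub>B\<^esub> h y" if "x \<in> carrier A" "y \<in> carrier A" for x y
    using that by (simp add: a_minus_def add)
  \<comment> \<open>Reading the morphism equations backwards gathers a term built from images into
    the image of one term of \<open>A\<close>, where the axiom holds.\<close>
  note tr = add [symmetric] mult [symmetric] smult [symmetric] prelie [symmetric] minus [symmetric]
    one [symmetric]
  have "module K B"
  proof (rule moduleI)
    show "cring K" by (rule A.R.cring_axioms)
    show "abelian_group B" by (rule B.abelian_group_axioms)
  next
    fix a x assume a: "a \<in> carrier K" and "x \<in> carrier B"
    then obtain x' where x': "x = h x'" "x' \<in> carrier A" using surj by blast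
    then show "a \<odot>\<^bsub>B\<^esub> x \<in> carrier B" using a by (simp add: tr)
    fix b assume b: "b \<in> carrier K"
    show "(a \<oplus>\<^bsub>K\<^esub> b) \<odot>\<^bsub>B\<^esub> x = a \<odot>\<^bsub>B\<^esub> x \<oplus>\<^bsub>B\<^esub> b \<odot>\<^bsub>B\<^esub> x"
      "(a \<otimes>\<^bsub>K\<^esub> b) \<odot>\<^bsub>B\<^esub> x = a \<odot>\<^bsub>B\<^esub> (b \<odot>\<^bsub>B\<^esub> x)"
      using a b x' by (simp_all add: tr A.smult_l_distr A.smult_assoc1)
  next
    fix a x y assume a: "a \<in> carrier K" and "x \<in> carrier B" "y \<in> carrier B"
    then obtain x' y' where "x = h x'" "x' \<in> carrier A" "y = h y'" "y' \<in> carrier A" using surj by blast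
    then show "a \<odot>\<^bsub>B\<^esub> (x \<oplus>\<^bsub>B\<^esub> y) = a \<odot>\<^bsub>B\<^esub> x \<oplus>\<^bsub>B\<^esub> a \<odot>\<^bsub>B\<^esub> y"
      using a by (simp add: tr A.smult_r_distr)
  next
    fix x assume "x \<in> carrier B"
    then obtain x' where "x = h x'" "x' \<in> carrier A" using surj by blast
    then show "\<one>\<^bsub>K\<^esub> \<odot>\<^bsub>B\<^esub> x = x" by (simp add: tr)
  qed
  moreover have "\<forall>a x y. a \<in> carrier K \<longrightarrow> x \<in> carrier B \<longrightarrow> y \<in> carrier B \<longrightarrow>
      (a \<odot>\<^bsub>B\<^esub> x) \<otimes>\<^bsub>B\<^esub> y = a \<odot>\<^bsub>B\<^esub> (x \<otimes>\<^bsub>B\<^esub> y)"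
    by (intro allI impI, (drule surj)+, clarify) (simp add: tr A.smult_assoc2)
  ultimately have "algebra K B"
    unfolding algebra_def algebra_axioms_def using B.cring_axioms by simp
  moreover have "unitary_com_prelie_axioms K B"
  proof
    fix a b c assume abc: "a \<in> carrier B" "b \<in> carrier B" "c \<in> carrier B"
    show "(a \<triangleleft>\<^bsub>B\<^esub> b) \<triangleleft>\<^bsub>B\<^esub> c \<ominus>\<^bsub>B\<^esub> a \<triangleleft>\<^bsub>B\<^esub> (b \<triangleleft>\<^bsub>B\<^esub> c) = (a \<triangleleft>\<^bsub>B\<^esub> c) \<triangleleft>\<^bsub>B\<^esub> b \<ominus>\<^bsub>B\<^esub> a \<triangleleft>\<^bsub>B\<^esub> (c \<triangleleft>\<^bsub>B\<^esub> b)"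
      using abc[THEN surj]
      by clarify (simp add: tr A.prelie_closed, rule arg_cong[of _ _ h], rule A.prelie_identity)
  qed ((drule surj)+, clarify, simp add: tr A.prelie_closed A.prelie_add_left A.prelie_add_right
        A.prelie_smult_left A.prelie_smult_right A.prelie_leibniz)+
  ultimately show ?thesis
    unfolding unitary_com_prelie_def using A.field_axioms by simp
qed

text \<open>Cosets of a kernel are fibres of the map. Indexing them by their common image lets the
  quotient be computed with forests.\<close>

definition forget_fibre :: "'d set \<Rightarrow> ('d rforest \<Rightarrow>\<^sub>0 'k) \<Rightarrow> ('d ptree \<Rightarrow>\<^sub>0 'k::field_char_0) set" where
  "forget_fibre D y = {x. Poly_Mapping.keys x \<subseteq> PT D \<and> forget_ext x = y}"

lemma coset_eq_fibre:
  assumes x: "Poly_Mapping.keys x \<subseteq> PT D"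
  shows "CK_ideal D +>\<^bsub>CP D\<^esub> x = forget_fibre D (forget_ext x)"
proof
  show "CK_ideal D +>\<^bsub>CP D\<^esub> x \<subseteq> forget_fibre D (forget_ext x)"
  proof
    fix z assume "z \<in> CK_ideal D +>\<^bsub>CP D\<^esub> x"
    then obtain k where "k \<in> forget_kernel D" "z = k + x"
      by (auto simp: a_r_coset_def' CK_ideal_eq_forget_kernel)
    then show "z \<in> forget_fibre D (forget_ext x)"
      using x by (simp add: forget_kernel_def forget_fibre_def keys_add_subset)
  qed
  show "forget_fibre D (forget_ext x) \<subseteq> CK_ideal D +>\<^bsub>CP D\<^esub> x"
  proof
    fix z assume "z \<in> forget_fibre D (forget_ext x)"
    then have "z - x \<in> CK_ideal D"
      using x by (simp add: CK_ideal_eq_forget_kernel forget_kernel_def forget_fibre_def keys_diff_subset)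
    then show "z \<in> CK_ideal D +>\<^bsub>CP D\<^esub> x"
      unfolding a_r_coset_def' by (auto intro!: bexI[of _ "z - x"])
  qed
qed

lemma coarse_ext_in_fibre: "Poly_Mapping.keys y \<subseteq> RF D \<Longrightarrow> coarse_ext y \<in> forget_fibre D y"
  by (simp add: forget_fibre_def keys_coarse_ext forget_ext_coarse_ext)

text \<open>The coarse lift shows that the fibre is nonempty, and the image of any of its elements
  recovers the index.\<close>

lemma fibre_inj:
  "Poly_Mapping.keys x \<subseteq> RF D \<Longrightarrow> forget_fibre D x = forget_fibre D y \<Longrightarrow> x = y"
  using coarse_ext_in_fibre[of x D] by (auto simp: forget_fibre_def)

lemma carrier_CK_quotient: "carrier (CK_quotient D) = forget_fibre D ` {y. Poly_Mapping.keys y \<subseteq> RF D}"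
proof -
  have "carrier (CK_quotient D) = (\<lambda>x. CK_ideal D +>\<^bsub>CP D\<^esub> x) ` {x. Poly_Mapping.keys x \<subseteq> PT D}"
    by (auto simp: CK_quotient_def com_prelie_quotient_def FactRing_def A_RCOSETS_def' )
  also have "\<dots> = (\<lambda>x. forget_fibre D (forget_ext x)) ` {x. Poly_Mapping.keys x \<subseteq> PT D}"
    by (rule image_cong) (simp_all add: coset_eq_fibre)
  also have "\<dots> = forget_fibre D ` forget_ext ` {x. Poly_Mapping.keys x \<subseteq> PT D}"
    by (simp add: image_image)
  also have "forget_ext ` {x. Poly_Mapping.keys x \<subseteq> PT D} = {y. Poly_Mapping.keys y \<subseteq> RF D}"
  proof
    show "forget_ext ` {x. Poly_Mapping.keys x \<subseteq> PT D} \<subseteq> {y. Poly_Mapping.keys y \<subseteq> RF D}"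
      using keys_forget_ext by blast
    show "{y. Poly_Mapping.keys y \<subseteq> RF D} \<subseteq> forget_ext ` {x. Poly_Mapping.keys x \<subseteq> PT D}"
      using keys_coarse_ext forget_ext_coarse_ext by (metis (mono_tags, lifting) image_eqI mem_Collect_eq subsetI)
  qed
  finally show ?thesis .
qed

text \<open>Operations on cosets are unions over all representatives. Independence of the
  representative makes the family constant, and nonemptiness makes the union equal to its
  value.\<close>

lemma UN_fibre:
  assumes "A \<noteq> {}" "\<And>x. x \<in> A \<Longrightarrow> f x = c"
  shows "(\<Union>x\<in>A. f x) = c"
  using assms by auto

lemma CK_quotient_ops:
  assumes x: "Poly_Mapping.keys x \<subseteq> RF D" and y: "Poly_Mapping.keys y \<subseteq> RF D"
  shows "forget_fibre D x \<otimes>\<^bsub>CK_quotient D\<^esub> forget_fibre D y = forget_fibre D (rforest_mult_ext x y)"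
    "forget_fibre D x \<triangleleft>\<^bsub>CK_quotient D\<^esub> forget_fibre D y = forget_fibre D (rforest_prelie_ext x y)"
    "forget_fibre D x \<oplus>\<^bsub>CK_quotient D\<^esub> forget_fibre D y = forget_fibre D (x + y)"
    "r \<odot>\<^bsub>CK_quotient D\<^esub> forget_fibre D x = forget_fibre D (free_smult r x)"
proof -
  note ne = coarse_ext_in_fibre[OF x] coarse_ext_in_fibre[OF y]
  have ne': "forget_fibre D x \<noteq> {}" "forget_fibre D y \<noteq> {}" using ne by blast+
  have "(\<Union>a\<in>forget_fibre D x. \<Union>b\<in>forget_fibre D y. CK_ideal D +>\<^bsub>CP D\<^esub> (ptree_mult_ext a b)) =
      forget_fibre D (rforest_mult_ext x y)"
    by (intro UN_fibre ne') (auto simp: forget_fibre_def[of D x] forget_fibre_def[of D y] coset_eq_fibre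
        ptree_ext_closed forget_ext_mult)
  then show "forget_fibre D x \<otimes>\<^bsub>CK_quotient D\<^esub> forget_fibre D y = forget_fibre D (rforest_mult_ext x y)"
    by (simp add: CK_quotient_def com_prelie_quotient_def FactRing_def rcoset_mult_def)
  have "(\<Union>a\<in>forget_fibre D x. \<Union>b\<in>forget_fibre D y. CK_ideal D +>\<^bsub>CP D\<^esub> (ptree_prelie_ext a b)) =
      forget_fibre D (rforest_prelie_ext x y)"
    by (intro UN_fibre ne') (auto simp: forget_fibre_def[of D x] forget_fibre_def[of D y] coset_eq_fibre
        ptree_ext_closed forget_ext_prelie)
  then show "forget_fibre D x \<triangleleft>\<^bsub>CK_quotient D\<^esub> forget_fibre D y = forget_fibre D (rforest_prelie_ext x y)"
    by (simp add: CK_quotient_def com_prelie_quotient_def)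
  have "(\<Union>a\<in>forget_fibre D x. CK_ideal D +>\<^bsub>CP D\<^esub> (free_smult r a)) = forget_fibre D (free_smult r x)"
    by (intro UN_fibre ne') (auto simp: forget_fibre_def[of D x] coset_eq_fibre keys_free_smult_subset)
  then show "r \<odot>\<^bsub>CK_quotient D\<^esub> forget_fibre D x = forget_fibre D (free_smult r x)"
    by (simp add: CK_quotient_def com_prelie_quotient_def)
  \<comment> \<open>Addition in the quotient is elementwise addition of sets, not a union of cosets.
    Each element \<open>z\<close> of the target fibre is therefore split with
    \<open>coarse_ext y\<close> as second summand.\<close>
  have "(\<Union>a\<in>forget_fibre D x. \<Union>b\<in>forget_fibre D y. {a + b}) = forget_fibre D (x + y)"
  proof
    show "(\<Union>a\<in>forget_fibre D x. \<Union>b\<in>forget_fibre D y. {a + b}) \<subseteq> forget_fibre D (x + y)"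
      by (simp add: UN_subset_iff forget_fibre_def keys_add_subset)
    show "forget_fibre D (x + y) \<subseteq> (\<Union>a\<in>forget_fibre D x. \<Union>b\<in>forget_fibre D y. {a + b})"
    proof
      fix z assume "z \<in> forget_fibre D (x + y)"
      then have "z - coarse_ext y \<in> forget_fibre D x"
        using ne(2) by (simp add: forget_fibre_def keys_diff_subset)
      then show "z \<in> (\<Union>a\<in>forget_fibre D x. \<Union>b\<in>forget_fibre D y. {a + b})"
        using ne(2) by (intro UN_I[of "z - coarse_ext y"] UN_I[of "coarse_ext y"]) simp_all
    qed
  qed
  then show "forget_fibre D x \<oplus>\<^bsub>CK_quotient D\<^esub> forget_fibre D y = forget_fibre D (x + y)"
    by (simp add: CK_quotient_def com_prelie_quotient_def FactRing_def set_add_def')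
qed

lemma CK_quotient_smult:
  "Poly_Mapping.keys x \<subseteq> RF D \<Longrightarrow> r \<odot>\<^bsub>CK_quotient D\<^esub> forget_fibre D x = forget_fibre D (free_smult r x)"
  by (rule CK_quotient_ops(4))

lemma CK_quotient_zero_one:
  "\<zero>\<^bsub>CK_quotient D\<^esub> = forget_fibre D 0"
  "\<one>\<^bsub>CK_quotient D\<^esub> = forget_fibre D (Poly_Mapping.single rforest_empty 1)"
proof -
  show "\<zero>\<^bsub>CK_quotient D\<^esub> = forget_fibre D 0"
    by (simp add: CK_quotient_def com_prelie_quotient_def FactRing_def CK_ideal_eq_forget_kernel
        forget_kernel_def forget_fibre_def)
  show "\<one>\<^bsub>CK_quotient D\<^esub> = forget_fibre D (Poly_Mapping.single rforest_empty 1)"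
    by (simp add: CK_quotient_def com_prelie_quotient_def FactRing_def coset_eq_fibre ptree_empty_in_PT
        forget_empty)
qed

lemma bij_betw_fibre:
  "bij_betw (forget_fibre D) {y. Poly_Mapping.keys y \<subseteq> RF D} (carrier (CK_quotient D))"
  by (simp add: bij_betw_def inj_on_def carrier_CK_quotient) (blast intro: fibre_inj)

lemma unitary_com_prelie_CK_quotient:
  "unitary_com_prelie class_ring (CK_quotient D :: ('k::field_char_0, _) com_prelie)"
  by (rule unitary_com_prelie_transport[OF unitary_com_prelie_grafting_algebra[of D], where h = "forget_fibre D"])
     (simp_all add: bij_betw_fibre CK_quotient_zero_one CK_quotient_ops CK_quotient_smult)

lemma ptree_coset_eq: "T \<in> PT D \<Longrightarrow> ptree_coset D T = forget_fibre D (Poly_Mapping.single (forget_blocks T) 1)"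
  by (simp add: ptree_coset_def coset_eq_fibre)

text \<open>The description is satisfied by the coarse tree over \<open>F\<close>, and uniquely so,
  because the coset of a tree depends only on its underlying forest.\<close>

lemma rforest_coset_eq:
  assumes F: "F \<in> RF D"
  shows "rforest_coset D F = (forget_fibre D (Poly_Mapping.single F 1) :: ('d ptree \<Rightarrow>\<^sub>0 'k::field_char_0) set)"
  unfolding rforest_coset_def
proof (rule the_equality)
  show "\<exists>T\<in>PT D. forget_blocks T = F \<and> forget_fibre D (Poly_Mapping.single F 1) = (ptree_coset D T :: ('d ptree \<Rightarrow>\<^sub>0 'k) set)"
    by (intro bexI[of _ "coarse_ptree F"]) (simp_all add: ptree_coset_eq forget_coarse coarse_in_PT F)
qed (auto simp: ptree_coset_eq)

lemma finsum_fibre: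
  assumes "finite A" "\<And>a. a \<in> A \<Longrightarrow> Poly_Mapping.keys (g a) \<subseteq> RF D"
  shows "finsum (CK_quotient D) (\<lambda>a. forget_fibre D (g a)) A =
    (forget_fibre D (\<Sum>a\<in>A. g a) :: ('d ptree \<Rightarrow>\<^sub>0 'k::field_char_0) set)"
  using assms
proof (induction A rule: finite_induct)
  interpret Q: unitary_com_prelie class_ring "CK_quotient D :: ('k, _) com_prelie"
    by (rule unitary_com_prelie_CK_quotient)
  {
    case empty
    show ?case by (simp add: CK_quotient_zero_one)
  next
    case (insert a A)
    have "forget_fibre D (g b) \<in> carrier (CK_quotient D)" if "b \<in> insert a A" for b
      using insert.prems[OF that] by (simp add: carrier_CK_quotient)
    then have "finsum (CK_quotient D) (\<lambda>a. forget_fibre D (g a)) (insert a A) =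
        forget_fibre D (g a) \<oplus>\<^bsub>CK_quotient D\<^esub> forget_fibre D (\<Sum>a\<in>A. g a)"
      using insert by (subst Q.finsum_insert) auto
    also have "\<dots> = forget_fibre D (\<Sum>a\<in>insert a A. g a)"
      using insert by (subst CK_quotient_ops) (auto intro!: keys_sum_subset)
    finally show ?case .
  }
qed

text \<open>Linear combinations in the quotient become fibres over linear combinations of forests.
  This serves both the identification map and the basis property.\<close>

lemma finsum_rforest_coset:
  assumes "finite A" "A \<subseteq> RF D"
  shows "finsum (CK_quotient D) (\<lambda>F. c F \<odot>\<^bsub>CK_quotient D\<^esub> rforest_coset D F) A =
    (forget_fibre D (\<Sum>F\<in>A. free_smult (c F) (Poly_Mapping.single F 1)) :: ('d ptree \<Rightarrow>\<^sub>0 'k::field_char_0) set)"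
proof -
  interpret Q: unitary_com_prelie class_ring "CK_quotient D :: ('k, _) com_prelie"
    by (rule unitary_com_prelie_CK_quotient)
  have k: "Poly_Mapping.keys (free_smult (c F) (Poly_Mapping.single F (1::'k))) \<subseteq> RF D" if "F \<in> A" for F
    using assms that by (intro keys_free_smult_subset) auto
  have "finsum (CK_quotient D) (\<lambda>F. c F \<odot>\<^bsub>CK_quotient D\<^esub> rforest_coset D F) A =
      finsum (CK_quotient D) (\<lambda>F. forget_fibre D (free_smult (c F) (Poly_Mapping.single F 1))) A"
    using assms k
    by (intro Q.finsum_cong') (auto simp: rforest_coset_eq subsetD CK_quotient_smult carrier_CK_quotient)
  also have "\<dots> = forget_fibre D (\<Sum>F\<in>A. free_smult (c F) (Poly_Mapping.single F 1))"
    by (rule finsum_fibre[OF assms(1) k])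
  finally show ?thesis .
qed

lemma HCK_ident_eq:
  assumes x: "Poly_Mapping.keys x \<subseteq> RF D"
  shows "HCK_ident D x = forget_fibre D x"
  unfolding HCK_ident_def finsum_rforest_coset[OF finite_keys x] by (simp add: sum_free_smult_single)

section \<open>The basis of forests and the structure transported to the Connes-Kreimer
  algebra\<close>

lemma inj_on_rforest_coset:
  fixes D :: "'d set"
  shows "inj_on (rforest_coset D :: _ \<Rightarrow> ('d ptree \<Rightarrow>\<^sub>0 'k::field_char_0) set) (RF D)"
proof (rule inj_onI)
  fix F G assume FG: "F \<in> RF D" "G \<in> RF D"
    and "rforest_coset D F = (rforest_coset D G :: ('d ptree \<Rightarrow>\<^sub>0 'k) set)"
  then have "Poly_Mapping.single F (1::'k) = Poly_Mapping.single G 1"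
    by (intro fibre_inj[of _ D]) (simp_all add: rforest_coset_eq)
  then have "Poly_Mapping.keys (Poly_Mapping.single F (1::'k)) = Poly_Mapping.keys (Poly_Mapping.single G (1::'k))"
    by simp
  then show "F = G" by simp
qed

lemma basis_CK_quotient:
  fixes D :: "'d set"
  shows "vectorspace.basis class_ring (CK_quotient D :: ('k::field_char_0, _) com_prelie) (rforest_coset D ` RF D)"
proof -
  let ?Q = "CK_quotient D :: ('k, _) com_prelie" and ?f = "rforest_coset D :: _ \<Rightarrow> ('d ptree \<Rightarrow>\<^sub>0 'k) set"
  interpret Q: unitary_com_prelie class_ring ?Q
    by (rule unitary_com_prelie_CK_quotient)
  interpret V: vectorspace class_ring ?Q
    unfolding vectorspace_def using Q.module_axioms field_class_ring by blast
  have carrier: "?f ` RF D \<subseteq> carrier ?Q"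
    by (auto simp: rforest_coset_eq carrier_CK_quotient)
  \<comment> \<open>Library combinations are indexed by vectors; injectivity of \<open>?f\<close>
    reindexes them by forests.\<close>
  have lincomb: "Q.lincomb a (?f ` C) = forget_fibre D (\<Sum>F\<in>C. free_smult (a (?f F)) (Poly_Mapping.single F 1))"
    if "finite C" "C \<subseteq> RF D" for a C
  proof -
    have "Q.lincomb a (?f ` C) = finsum ?Q (\<lambda>F. a (?f F) \<odot>\<^bsub>?Q\<^esub> ?f F) C"
      unfolding Q.lincomb_def
      using that carrier inj_on_subset[OF inj_on_rforest_coset that(2)]
      by (subst Q.finsum_reindex) (auto intro!: Q.smult_closed)
    then show ?thesis by (simp add: finsum_rforest_coset[OF that])
  qed
  have "Q.lin_indpt (?f ` RF D)"
  proof
    assume "Q.lin_dep (?f ` RF D)"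
    then obtain A a v where A: "finite A" "A \<subseteq> ?f ` RF D" "Q.lincomb a A = \<zero>\<^bsub>?Q\<^esub>" "v \<in> A" "a v \<noteq> 0"
      unfolding Q.lin_dep_def by auto
    then obtain C where C: "finite C" "C \<subseteq> RF D" "A = ?f ` C"
      using finite_subset_image by metis
    obtain G where G: "G \<in> C" "v = ?f G" using A(4) C(3) by blast
    have "forget_fibre D 0 = forget_fibre D (\<Sum>F\<in>C. free_smult (a (?f F)) (Poly_Mapping.single F 1))"
      using A(3) lincomb[OF C(1,2)] C(3) by (simp add: CK_quotient_zero_one)
    \<comment> \<open>Injectivity of the fibres lifts the relation to the free space, where the
      coefficient at \<open>G\<close> can be read off.\<close>
    then have "0 = (\<Sum>F\<in>C. free_smult (a (?f F)) (Poly_Mapping.single F (1::'k)))"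
      by (intro fibre_inj) simp_all
    then have "0 = Poly_Mapping.lookup (\<Sum>F\<in>C. free_smult (a (?f F)) (Poly_Mapping.single F (1::'k))) G"
      by (metis lookup_zero)
    also have "\<dots> = (\<Sum>F\<in>C. if F = G then a (?f G) else 0)"
      by (auto simp: lookup_sum lookup_single when_def intro: sum.cong)
    also have "\<dots> = a v" using C(1) G by simp
    finally show False using A(5) by simp
  qed
  moreover have "Q.span (?f ` RF D) = carrier ?Q"
  proof
    show "Q.span (?f ` RF D) \<subseteq> carrier ?Q"
    proof
      fix y assume "y \<in> Q.span (?f ` RF D)"
      then obtain a A where y: "y = Q.lincomb a A" "A \<subseteq> ?f ` RF D" "a \<in> A \<rightarrow> carrier class_ring"
        unfolding Q.span_def by blast
      show "y \<in> carrier ?Q"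
        unfolding y(1) by (rule Q.lincomb_closed[OF order_trans[OF y(2) carrier] y(3)])
    qed
    show "carrier ?Q \<subseteq> Q.span (?f ` RF D)"
    proof
      fix y assume "y \<in> carrier ?Q"
      then obtain x where x: "Poly_Mapping.keys x \<subseteq> RF D" "y = forget_fibre D x"
        by (auto simp: carrier_CK_quotient)
      \<comment> \<open>Coefficients are attached to forests, whereas the span wants them attached
        to vectors; the inverse of \<open>?f\<close> converts.\<close>
      define a where "a = (\<lambda>v. Poly_Mapping.lookup x (inv_into (RF D) ?f v))"
      have "a (?f F) = Poly_Mapping.lookup x F" if "F \<in> Poly_Mapping.keys x" for F
        using subsetD[OF x(1) that] by (simp add: a_def inv_into_f_f[OF inj_on_rforest_coset])
      then have "(\<Sum>F\<in>Poly_Mapping.keys x. free_smult (a (?f F)) (Poly_Mapping.single F 1)) =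
          (\<Sum>F\<in>Poly_Mapping.keys x. free_smult (Poly_Mapping.lookup x F) (Poly_Mapping.single F 1))"
        by (intro sum.cong) (simp_all del: in_keys_iff)
      then have "y = Q.lincomb a (?f ` Poly_Mapping.keys x)"
        unfolding lincomb[OF finite_keys x(1)] by (simp add: sum_free_smult_single x(2))
      moreover have "finite (?f ` Poly_Mapping.keys x)" "?f ` Poly_Mapping.keys x \<subseteq> ?f ` RF D"
        using x(1) by (simp_all add: image_mono)
      ultimately show "y \<in> Q.span (?f ` RF D)"
        unfolding Q.span_def
        by (intro CollectI exI[of _ a] exI[of _ "?f ` Poly_Mapping.keys x"] conjI) auto
    qed
  qed
  ultimately show ?thesis unfolding V.basis_def using carrier by simp
qed

lemma HCK_com_prelie_simps [simp]:
  "carrier (HCK_com_prelie D) = {x. Poly_Mapping.keys x \<subseteq> RF D}" "add (HCK_com_prelie D) = (+)"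
  "zero (HCK_com_prelie D) = 0" "mult (HCK_com_prelie D) = rforest_mult_ext"
  "one (HCK_com_prelie D) = Poly_Mapping.single rforest_empty 1"
  "smult (HCK_com_prelie D) = free_smult"
  by (simp_all add: HCK_com_prelie_def)

text \<open>The quotient multiplies fibres by grafting their indices, and the identification is
  injective, so inverting it returns the grafting product.\<close>

lemma HCK_com_prelie_prelie:
  assumes x: "Poly_Mapping.keys x \<subseteq> RF D" and y: "Poly_Mapping.keys y \<subseteq> RF D"
  shows "x \<triangleleft>\<^bsub>HCK_com_prelie D\<^esub> y = rforest_prelie_ext x y"
proof -
  have "x \<triangleleft>\<^bsub>HCK_com_prelie D\<^esub> y =
      inv_into {x. Poly_Mapping.keys x \<subseteq> RF D} (HCK_ident D) (HCK_ident D x \<triangleleft>\<^bsub>CK_quotient D\<^esub> HCK_ident D y)"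
    by (simp add: HCK_com_prelie_def)
  also have "HCK_ident D x \<triangleleft>\<^bsub>CK_quotient D\<^esub> HCK_ident D y = HCK_ident D (rforest_prelie_ext x y)"
    using x y by (simp add: HCK_ident_eq CK_quotient_ops rforest_ext_closed)
  also have "inv_into {x. Poly_Mapping.keys x \<subseteq> RF D} (HCK_ident D) \<dots> = rforest_prelie_ext x y"
  proof (rule inv_into_f_f)
    show "inj_on (HCK_ident D) {x. Poly_Mapping.keys x \<subseteq> RF D}"
      by (rule inj_onI) (simp add: HCK_ident_eq fibre_inj)
  qed (simp add: rforest_ext_closed x y)
  finally show ?thesis .
qed

text \<open>The identity is a suitable bijection, since on the carrier the transported product is
  the grafting product and all other operations coincide.\<close>

lemma unitary_com_prelie_HCK:
  "unitary_com_prelie class_ring (HCK_com_prelie D :: ('k::field_char_0, _) com_prelie)"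
  by (rule unitary_com_prelie_transport[OF unitary_com_prelie_grafting_algebra[of D], where h = id])
     (simp_all add: HCK_com_prelie_prelie)

theorem proposition3p6:
  fixes D :: "'d set"
    and Q :: "('k::field_char_0, ('d ptree \<Rightarrow>\<^sub>0 'k) set) com_prelie"
    and H :: "('k, 'd rforest \<Rightarrow>\<^sub>0 'k) com_prelie"
    and pcoset :: "'d ptree \<Rightarrow> ('d ptree \<Rightarrow>\<^sub>0 'k) set"
    and fcoset :: "'d rforest \<Rightarrow> ('d ptree \<Rightarrow>\<^sub>0 'k) set"
    and \<iota> :: "('d rforest \<Rightarrow>\<^sub>0 'k) \<Rightarrow> ('d ptree \<Rightarrow>\<^sub>0 'k) set"
  defines "Q \<equiv> CK_quotient D"
    and "H \<equiv> HCK_com_prelie D"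
    and "pcoset \<equiv> ptree_coset D"
    and "fcoset \<equiv> rforest_coset D"
    and "\<iota> \<equiv> HCK_ident D"
  shows "(\<forall>T\<in>PT D. \<forall>T'\<in>PT D. forget_blocks T = forget_blocks T' \<longrightarrow> pcoset T = pcoset T')
    \<and> (\<forall>F\<in>RF D. \<exists>!X. \<exists>T\<in>PT D. forget_blocks T = F \<and> X = pcoset T)
    \<and> inj_on fcoset (RF D) \<and> vectorspace.basis class_ring Q (fcoset ` RF D)
    \<and> unitary_com_prelie class_ring Q
    \<and> \<iota> \<in> ring_iso (HCK D) Q \<and> \<iota> \<in> LinearCombinations.module_hom class_ring (HCK D) Q
    \<and> (\<forall>F\<in>RF D. \<iota> (Poly_Mapping.single F 1) = fcoset F)
    \<and> unitary_com_prelie class_ring H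
    \<and> (\<forall>x\<in>carrier H. \<forall>y\<in>carrier H. \<iota> (x \<triangleleft>\<^bsub>H\<^esub> y) = \<iota> x \<triangleleft>\<^bsub>Q\<^esub> \<iota> y)"
proof (intro conjI ballI impI)
  note defs = Q_def H_def pcoset_def fcoset_def \<iota>_def
  show "pcoset T = pcoset T'" if "T \<in> PT D" "T' \<in> PT D" "forget_blocks T = forget_blocks T'" for T T'
    using that by (simp add: defs ptree_coset_eq)
  show "\<exists>!X. \<exists>T\<in>PT D. forget_blocks T = F \<and> X = pcoset T" if F: "F \<in> RF D" for F
  proof (rule ex1I)
    show "\<exists>T\<in>PT D. forget_blocks T = F \<and> pcoset (coarse_ptree F) = pcoset T"
      using F by (intro bexI[of _ "coarse_ptree F"]) (simp_all add: forget_coarse coarse_in_PT)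
  qed (use F in \<open>auto simp: defs ptree_coset_eq coarse_in_PT forget_coarse\<close>)
  show "inj_on fcoset (RF D)" unfolding defs by (rule inj_on_rforest_coset)
  show "vectorspace.basis class_ring Q (fcoset ` RF D)" unfolding defs by (rule basis_CK_quotient)
  show "unitary_com_prelie class_ring Q" unfolding defs by (rule unitary_com_prelie_CK_quotient)
  show "unitary_com_prelie class_ring H" unfolding defs by (rule unitary_com_prelie_HCK)
  have fibre: "\<iota> x = forget_fibre D x" if "Poly_Mapping.keys x \<subseteq> RF D" for x
    using that by (simp add: defs HCK_ident_eq)
  have closed: "forget_fibre D x \<in> carrier Q" if "Poly_Mapping.keys x \<subseteq> RF D" for x
    using that by (simp add: defs carrier_CK_quotient)
  have "bij_betw \<iota> (carrier (HCK D)) (carrier Q)"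
    by (subst bij_betw_cong[of _ \<iota> "forget_fibre D"]) (simp_all add: fibre, simp add: defs bij_betw_fibre)
  then show "\<iota> \<in> ring_iso (HCK D) Q"
    unfolding ring_iso_def Ring.ring_hom_def
    by (auto simp: fibre closed rforest_ext_closed keys_add_subset rforest_empty_in_RF simp del: in_keys_iff)
       (simp_all add: defs CK_quotient_ops CK_quotient_zero_one)
  show "\<iota> \<in> LinearCombinations.module_hom class_ring (HCK D) Q"
    unfolding LinearCombinations.module_hom_def
    by (auto simp: fibre closed keys_add_subset keys_free_smult_subset simp del: in_keys_iff)
       (simp_all add: defs CK_quotient_ops CK_quotient_smult)
  show "\<iota> (Poly_Mapping.single F 1) = fcoset F" if "F \<in> RF D" for F
    using that by (simp add: fibre) (simp add: defs rforest_coset_eq)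
  show "\<iota> (x \<triangleleft>\<^bsub>H\<^esub> y) = \<iota> x \<triangleleft>\<^bsub>Q\<^esub> \<iota> y" if "x \<in> carrier H" "y \<in> carrier H" for x y
    using that by (simp add: defs HCK_com_prelie_prelie HCK_ident_eq CK_quotient_ops rforest_ext_closed)
qed

end
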